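(* Let $\phi\colon\mathbb{R}\to\mathbb{R}$ be an increasing homeomorphism with $\phi(0)=0$, $f,q\colon\mathbb{R}\to\mathbb{R}$ continuous, $a\in L^\infty(0,T)$ with $a(t)\ge0$ a.e. and $\bar a:=\frac1T\int_0^Ta>0$, and $e\in L^1(0,T)$ with $\frac1T\int_0^Te=0$. Assume the limits $\omega_\pm:=\lim_{u\to\pm\infty}q(u)\in[-\infty,+\infty]$ exist. Consider $$(\phi(u'))'+f(u)u'+a(t)q(u)=s+e(t).\qquad(\mathscr{W\!E}_s)$$ Assume there exists $D>0$ such that $q(u)>\omega_-$ for $u\le-D$ and $q(u)>\omega_+$ for $u\ge D$, and that $\max\{\omega_-,\omega_+\}>-\infty$. Then there exists $s_0\in\,]\bar a\omega_-,+\infty[$ such that: for $s>s_0$, $(\mathscr{W\!E}_s)$ has no $T$-periodic solutions; for $s=s_0$, at least one; for $\bar a\omega_-<s<s_0$, at least one; for $\bar a\max\{\omega_-,\omega_+\}<s<s_0$, at least two $T$-periodic solutions.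
   Context: A $T$-periodic solution is $u\in\mathcal{C}^1([0,T])$ with $u(0)=u(T)$, $u'(0)=u'(T)$, $\phi(u')$ absolutely continuous, satisfying the equation a.e. Products such as $\bar a\cdot(-\infty)$ are $-\infty$. *)

theory Defs
  imports "HOL-Analysis.Analysis"
begin

definition abs_cont_on :: "(real \<Rightarrow> real) \<Rightarrow> real \<Rightarrow> real \<Rightarrow> bool" where
  "abs_cont_on g a b \<longleftrightarrow>
     (\<forall>\<epsilon>>0. \<exists>\<delta>>0. \<forall>(n::nat) (xs::nat \<Rightarrow> real) (ys::nat \<Rightarrow> real).
        (\<forall>i<n. a \<le> xs i \<and> xs i \<le> ys i \<and> ys i \<le> b) \<and>
        (\<forall>i<n. \<forall>j<n. i \<noteq> j \<longrightarrow> ys i \<le> xs j \<or> ys j \<le> xs i) \<and>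
        (\<Sum>i<n. ys i - xs i) < \<delta>
        \<longrightarrow> (\<Sum>i<n. \<bar>g (ys i) - g (xs i)\<bar>) < \<epsilon>)"

definition periodic_sol ::
  "(real \<Rightarrow> real) \<Rightarrow> (real \<Rightarrow> real) \<Rightarrow> (real \<Rightarrow> real) \<Rightarrow> (real \<Rightarrow> real) \<Rightarrow>
   (real \<Rightarrow> real) \<Rightarrow> real \<Rightarrow> real \<Rightarrow> (real \<Rightarrow> real) \<Rightarrow> bool" where
  "periodic_sol phi f a q e s T u \<longleftrightarrow>
     (\<exists>u'. (\<forall>t\<in>{0..T}. (u has_real_derivative u' t) (at t within {0..T})) \<and>
           continuous_on {0..T} u' \<and>
           u 0 = u T \<and> u' 0 = u' T \<and>
           abs_cont_on (\<lambda>t. phi (u' t)) 0 T \<and>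
           (AE t in lebesgue. t \<in> {0..T} \<longrightarrow>
              (\<exists>D. ((\<lambda>\<tau>. phi (u' \<tau>)) has_real_derivative D) (at t within {0..T}) \<and>
                   D + f (u t) * u' t + a t * q (u t) = s + e t)))"

end

theory Submission
  imports Defs "HOL-Complex_Analysis.Great_Picard"
begin

text \<open>
  With \<open>F' = f\<close> the equation reads \<open>(\<phi>(u') + F(u))' = s + e - a q(u)\<close>, and \<open>s T = \<integral> a q(u)\<close> for a
  periodic solution. As \<open>q\<close> is bounded above, testing with functions of \<open>u\<close> bounds \<open>u'\<close> independently of \<open>f\<close>,
  so solutions that are far out on one side have \<open>s\<close> close to the mean of \<open>a\<close> times \<open>\<omega>\<^sub>-\<close> or \<open>\<omega>\<^sub>+\<close>.

  Degree theory is replaced by a continuation principle that follows from Schauder's theorem. Fix a solution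
  \<open>\<alpha>\<close> at a level \<open>s' > s\<close> and look for pairs \<open>(u, \<sigma>)\<close> such that \<open>u\<close> solves the equation at level \<open>\<sigma>\<close> and
  \<open>min (u - \<alpha>) = r\<close>. For \<open>r = 0\<close> the solution touches \<open>\<alpha>\<close> from above, which forces \<open>\<sigma> \<ge> s' > s\<close>, while for
  \<open>r\<close> near \<open>-\<infinity>\<close>, and near \<open>+\<infinity>\<close> when \<open>s\<close> exceeds the value at \<open>\<omega>\<^sub>+\<close>, one has \<open>\<sigma> < s\<close>. Hence \<open>\<sigma> = s\<close> for some
  \<open>r < 0\<close>, and in the second case also for some \<open>r > 0\<close>. The critical \<open>s\<^sub>0\<close> is the supremum of the solvable
  levels; it is attained by compactness.
\<close>

text \<open>At a fixed level the periodic problem has the constants as kernel and the mean condition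
  as obstruction. Letting the mean condition define the level \<sigma>, and prescribing
  \<open>min (u - \<alpha>)\<close> instead, removes both at once: for every \<open>r\<close> there
  is a fixed point problem on a compact convex set, and only the scalar \<sigma> remains to be
  tuned. The obstacle is that nothing is assumed about size or sign of \<open>f\<close>, and that
  \<open>q\<close> may tend to -\<infinity>. Both are met by truncation, which needs bounds that the
  truncation does not disturb. The bound on \<open>u'\<close> comes from the range of
  \<open>c + H\<close> alone, so it survives replacing \<open>F\<close> by any continuous function;
  and it sees \<open>q\<close> only through an upper bound, which cutting off the argument of
  \<open>q\<close> preserves. That \<open>q\<close> lies strictly above its limits far out serves
  three purposes: it excludes the limit +\<infinity>, it yields a first solvable level above the
  value at \<open>\<omega>\<^sub>-\<close>, and it locates solutions when \<open>s\<close> does not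
  exceed the value at \<open>\<omega>\<^sub>+\<close>, where at equality the limit alone decides
  nothing.\<close>

section \<open>Fixed points\<close>

text \<open>The labels record whether \<open>f\<close> moves a coordinate up or down. Kuhn's lemma
  on a grid of mesh \<open>1 / Suc m\<close> gives a cell in which every coordinate below
  \<open>n\<close> carries both labels, and compactness of the product of intervals lets these cells
  shrink to a point. The cube sits in a function type so that \<open>n\<close> can be chosen inside
  a proof: in \<open>schauder\<close> it is the size of a net.\<close>

lemma brouwer_cube_nat:
  fixes f :: "(nat \<Rightarrow> real) \<Rightarrow> (nat \<Rightarrow> real)" and n :: nat
  defines "S \<equiv> PiE UNIV (\<lambda>_. {0..1})"
  assumes cont: "continuous_on S f" and maps: "f ` S \<subseteq> S"
  shows "\<exists>x\<in>S. \<forall>i<n. f x i = x i"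
proof -
  have S: "x \<in> S \<longleftrightarrow> (\<forall>i. 0 \<le> x i \<and> x i \<le> 1)" for x
    by (auto simp: S_def PiE_def Pi_def)
  have cS: "compact S"
    unfolding S_def compactin_euclidean_iff[symmetric] euclidean_product_topology[symmetric]
    by (subst compactin_PiE) (simp add: compactin_euclidean_iff)
  obtain label :: "(nat \<Rightarrow> real) \<Rightarrow> nat \<Rightarrow> nat" where label:
     "\<And>x i. label x i \<le> 1"
     "\<And>x i. x \<in> S \<Longrightarrow> x i = 0 \<Longrightarrow> label x i = 0"
     "\<And>x i. x \<in> S \<Longrightarrow> x i = 1 \<Longrightarrow> label x i = 1"
     "\<And>x i. x \<in> S \<Longrightarrow> label x i = 0 \<Longrightarrow> x i \<le> f x i"
     "\<And>x i. x \<in> S \<Longrightarrow> label x i = 1 \<Longrightarrow> f x i \<le> x i"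
  proof -
    have k1: "\<forall>x. x \<in> S \<longrightarrow> f x \<in> S" using maps by auto
    have k2: "\<forall>x. x \<in> S \<longrightarrow> (\<forall>i. True \<longrightarrow> 0 \<le> x i \<and> x i \<le> 1)" by (simp add: S)
    obtain l :: "(nat \<Rightarrow> real) \<Rightarrow> nat \<Rightarrow> nat" where l: "\<forall>x i. l x i \<le> 1"
      "\<forall>x i. x \<in> S \<and> True \<and> x i = 0 \<longrightarrow> l x i = 0"
      "\<forall>x i. x \<in> S \<and> True \<and> x i = 1 \<longrightarrow> l x i = 1"
      "\<forall>x i. x \<in> S \<and> True \<and> l x i = 0 \<longrightarrow> x i \<le> f x i"
      "\<forall>x i. x \<in> S \<and> True \<and> l x i = 1 \<longrightarrow> f x i \<le> x i"
      using kuhn_labelling_lemma'[where P = "\<lambda>x. x \<in> S" and Q = "\<lambda>_. True" and f = f, OF k1 k2]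
      by (elim exE conjE) (rule that)
    show ?thesis by (rule that[of l]) (use l in simp_all)
  qed
  have ex: "\<exists>z\<in>S. \<forall>i<n. \<exists>a\<in>S. \<exists>b\<in>S. (\<forall>j. \<bar>a j - z j\<bar> \<le> 1 / real (Suc m)) \<and>
      (\<forall>j. \<bar>b j - z j\<bar> \<le> 1 / real (Suc m)) \<and> a i \<le> f a i \<and> f b i \<le> b i" for m
  proof -
    define p where "p = Suc m"
    define pt where "pt x = (\<lambda>i. if i < n then real (x i) / real p else 0)" for x :: "nat \<Rightarrow> nat"
    have p0: "0 < p" by (simp add: p_def)
    have ptS: "pt x \<in> S" if "\<forall>i<n. x i \<le> p" for x
      using that p0 by (auto simp: S pt_def)
    obtain q where q: "\<forall>i<n. q i < p"
      and qq: "\<forall>i<n. \<exists>r s. (\<forall>j<n. q j \<le> r j \<and> r j \<le> q j + 1) \<and>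
          (\<forall>j<n. q j \<le> s j \<and> s j \<le> q j + 1) \<and> label (pt r) i \<noteq> label (pt s) i"
    proof (rule kuhn_lemma[of p n "\<lambda>x. label (pt x)"])
      show "\<forall>x. (\<forall>i<n. x i \<le> p) \<longrightarrow> (\<forall>i<n. label (pt x) i = 0 \<or> label (pt x) i = 1)"
        using label(1) by (metis less_one nat_less_le)
      show "\<forall>x. (\<forall>i<n. x i \<le> p) \<longrightarrow> (\<forall>i<n. x i = 0 \<longrightarrow> label (pt x) i = 0)"
        using label(2) ptS by (auto simp: pt_def)
      show "\<forall>x. (\<forall>i<n. x i \<le> p) \<longrightarrow> (\<forall>i<n. x i = p \<longrightarrow> label (pt x) i = 1)"
        using label(3) ptS p0 by (auto simp: pt_def)
    qed (use p0 in auto)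
    have near: "pt r \<in> S \<and> (\<forall>j. \<bar>pt r j - pt q j\<bar> \<le> 1 / real (Suc m))"
      if qr: "\<forall>j<n. q j \<le> r j \<and> r j \<le> q j + 1" for r
    proof
      show "pt r \<in> S" using that q by (intro ptS) (metis Suc_eq_plus1 Suc_leI le_trans)
      have "\<bar>real (r j) / real p - real (q j) / real p\<bar> \<le> 1 / real p" if "j < n" for j
      proof -
        have "real (q j) \<le> real (r j)" "real (r j) \<le> real (q j) + 1"
          using qr that by (auto simp flip: of_nat_Suc)
        then have "\<bar>real (r j) - real (q j)\<bar> / real p \<le> 1 / real p"
          by (intro divide_right_mono) auto
        then show ?thesis by (simp add: abs_divide flip: diff_divide_distrib)
      qed
      then show "\<forall>j. \<bar>pt r j - pt q j\<bar> \<le> 1 / real (Suc m)"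
        by (auto simp: pt_def p_def)
    qed
    show ?thesis
    proof (rule bexI[of _ "pt q"], intro allI impI)
      show "pt q \<in> S" using q by (intro ptS) auto
      fix i assume "i < n"
      then obtain r s where r: "\<forall>j<n. q j \<le> r j \<and> r j \<le> q j + 1"
        and s: "\<forall>j<n. q j \<le> s j \<and> s j \<le> q j + 1" and ne: "label (pt r) i \<noteq> label (pt s) i"
        using qq by blast
      consider "label (pt r) i = 0" "label (pt s) i = 1" | "label (pt r) i = 1" "label (pt s) i = 0"
        using ne label(1) by (metis less_one nat_less_le)
      then show "\<exists>a\<in>S. \<exists>b\<in>S. (\<forall>j. \<bar>a j - pt q j\<bar> \<le> 1 / real (Suc m)) \<and>
        (\<forall>j. \<bar>b j - pt q j\<bar> \<le> 1 / real (Suc m)) \<and> a i \<le> f a i \<and> f b i \<le> b i"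
        using near[OF r] near[OF s] label(4,5) by cases blast+
    qed
  qed
  then obtain z where zS: "\<And>m. z m \<in> S" and zz: "\<And>m. \<forall>i<n. \<exists>a\<in>S. \<exists>b\<in>S.
      (\<forall>j. \<bar>a j - z m j\<bar> \<le> 1 / real (Suc m)) \<and>
      (\<forall>j. \<bar>b j - z m j\<bar> \<le> 1 / real (Suc m)) \<and> a i \<le> f a i \<and> f b i \<le> b i"
    by metis
  obtain x k where x: "x \<in> S" "strict_mono (k :: nat \<Rightarrow> nat)" "(z \<circ> k) \<longlonglongrightarrow> x"
    using cS zS unfolding compact_def by metis
  show ?thesis
  proof (intro bexI allI impI)
    show "x \<in> S" by fact
    fix i assume "i < n"
    define Q where "Q m a b \<longleftrightarrow> a \<in> S \<and> b \<in> S \<and> (\<forall>j. \<bar>a j - z m j\<bar> \<le> 1 / real (Suc m)) \<and>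
      (\<forall>j. \<bar>b j - z m j\<bar> \<le> 1 / real (Suc m)) \<and> a i \<le> f a i \<and> f b i \<le> b i" for m a b
    have "\<forall>m. \<exists>a b. Q m a b"
      unfolding Q_def using zz \<open>i < n\<close> by blast
    then obtain a b where "\<forall>m. Q m (a m) (b m)" by metis
    then have ab: "\<And>m. a m \<in> S" "\<And>m. b m \<in> S"
      "\<And>m j. \<bar>a m j - z m j\<bar> \<le> 1 / real (Suc m)" "\<And>m j. \<bar>b m j - z m j\<bar> \<le> 1 / real (Suc m)"
      "\<And>m. a m i \<le> f (a m) i" "\<And>m. f (b m) i \<le> b m i"
      unfolding Q_def by blast+
    have coord: "(\<lambda>m. h m j) \<longlonglongrightarrow> y j" if "h \<longlonglongrightarrow> y" for h :: "nat \<Rightarrow> nat \<Rightarrow> real" and y j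
      using continuous_on_tendsto_compose[OF continuous_on_product_coordinates[of j] that] by simp
    have lim: "(\<lambda>m. h (k m)) \<longlonglongrightarrow> x" if h: "\<And>m j. \<bar>h m j - z m j\<bar> \<le> 1 / real (Suc m)" for h
    proof -
      have "(\<lambda>m. h (k m) j) \<longlonglongrightarrow> x j" for j
      proof (rule Lim_transform)
        show "(\<lambda>m. z (k m) j) \<longlonglongrightarrow> x j" using coord[OF x(3)] by simp
        have "(\<lambda>m. 1 / real (Suc (k m))) \<longlonglongrightarrow> 0"
          using LIMSEQ_subseq_LIMSEQ[OF LIMSEQ_Suc[OF lim_1_over_n] x(2)] by (simp add: o_def)
        then show "(\<lambda>m. h (k m) j - z (k m) j) \<longlonglongrightarrow> 0"
          by (rule Lim_null_comparison[rotated]) (use h in \<open>auto simp: abs_minus_commute intro!: always_eventually\<close>)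
      qed
      then have "limitin (product_topology (\<lambda>i. euclidean) UNIV) (\<lambda>m. h (k m)) x sequentially"
        by (subst limitin_componentwise) auto
      then show ?thesis by (simp add: euclidean_product_topology)
    qed
    have fl: "(\<lambda>m. f (h (k m)) i) \<longlonglongrightarrow> f x i" if h: "\<And>m. h m \<in> S" "(\<lambda>m. h (k m)) \<longlonglongrightarrow> x" for h
      using coord[of "\<lambda>m. f (h (k m))" "f x" i] continuous_on_tendsto_compose[OF cont h(2) x(1)] h(1) by auto
    have "x i \<le> f x i"
      by (rule LIMSEQ_le[OF coord[OF lim[OF ab(3)]] fl[OF ab(1) lim[OF ab(3)]]]) (use ab(5) in auto)
    moreover have "f x i \<le> x i"
      by (rule LIMSEQ_le[OF fl[OF ab(2) lim[OF ab(4)]] coord[OF lim[OF ab(4)]]]) (use ab(6) in auto)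
    ultimately show "f x i = x i" by simp
  qed
qed

text \<open>The finite-dimensional subproblem lives in the convex hull of a finite net of \<open>f ` K\<close>.
  The cube is mapped into this hull by normalising weights; the mass missing up to 1 is put on the
  base point, which keeps the normalisation away from division by zero.\<close>
theorem schauder:
  fixes f :: "'a::real_normed_vector \<Rightarrow> 'a"
  assumes K: "compact K" "convex K" "K \<noteq> {}" and cont: "continuous_on K f" and maps: "f ` K \<subseteq> K"
  shows "\<exists>x\<in>K. f x = x"
proof -
  have approx: "\<exists>x\<in>K. norm (f x - x) \<le> \<epsilon>" if "\<epsilon> > 0" for \<epsilon>
  proof -
    have "compact (f ` K)" using K(1) cont by (rule compact_continuous_image[rotated])
    from seq_compact_imp_totally_bounded[OF compact_imp_seq_compact[OF this], rule_format, OF that]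
    obtain N where N: "finite N" "N \<subseteq> f ` K" "f ` K \<subseteq> (\<Union>x\<in>N. ball x \<epsilon>)"
      by (elim exE conjE) (rule that)
    obtain n :: nat and x where xn: "N = x ` {..<n}" 
      using N(1) finite_imp_nat_seg_image_inj_on[of N] unfolding lessThan_def by blast
    have xK: "x i \<in> K" if "i < n" for i using xn N(2) maps that by auto
    obtain b where b: "b \<in> K" using K(3) by auto
    define S where "S = PiE UNIV (\<lambda>_::nat. {0..1::real})"
    have S: "t \<in> S \<longleftrightarrow> (\<forall>i. 0 \<le> t i \<and> t i \<le> 1)" for t
      by (auto simp: S_def PiE_def Pi_def)
    define W where "W t = (\<Sum>i<n. t i)" for t :: "nat \<Rightarrow> real"
    define X where "X t = (1 / max 1 (W t)) *\<^sub>R ((\<Sum>i<n. t i *\<^sub>R x i) + max 0 (1 - W t) *\<^sub>R b)" for t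
    \<comment> \<open>The Schauder weights before normalisation: \<open>m i\<close> is positive
      exactly on the open ball of radius \<epsilon> about \<open>x i\<close>, so averaging the net
      points with these weights moves \<open>y\<close> by at most \<epsilon>. The fixed point is
      sought among weight vectors, not among points of \<open>K\<close>.\<close>
    define m where "m i y = max 0 (\<epsilon> - norm (y - x i))" for i y
    define M where "M y = (\<Sum>i<n. m i y)" for y
    have W0: "0 \<le> W t" if "t \<in> S" for t
      using that by (auto simp: W_def S intro!: sum_nonneg)
    have XK: "X t \<in> K" if t: "t \<in> S" for t
    proof -
      have eq: "X t = (\<Sum>i<Suc n. ((if i < n then t i else max 0 (1 - W t)) / max 1 (W t)) *\<^sub>R (if i < n then x i else b))"
        by (simp add: X_def scaleR_right_distrib scaleR_sum_right)
      show ?thesis unfolding eq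
      proof (rule convex_sum)
        show "(\<Sum>i<Suc n. (if i < n then t i else max 0 (1 - W t)) / max 1 (W t)) = 1"
          by (simp add: W_def flip: sum_divide_distrib add_divide_distrib)
             (auto simp: max_def)
      qed (use t b xK K(2) in \<open>auto simp: S\<close>)
    qed
    have Mpos: "M y > 0" if y: "y \<in> f ` K" for y
    proof -
      obtain i where i: "i < n" "dist (x i) y < \<epsilon>" using N(3) y unfolding xn by auto
      then have "0 < m i y" by (simp add: m_def dist_norm norm_minus_commute)
      then show ?thesis unfolding M_def using i(1)
        by (intro sum_pos2[where i=i]) (auto simp: m_def)
    qed
    define G where "G t i = (if i < n then m i (f (X t)) / M (f (X t)) else 0)" for t i
    have m0: "0 \<le> m i y" for i y by (simp add: m_def)
    have mM: "m i y \<le> M y" if "i < n" for i y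
      unfolding M_def using that by (intro member_le_sum) (auto simp: m0)
    have GS: "G ` S \<subseteq> S"
    proof
      fix g assume "g \<in> G ` S"
      then obtain t where t: "t \<in> S" "g = G t" by auto
      have "0 < M (f (X t))" using Mpos XK t by auto
      then show "g \<in> S" using m0 mM by (auto simp: S t(2) G_def divide_le_eq_1)
    qed
    have cX: "continuous_on S X"
      unfolding X_def W_def
      by (intro continuous_intros continuous_on_subset[OF continuous_on_product_coordinates]) auto
    have cfX: "continuous_on S (\<lambda>t. f (X t))"
      by (rule continuous_on_compose2[OF cont cX]) (use XK in auto)
    have cG: "continuous_on S G"
    proof (rule continuous_on_coordinatewise_then_product)
      fix i
      show "continuous_on S (\<lambda>t. G t i)"
      proof (cases "i < n")
        case True
        have "M (f (X t)) \<noteq> 0" if "t \<in> S" for t using Mpos[of "f (X t)"] XK[OF that] by auto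
        then have "continuous_on S (\<lambda>t. m i (f (X t)) / M (f (X t)))"
          unfolding M_def m_def
          by (intro continuous_intros cfX) auto
        then show ?thesis using True by (simp add: G_def)
      qed (simp add: G_def)
    qed
    obtain t where t: "t \<in> S" "\<forall>i<n. G t i = t i"
      using brouwer_cube_nat[of G n] cG GS unfolding S_def by blast
    define y where "y = f (X t)"
    have My: "M y > 0" using Mpos XK t(1) by (auto simp: y_def)
    have ti: "t i = m i y / M y" if "i < n" for i using t(2) that by (auto simp: G_def y_def)
    \<comment> \<open>Normalised weights sum to 1, so at the fixed point the mass on
      \<open>b\<close> vanishes and \<open>X t\<close> is an average of net points only.\<close>
    have W1: "W t = 1" unfolding W_def using My ti by (simp add: M_def flip: sum_divide_distrib)
    have Xt: "X t = (\<Sum>i<n. t i *\<^sub>R x i)" by (simp add: X_def W1)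
    have "y - X t = (\<Sum>i<n. t i *\<^sub>R (y - x i))"
      using W1 by (simp add: Xt W_def scaleR_diff_right sum_subtractf flip: scaleR_sum_left)
    also have "norm \<dots> \<le> (\<Sum>i<n. t i * \<epsilon>)"
    proof (rule sum_norm_le)
      fix i assume "i \<in> {..<n}"
      then have i: "i < n" by simp
      show "norm (t i *\<^sub>R (y - x i)) \<le> t i * \<epsilon>"
      proof (cases "m i y = 0")
        case False
        then have "norm (y - x i) \<le> \<epsilon>" by (auto simp: m_def)
        then show ?thesis using t(1) by (auto simp: S intro: mult_left_mono)
      qed (use i in \<open>simp add: ti\<close>)
    qed
    also have "\<dots> = \<epsilon>" using W1 by (simp add: W_def flip: sum_distrib_right)
    finally have "norm (f (X t) - X t) \<le> \<epsilon>" by (simp add: y_def)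
    then show ?thesis using XK[OF t(1)] by blast
  qed
  have "continuous_on K (\<lambda>x. norm (f x - x))" by (intro continuous_intros cont)
  then obtain x where x: "x \<in> K" "\<And>y. y \<in> K \<Longrightarrow> norm (f x - x) \<le> norm (f y - y)"
    using continuous_attains_inf[OF K(1,3)] by blast
  have "norm (f x - x) = 0"
  proof (rule ccontr)
    assume "norm (f x - x) \<noteq> 0"
    then obtain y where "y \<in> K" "norm (f y - y) \<le> norm (f x - x) / 2"
      using approx[of "norm (f x - x) / 2"] by auto
    then show False using x(2)[of y] \<open>norm (f x - x) \<noteq> 0\<close> by (smt (verit) field_sum_of_halves norm_ge_zero)
  qed
  then show ?thesis using x(1) by auto
qed

text \<open>The part of \<open>K\<close> where \<open>k\<close> is nonnegative is compact and avoids
  the zeros of \<open>h\<close>, so \<open>h\<close> has a positive minimum there, against which the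
  maximum of \<open>k\<close> can be weighed. Elsewhere the sign of \<open>k\<close>
  suffices.\<close>

lemma dominated_by_penalty:
  fixes h k :: "'a::t2_space \<Rightarrow> real"
  assumes K: "compact K" "K \<noteq> {}" and h: "continuous_on K h" "\<And>x. x \<in> K \<Longrightarrow> 0 \<le> h x"
    and k: "continuous_on K k" and neg: "\<And>x. x \<in> K \<Longrightarrow> h x = 0 \<Longrightarrow> k x < 0"
  shows "\<exists>M\<ge>0. \<forall>x\<in>K. k x < M * h x"
proof (cases "\<exists>x\<in>K. k x \<ge> 0")
  case False
  then show ?thesis by (intro exI[of _ 0]) auto
next
  case True
  obtain x0 where x0: "x0 \<in> K" "\<And>x. x \<in> K \<Longrightarrow> k x \<le> k x0"
    using continuous_attains_sup[OF K k] by blast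
  have "compact (K \<inter> (K \<inter> k -` {0..}))"
    using K(1) k by (intro compact_Int_closed continuous_closed_preimage) (auto intro: compact_imp_closed)
  then have "compact (K \<inter> k -` {0..})" by (simp flip: Int_assoc)
  then have "\<exists>x1 \<in> K \<inter> k -` {0..}. \<forall>x \<in> K \<inter> k -` {0..}. h x1 \<le> h x"
    using True by (intro continuous_attains_inf continuous_on_subset[OF h(1)]) auto
  then obtain x1 where x1: "x1 \<in> K" "k x1 \<ge> 0" "\<And>x. x \<in> K \<Longrightarrow> k x \<ge> 0 \<Longrightarrow> h x1 \<le> h x"
    by auto
  have h1: "h x1 > 0" using neg[OF x1(1)] h(2)[OF x1(1)] x1(2) by fastforce
  have k0: "0 \<le> k x0" using x0(2)[OF x1(1)] x1(2) by simp
  show ?thesis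
  proof (intro exI[of _ "(k x0 + 1) / h x1"] conjI ballI)
    show M: "0 \<le> (k x0 + 1) / h x1" using h1 k0 by simp
    fix x assume x: "x \<in> K"
    show "k x < (k x0 + 1) / h x1 * h x"
    proof (cases "k x \<ge> 0")
      case True
      have "k x < (k x0 + 1) / h x1 * h x1" using x0(2)[OF x] h1 by simp
      also have "\<dots> \<le> (k x0 + 1) / h x1 * h x" by (intro mult_left_mono x1(3) x True M)
      finally show ?thesis .
    next
      case False
      have "0 \<le> (k x0 + 1) / h x1 * h x" by (intro mult_nonneg_nonneg M h(2) x)
      then show ?thesis using False by linarith
    qed
  qed
qed

text \<open>Schauder's theorem for the pair \<open>(r, x)\<close> replaces the degree-theoretic continuation principle:
  subtracting a multiple of the residual \<open>norm (V r x - x)\<close> at one end and adding it at the other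
  gives \<open>g\<close> a definite sign on all of \<open>K\<close> at both ends without changing it at fixed points.\<close>
theorem fixpoint_continuation:
  fixes V :: "real \<Rightarrow> 'a::real_normed_vector \<Rightarrow> 'a" and g :: "real \<Rightarrow> 'a \<Rightarrow> real"
  assumes r: "r1 < r2" and K: "compact K" "convex K" "K \<noteq> {}"
    and cV: "continuous_on ({r1..r2} \<times> K) (\<lambda>z. V (fst z) (snd z))"
    and maps: "\<And>r x. r \<in> {r1..r2} \<Longrightarrow> x \<in> K \<Longrightarrow> V r x \<in> K"
    and cg: "continuous_on ({r1..r2} \<times> K) (\<lambda>z. g (fst z) (snd z))"
    and neg: "\<And>x. x \<in> K \<Longrightarrow> V r1 x = x \<Longrightarrow> g r1 x < 0"
    and pos: "\<And>x. x \<in> K \<Longrightarrow> V r2 x = x \<Longrightarrow> g r2 x > 0"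
  shows "\<exists>r\<in>{r1..r2}. \<exists>x\<in>K. V r x = x \<and> g r x = 0"
proof -
  have slice: "continuous_on K (\<lambda>x. h r' x)"
    if "continuous_on ({r1..r2} \<times> K) (\<lambda>z. h (fst z) (snd z))" "r' \<in> {r1..r2}"
    for h :: "real \<Rightarrow> 'a \<Rightarrow> 'b::topological_space" and r'
  proof -
    have "continuous_on K (\<lambda>x. (\<lambda>z. h (fst z) (snd z)) (r', x))"
      using that by (intro continuous_on_compose2[OF that(1)] continuous_intros) auto
    then show ?thesis by simp
  qed
  obtain M1 where M1: "M1 \<ge> 0" "\<And>x. x \<in> K \<Longrightarrow> g r1 x < M1 * norm (V r1 x - x)"
    using dominated_by_penalty[OF K(1,3), of "\<lambda>x. norm (V r1 x - x)" "g r1"] r neg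
    by (force intro!: continuous_intros slice[OF cV] slice[OF cg])
  obtain M2 where M2: "M2 \<ge> 0" "\<And>x. x \<in> K \<Longrightarrow> - g r2 x < M2 * norm (V r2 x - x)"
    using dominated_by_penalty[OF K(1,3), of "\<lambda>x. norm (V r2 x - x)" "\<lambda>x. - g r2 x"] r pos
    by (force intro!: continuous_intros slice[OF cV] slice[OF cg])
  define G where "G r x = g r x + ((r - r1) * M2 - (r2 - r) * M1) / (r2 - r1) * norm (V r x - x)" for r x
  define \<Phi> where "\<Phi> z = (max r1 (min r2 (fst z - G (fst z) (snd z))), V (fst z) (snd z))" for z
  have c\<Phi>: "continuous_on ({r1..r2} \<times> K) \<Phi>"
    unfolding \<Phi>_def G_def using r by (intro continuous_intros cV cg) auto
  have "\<Phi> ` ({r1..r2} \<times> K) \<subseteq> {r1..r2} \<times> K"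
    using r maps by (auto simp: \<Phi>_def)
  moreover have "compact ({r1..r2} \<times> K)" "convex ({r1..r2} \<times> K)" "{r1..r2} \<times> K \<noteq> {}"
    using K r by (auto intro: compact_Times convex_Times)
  ultimately have "\<exists>z\<in>{r1..r2} \<times> K. \<Phi> z = z"
    by (intro schauder c\<Phi>)
  then obtain r' x where rx: "r' \<in> {r1..r2}" "x \<in> K" "\<Phi> (r', x) = (r', x)"
    by auto
  have V: "V r' x = x" using rx(3) by (simp add: \<Phi>_def)
  have G: "G r' x = g r' x" by (simp add: G_def V)
  have clamp_period: "max r1 (min r2 (r' - g r' x)) = r'" using rx(3) by (simp add: \<Phi>_def G)
  \<comment> \<open>A positive value of \<open>g\<close> pushes the level down, so clamping can
    restore it only at \<open>r1\<close>; a negative one only at \<open>r2\<close>. Both contradict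
    the prescribed end signs.\<close>
  have "g r' x = 0"
  proof (rule ccontr)
    assume "g r' x \<noteq> 0"
    then consider "r' = r1" "g r' x > 0" | "r' = r2" "g r' x < 0"
      using clamp_period r by (auto simp: max_def min_def split: if_splits)
    then show False using neg[OF rx(2)] pos[OF rx(2)] V by cases auto
  qed
  then show ?thesis using rx V by blast
qed

section \<open>Absolutely continuous functions\<close>

text \<open>Tagged divisions are indexed by pairs of a tag and an interval; a bijection with an
  initial segment of \<open>nat\<close> transports the estimate to them.\<close>

lemma abs_cont_on_finite_family:
  assumes "abs_cont_on g a b" "\<epsilon> > 0"
  shows "\<exists>\<delta>>0. \<forall>I (xs :: 'i \<Rightarrow> real) ys. finite I \<and> (\<forall>i\<in>I. a \<le> xs i \<and> xs i \<le> ys i \<and> ys i \<le> b) \<and>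
      (\<forall>i\<in>I. \<forall>j\<in>I. i \<noteq> j \<longrightarrow> ys i \<le> xs j \<or> ys j \<le> xs i) \<and>
      (\<Sum>i\<in>I. ys i - xs i) < \<delta> \<longrightarrow> (\<Sum>i\<in>I. \<bar>g (ys i) - g (xs i)\<bar>) < \<epsilon>"
proof -
  obtain \<delta> where \<delta>: "\<delta> > 0" and ac: "\<forall>(n::nat) (xs::nat \<Rightarrow> real) (ys::nat \<Rightarrow> real).
        (\<forall>i<n. a \<le> xs i \<and> xs i \<le> ys i \<and> ys i \<le> b) \<and>
        (\<forall>i<n. \<forall>j<n. i \<noteq> j \<longrightarrow> ys i \<le> xs j \<or> ys j \<le> xs i) \<and>
        (\<Sum>i<n. ys i - xs i) < \<delta>
        \<longrightarrow> (\<Sum>i<n. \<bar>g (ys i) - g (xs i)\<bar>) < \<epsilon>"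
    using assms unfolding abs_cont_on_def by blast
  show ?thesis
  proof (intro exI[of _ \<delta>] conjI \<delta> allI impI, elim conjE)
    fix I and xs ys :: "'i \<Rightarrow> real"
    assume I: "finite I" and 1: "\<forall>i\<in>I. a \<le> xs i \<and> xs i \<le> ys i \<and> ys i \<le> b"
      and 2: "\<forall>i\<in>I. \<forall>j\<in>I. i \<noteq> j \<longrightarrow> ys i \<le> xs j \<or> ys j \<le> xs i"
      and 3: "(\<Sum>i\<in>I. ys i - xs i) < \<delta>"
    obtain h where h: "bij_betw h {..<card I} I"
      using ex_bij_betw_nat_finite[OF I] by (auto simp: atLeast0LessThan)
    have hI: "h i \<in> I" if "i < card I" for i using h that by (auto simp: bij_betw_def)
    have hinj: "h i \<noteq> h j" if "i < card I" "j < card I" "i \<noteq> j" for i j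
      using h that by (auto simp: bij_betw_def inj_on_def)
    have "(\<Sum>i<card I. ys (h i) - xs (h i)) = (\<Sum>i\<in>I. ys i - xs i)"
      by (rule sum.reindex_bij_betw[OF h])
    then have "(\<Sum>i<card I. \<bar>g (ys (h i)) - g (xs (h i))\<bar>) < \<epsilon>"
      using ac[rule_format, of "card I" "\<lambda>i. xs (h i)" "\<lambda>i. ys (h i)"] 1 2 3 hI hinj by simp
    then show "(\<Sum>i\<in>I. \<bar>g (ys i) - g (xs i)\<bar>) < \<epsilon>"
      by (simp add: sum.reindex_bij_betw[OF h, of "\<lambda>i. \<bar>g (ys i) - g (xs i)\<bar>"])
  qed
qed

lemma interval_interiors_disjoint:
  fixes a b c d :: real
  assumes "a < b" "c < d" "{a<..<b} \<inter> {c<..<d} = {}"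
  shows "b \<le> c \<or> d \<le> a"
proof (rule ccontr)
  assume "\<not> ?thesis"
  then have "max a c < min b d" using assms by auto
  then obtain z where "max a c < z" "z < min b d" using dense by blast
  then show False using assms(3) by auto
qed

text \<open>Off \<open>N\<close> the gauge is the radius of the difference quotient estimate, so
  such tags contribute an error proportional to length. Tags in \<open>N\<close> are confined to an
  open set of measure below \<delta>, where absolute continuity makes the increments of
  \<open>g\<close> small; the integrand \<open>h\<close> vanishes there, so nothing but these
  increments is left.\<close>

theorem abs_cont_on_has_integral:
  fixes g g' :: "real \<Rightarrow> real"
  assumes ac: "abs_cont_on g a b" and ab: "a \<le> b" and N: "negligible N"
    and der: "\<And>x. x \<in> {a..b} \<Longrightarrow> x \<notin> N \<Longrightarrow> (g has_real_derivative g' x) (at x within {a..b})"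
  shows "(g' has_integral (g b - g a)) {a..b}"
proof -
  define h where "h x = (if x \<in> N then 0 else g' x)" for x
  have "(h has_integral (g b - g a)) (cbox a b)"
    unfolding has_integral
  proof (intro allI impI)
    fix e :: real assume e: "e > 0"
    \<comment> \<open>All tags off \<open>N\<close> together cost at most \<open>e / 4\<close>; the
      summand 1 keeps the denominator positive when \<open>a = b\<close>.\<close>
    define e1 where "e1 = e / (4 * (b - a + 1))"
    have e1: "e1 > 0" "e1 * (b - a) \<le> e / 4" using e ab by (auto simp: e1_def field_simps)
    have e2: "e / 2 > 0" using e by simp
    obtain \<delta> where \<delta>: "\<delta> > 0" and acs:
      "\<forall>I (xs :: real \<times> real set \<Rightarrow> real) ys. finite I \<and> (\<forall>i\<in>I. a \<le> xs i \<and> xs i \<le> ys i \<and> ys i \<le> b) \<and>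
      (\<forall>i\<in>I. \<forall>j\<in>I. i \<noteq> j \<longrightarrow> ys i \<le> xs j \<or> ys j \<le> xs i) \<and>
      (\<Sum>i\<in>I. ys i - xs i) < \<delta> \<longrightarrow> (\<Sum>i\<in>I. \<bar>g (ys i) - g (xs i)\<bar>) < e / 2"
      using abs_cont_on_finite_family[OF ac e2] by (elim exE conjE) (rule that)
    obtain U where U: "open U" "N \<subseteq> U" "U \<in> lmeasurable" "measure lebesgue U < \<delta>"
    proof -
      obtain U where U: "open U" "N \<subseteq> U" "U - N \<in> lmeasurable" "emeasure lebesgue (U - N) < ennreal \<delta>"
        using sets_lebesgue_outer_open[OF negligible_imp_sets[OF N] \<delta>] by metis
      have "U = (U - N) \<union> N" using U(2) by auto
      then have m: "U \<in> lmeasurable" using U(3) N by (metis fmeasurable.Un negligible_imp_measurable)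
      have "measure lebesgue (U - N) = measure lebesgue U"
        using N m by (intro measure_Diff_null_set) (auto simp: negligible_iff_null_sets)
      then have "measure lebesgue U < \<delta>" using U(3,4) \<delta>
        by (metis emeasure_eq_measure2 ennreal_less_iff measure_nonneg)
      then show thesis using that U m by blast
    qed
    have "\<exists>d>0. \<forall>y\<in>{a..b}. \<bar>y - x\<bar> < d \<longrightarrow> \<bar>g y - g x - g' x * (y - x)\<bar> \<le> e1 * \<bar>y - x\<bar>"
      if "x \<in> {a..b}" "x \<notin> N" for x
      using der[OF that] e1(1) unfolding has_field_derivative_def has_derivative_within_alt
      by (auto simp: real_norm_def)
    then obtain d where d: "\<And>x. x \<in> {a..b} \<Longrightarrow> x \<notin> N \<Longrightarrow> d x > 0"
      "\<And>x y. x \<in> {a..b} \<Longrightarrow> x \<notin> N \<Longrightarrow> y \<in> {a..b} \<Longrightarrow> \<bar>y - x\<bar> < d x \<Longrightarrow>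
        \<bar>g y - g x - g' x * (y - x)\<bar> \<le> e1 * \<bar>y - x\<bar>"
      by metis
    define \<gamma> where "\<gamma> x = (if x \<in> N then U else if x \<in> {a..b} then ball x (d x) else UNIV)" for x
    show "\<exists>\<gamma>. gauge \<gamma> \<and> (\<forall>\<D>. \<D> tagged_division_of cbox a b \<and> \<gamma> fine \<D> \<longrightarrow>
            norm ((\<Sum>(x,k)\<in>\<D>. measure lborel k *\<^sub>R h x) - (g b - g a)) < e)"
    proof (intro exI[of _ \<gamma>] conjI allI impI)
      show "gauge \<gamma>" using U d(1) by (auto simp: gauge_def \<gamma>_def)
      fix \<D> assume "\<D> tagged_division_of cbox a b \<and> \<gamma> fine \<D>"
      then have \<D>: "\<D> tagged_division_of {a..b}" and fine: "\<gamma> fine \<D>" by auto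
      note D' = tagged_division_ofD[OF \<D>]
      have fin: "finite \<D>" by (rule D'(1))
      have K: "k = {Inf k..Sup k}" "Inf k \<le> x" "x \<le> Sup k" "a \<le> Inf k" "Sup k \<le> b" "measure lborel k = Sup k - Inf k"
        "Inf k \<in> k" "Sup k \<in> k" "interior k = {Inf k<..<Sup k}"
        if xk: "(x, k) \<in> \<D>" for x k
      proof -
        obtain u v where uv: "k = {u..v}" using D'(4)[OF xk] by auto
        have "x \<in> k" "k \<subseteq> {a..b}" using D'(2,3)[OF xk] by auto
        then have "u \<le> v" "u \<le> x" "x \<le> v" "a \<le> u" "v \<le> b" using uv by auto
        moreover from this have "Inf k = u" "Sup k = v" using uv by auto
        ultimately show "k = {Inf k..Sup k}" "Inf k \<le> x" "x \<le> Sup k" "a \<le> Inf k" "Sup k \<le> b"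
          "measure lborel k = Sup k - Inf k" "Inf k \<in> k" "Sup k \<in> k" "interior k = {Inf k<..<Sup k}"
          using uv by simp_all
      qed
      define A where "A = {p \<in> \<D>. fst p \<notin> N}"
      define B where "B = {p \<in> \<D>. fst p \<in> N}"
      define B' where "B' = {p \<in> B. Inf (snd p) < Sup (snd p)}"
      have AB: "\<D> = A \<union> B" "A \<inter> B = {}" "finite A" "finite B" "finite B'" "B' \<subseteq> B"
        using fin by (auto simp: A_def B_def B'_def)
      define t where "t = (\<lambda>(x,k). measure lborel k *\<^sub>R h x - (g (Sup k) - g (Inf k)))"
      have "(\<Sum>(x,k)\<in>\<D>. measure lborel k *\<^sub>R h x) - (g b - g a) = sum t \<D>"
        unfolding t_def additive_tagged_division_1[OF ab \<D>, symmetric]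
        by (simp add: sum_subtractf case_prod_beta)
      also have "\<dots> = sum t A + sum t B"
        using AB by (simp add: sum.union_disjoint)
      finally have eq: "(\<Sum>(x,k)\<in>\<D>. measure lborel k *\<^sub>R h x) - (g b - g a) = sum t A + sum t B" .
      have tA: "\<bar>t p\<bar> \<le> e1 * measure lborel (snd p)" if p: "p \<in> A" for p
      proof -
        obtain x k where pk: "p = (x, k)" by force
        have xk: "(x, k) \<in> \<D>" "x \<notin> N" using p by (auto simp: A_def pk)
        note Kx = K[OF xk(1)]
        have x: "x \<in> {a..b}" using Kx(2-5) by auto
        have "k \<subseteq> ball x (d x)" using fineD[OF fine xk(1)] xk(2) x by (simp add: \<gamma>_def)
        moreover have "Inf k \<in> k" "Sup k \<in> k" by (fact Kx)+
        ultimately have "Inf k \<in> ball x (d x)" "Sup k \<in> ball x (d x)" by blast+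
        then have near: "\<bar>Inf k - x\<bar> < d x" "\<bar>Sup k - x\<bar> < d x"
          by (simp_all add: dist_real_def abs_minus_commute)
        have "Inf k \<in> {a..b}" "Sup k \<in> {a..b}" using Kx(2-5) by auto
        then have "\<bar>g (Sup k) - g x - g' x * (Sup k - x)\<bar> \<le> e1 * \<bar>Sup k - x\<bar>"
          "\<bar>g (Inf k) - g x - g' x * (Inf k - x)\<bar> \<le> e1 * \<bar>Inf k - x\<bar>"
          using d(2)[OF x xk(2)] near by blast+
        moreover have "\<bar>Sup k - x\<bar> = Sup k - x" "\<bar>Inf k - x\<bar> = x - Inf k" using Kx(2-5) by auto
        moreover have "t p = (g (Inf k) - g x - g' x * (Inf k - x)) - (g (Sup k) - g x - g' x * (Sup k - x))"
          unfolding t_def pk h_def using xk(2) by (simp add: Kx(6) algebra_simps del: content_real_eq_0)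
        ultimately have "\<bar>t p\<bar> \<le> e1 * (x - Inf k) + e1 * (Sup k - x)"
          using abs_triangle_ineq4[of "g (Inf k) - g x - g' x * (Inf k - x)" "g (Sup k) - g x - g' x * (Sup k - x)"]
          by simp
        also have "\<dots> = e1 * measure lborel (snd p)"
          by (simp add: Kx(6) pk algebra_simps del: content_real_eq_0)
        finally show ?thesis .
      qed
      have "\<bar>sum t A\<bar> \<le> (\<Sum>p\<in>A. e1 * measure lborel (snd p))"
        by (rule order_trans[OF sum_abs sum_mono]) (rule tA)
      also have "\<dots> \<le> (\<Sum>p\<in>\<D>. e1 * measure lborel (snd p))"
        using e1 AB fin by (intro sum_mono2) auto
      also have "\<dots> = e1 * (b - a)"
        using additive_content_tagged_division[of \<D> a b] \<D> ab
        by (simp add: case_prod_beta flip: sum_distrib_left)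
      finally have A: "\<bar>sum t A\<bar> \<le> e / 4" using e1(2) by linarith
      have tB: "\<bar>t p\<bar> = \<bar>g (Sup (snd p)) - g (Inf (snd p))\<bar>" if "p \<in> B" for p
        using that by (auto simp: B_def t_def h_def case_prod_beta)
      have neB: "Inf (snd p) = Sup (snd p)" if "p \<in> B - B'" for p
        using that K(2,3)[of "fst p" "snd p"] by (force simp: B_def B'_def)
      have disj: "Sup (snd p) \<le> Inf (snd q) \<or> Sup (snd q) \<le> Inf (snd p)"
        if pq: "p \<in> B'" "q \<in> B'" "p \<noteq> q" for p q
      proof (rule interval_interiors_disjoint)
        show "Inf (snd p) < Sup (snd p)" "Inf (snd q) < Sup (snd q)" using pq by (auto simp: B'_def)
        have pD: "(fst p, snd p) \<in> \<D>" "(fst q, snd q) \<in> \<D>" using pq by (auto simp: B_def B'_def)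
        have "interior (snd p) \<inter> interior (snd q) = {}"
          using D'(5)[OF pD] pq(3) by (simp add: prod_eq_iff)
        moreover have "interior (snd p) = {Inf (snd p)<..<Sup (snd p)}" 
          by (rule K(9)[OF pD(1)])
        moreover have "interior (snd q) = {Inf (snd q)<..<Sup (snd q)}" 
          by (rule K(9)[OF pD(2)])
        ultimately show "{Inf (snd p)<..<Sup (snd p)} \<inter> {Inf (snd q)<..<Sup (snd q)} = {}" by simp
      qed
      have len: "(\<Sum>p\<in>B'. Sup (snd p) - Inf (snd p)) < \<delta>"
      proof -
        have "((\<lambda>_. 1::real) has_integral (\<Sum>p\<in>B'. Sup (snd p) - Inf (snd p))) (\<Union>p\<in>B'. {Inf (snd p)..Sup (snd p)})"
        proof (rule has_integral_UN[OF AB(5)])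
          fix p assume "p \<in> B'"
          then show "((\<lambda>_. 1::real) has_integral (Sup (snd p) - Inf (snd p))) {Inf (snd p)..Sup (snd p)}"
            using has_integral_const_real[of "1::real" "Inf (snd p)" "Sup (snd p)"] by (simp add: B'_def)
        next
          show "pairwise (\<lambda>p q. negligible ({Inf (snd p)..Sup (snd p)} \<inter> {Inf (snd q)..Sup (snd q)})) B'"
          proof (rule pairwiseI)
            fix p q assume pq: "p \<in> B'" "q \<in> B'" "p \<noteq> q"
            have "{Inf (snd p)..Sup (snd p)} \<inter> {Inf (snd q)..Sup (snd q)} \<subseteq> {Sup (snd p), Sup (snd q)}"
              using disj[OF pq] by auto
            then show "negligible ({Inf (snd p)..Sup (snd p)} \<inter> {Inf (snd q)..Sup (snd q)})"
              by (rule negligible_subset[rotated]) (simp add: negligible_finite)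
          qed
        qed
        then have "(\<Sum>p\<in>B'. Sup (snd p) - Inf (snd p)) = measure lebesgue (\<Union>p\<in>B'. {Inf (snd p)..Sup (snd p)})"
          by (subst lmeasure_integral) (auto simp: integral_unique intro!: fmeasurable.finite_UN AB(5))
        also have "\<dots> \<le> measure lebesgue U"
        proof (rule measure_mono_fmeasurable[OF _ _ U(3)])
          show "(\<Union>p\<in>B'. {Inf (snd p)..Sup (snd p)}) \<subseteq> U"
          proof (rule UN_least)
            fix p assume p: "p \<in> B'"
            then have pD: "(fst p, snd p) \<in> \<D>" "fst p \<in> N" by (auto simp: B_def B'_def)
            then have "snd p \<subseteq> U" using fineD[OF fine pD(1)] by (simp add: \<gamma>_def)
            then show "{Inf (snd p)..Sup (snd p)} \<subseteq> U" by (simp only: K(1)[OF pD(1), symmetric])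
          qed
        qed (use AB in \<open>auto intro!: sets.finite_UN\<close>)
        finally show ?thesis using U(4) by linarith
      qed
      have "\<bar>sum t B\<bar> \<le> (\<Sum>p\<in>B. \<bar>t p\<bar>)" by (rule sum_abs)
      also have "\<dots> = (\<Sum>p\<in>B. \<bar>g (Sup (snd p)) - g (Inf (snd p))\<bar>)"
        by (rule sum.cong[OF refl tB])
      also have "\<dots> = (\<Sum>p\<in>B'. \<bar>g (Sup (snd p)) - g (Inf (snd p))\<bar>)"
        using AB neB by (intro sum.mono_neutral_right) auto
      also have "\<dots> < e / 2"
      proof (rule acs[rule_format], intro conjI ballI impI)
        fix p assume "p \<in> B'"
        then have "(fst p, snd p) \<in> \<D>" by (auto simp: B_def B'_def)
        from K(2-5)[OF this] show "a \<le> Inf (snd p)" "Inf (snd p) \<le> Sup (snd p)" "Sup (snd p) \<le> b" by auto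
      qed (use AB(5) disj len in auto)
      finally have "\<bar>sum t B\<bar> < e / 2" .
      with A e have "\<bar>sum t A + sum t B\<bar> < e" by linarith
      then show "norm ((\<Sum>(x,k)\<in>\<D>. measure lborel k *\<^sub>R h x) - (g b - g a)) < e"
        unfolding eq real_norm_def .
    qed
  qed
  then show ?thesis
    by (intro has_integral_spike[OF N, of "{a..b}" g' h]) (auto simp: h_def)
qed

text \<open>At a bad point of tolerance \<epsilon>, arbitrarily short intervals with that point as
  endpoint and tag have a Riemann error above \<epsilon> times their length. Vitali's theorem
  selects disjoint ones that cover almost all bad points, and Henstock's lemma bounds the sum of
  their errors, hence their total length.\<close>

theorem AE_indefinite_integral_derivative:
  fixes f :: "real \<Rightarrow> real"
  assumes f: "f integrable_on {a..b}"
  shows "\<exists>N. negligible N \<and> (\<forall>x\<in>{a..b} - N.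
    ((\<lambda>t. integral {a..t} f) has_real_derivative f x) (at x within {a..b}))"
proof -
  define I where "I t = integral {a..t} f" for t
  have Idiff: "integral {x..y} f = I y - I x" if "a \<le> x" "x \<le> y" "y \<le> b" for x y
    using Henstock_Kurzweil_Integration.integral_combine[OF that(1,2) integrable_on_subinterval[OF f]] that
    by (simp add: I_def)
  define bad where "bad \<epsilon> = {x \<in> {a..b}. \<forall>d>0. \<exists>y\<in>{a..b}. \<bar>y - x\<bar> < d \<and>
      \<bar>I y - I x - f x * (y - x)\<bar> > \<epsilon> * \<bar>y - x\<bar>}" for \<epsilon>
  have neg: "negligible (bad \<epsilon>)" if \<epsilon>: "\<epsilon> > 0" for \<epsilon>
    unfolding negligible_outer_le
  proof (intro allI impI)
    fix \<eta> :: real assume \<eta>: "\<eta> > 0"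
    \<comment> \<open>Dividing the Henstock bound by \<epsilon> leaves total length at most
      \<eta>.\<close>
    have "\<epsilon> * \<eta> > 0" using \<epsilon> \<eta> by simp
    then obtain \<gamma> where \<gamma>: "gauge \<gamma>" and fine: "\<And>p. \<lbrakk>p tagged_partial_division_of (cbox a b); \<gamma> fine p\<rbrakk> \<Longrightarrow>
             (\<Sum>(x,k)\<in>p. norm (measure lborel k *\<^sub>R f x - integral k f)) < \<epsilon> * \<eta>"
      using Henstock_lemma[of f a b "\<epsilon> * \<eta>"] f by auto
    define K where "K = {(x, y). x \<in> {a..b} \<and> y \<in> {a..b} \<and> x \<noteq> y \<and> {min x y..max x y} \<subseteq> \<gamma> x \<and>
      \<bar>I y - I x - f x * (y - x)\<bar> > \<epsilon> * \<bar>y - x\<bar>}"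
    \<comment> \<open>Vitali's theorem speaks of balls about their centres, whereas the tag is an
      endpoint: the interval is rewritten as a ball about its midpoint.\<close>
    have cb: "cball ((x + y) / 2) (\<bar>y - x\<bar> / 2) = {min x y..max x y}" for x y :: real
      by (cases "x \<le> y") (auto simp: cball_eq_atLeastAtMost field_simps)
    have rK: "0 < \<bar>snd i - fst i\<bar> / 2" if "i \<in> K" for i using that by (auto simp: K_def)
    have covK: "\<exists>i. i \<in> K \<and> x \<in> cball ((fst i + snd i) / 2) (\<bar>snd i - fst i\<bar> / 2) \<and> \<bar>snd i - fst i\<bar> / 2 < d"
      if x: "x \<in> bad \<epsilon>" and d: "0 < d" for x d
    proof -
      obtain r where r: "r > 0" "ball x r \<subseteq> \<gamma> x"
        using \<gamma> unfolding gauge_def by (metis open_contains_ball)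
      have "\<exists>y\<in>{a..b}. \<bar>y - x\<bar> < min r d \<and> \<bar>I y - I x - f x * (y - x)\<bar> > \<epsilon> * \<bar>y - x\<bar>"
      proof -
        have "min r d > 0" using d r(1) by simp
        moreover have "\<forall>d>0. \<exists>y\<in>{a..b}. \<bar>y - x\<bar> < d \<and> \<bar>I y - I x - f x * (y - x)\<bar> > \<epsilon> * \<bar>y - x\<bar>"
          using x unfolding bad_def by blast
        ultimately show ?thesis by blast
      qed
      then obtain y where y: "y \<in> {a..b}" "\<bar>y - x\<bar> < min r d" "\<bar>I y - I x - f x * (y - x)\<bar> > \<epsilon> * \<bar>y - x\<bar>"
        by blast
      have "{min x y..max x y} \<subseteq> ball x r" using y(2) by (auto simp: dist_real_def)
      then have "(x, y) \<in> K" using y r(2) x by (auto simp: K_def bad_def)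
      then show ?thesis using y(2) d by (intro exI[of _ "(x, y)"]) (auto simp: cb simp del: mem_cball)
    qed
    obtain C where C: "countable C" "C \<subseteq> K"
      and pw: "pairwise (\<lambda>i j. disjnt (cball ((fst i + snd i) / 2) (\<bar>snd i - fst i\<bar> / 2))
           (cball ((fst j + snd j) / 2) (\<bar>snd j - fst j\<bar> / 2))) C"
      and nC: "negligible (bad \<epsilon> - (\<Union>i\<in>C. cball ((fst i + snd i) / 2) (\<bar>snd i - fst i\<bar> / 2)))"
      by (rule Vitali_covering_theorem_cballs[of K "\<lambda>i. \<bar>snd i - fst i\<bar> / 2" "bad \<epsilon>" "\<lambda>i. (fst i + snd i) / 2", OF rK covK])
    define J where "J i = {min (fst i) (snd i)..max (fst i) (snd i :: real)}" for i
    have pwJ: "J i \<inter> J j = {}" if "i \<in> C" "j \<in> C" "i \<noteq> j" for i j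
      using pw that unfolding cb pairwise_def disjnt_def J_def by blast
    have finle: "measure lebesgue (\<Union>i\<in>P. J i) \<le> \<eta>" if P: "P \<subseteq> C" "finite P" for P
    proof -
      define p where "p = (\<lambda>i. (fst i, J i)) ` P"
      have mem: "fst i \<in> J i" for i by (auto simp: J_def)
      have inj: "inj_on (\<lambda>i. (fst i, J i)) P"
        using pwJ mem P by (intro inj_onI) (metis Pair_inject disjoint_iff subsetD)
      have part: "p tagged_partial_division_of cbox a b"
        unfolding tagged_partial_division_of_def p_def
      proof (intro conjI allI impI)
        show "finite ((\<lambda>i. (fst i, J i)) ` P)" using P by simp
        fix x k assume "(x, k) \<in> (\<lambda>i. (fst i, J i)) ` P"
        then obtain i where i: "i \<in> P" "x = fst i" "k = J i" by auto
        then have "i \<in> K" using P C by auto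
        then show "k \<subseteq> cbox a b" using i by (auto simp: K_def J_def)
        show "x \<in> k" using mem i by simp
        show "\<exists>a b. k = cbox a b" unfolding i J_def by (intro exI) (rule interval_cbox)
      next
        fix x1 k1 x2 k2
        assume "(x1, k1) \<in> (\<lambda>i. (fst i, J i)) ` P \<and> (x2, k2) \<in> (\<lambda>i. (fst i, J i)) ` P \<and> (x1, k1) \<noteq> (x2, k2)"
        then obtain i j where ij: "i \<in> P" "j \<in> P" "i \<noteq> j" "k1 = J i" "k2 = J j" by auto
        have "k1 \<inter> k2 = {}" using pwJ[OF subsetD[OF P(1) ij(1)] subsetD[OF P(1) ij(2)] ij(3)] ij(4,5) by simp
        then show "interior k1 \<inter> interior k2 = {}" using interior_subset by blast
      qed
      moreover have "\<gamma> fine p"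
      proof (rule fineI)
        fix x k assume "(x, k) \<in> p"
        then obtain i where i: "i \<in> P" "x = fst i" "k = J i" by (auto simp: p_def)
        then have "i \<in> K" using P C by auto
        then show "k \<subseteq> \<gamma> x" using i by (auto simp: K_def J_def)
      qed
      ultimately have "(\<Sum>(x,k)\<in>p. norm (measure lborel k *\<^sub>R f x - integral k f)) < \<epsilon> * \<eta>" by (rule fine)
      then have lt: "(\<Sum>i\<in>P. \<bar>measure lborel (J i) * f (fst i) - integral (J i) f\<bar>) < \<epsilon> * \<eta>"
        unfolding p_def by (simp add: sum.reindex[OF inj] o_def real_norm_def)
      have each: "\<epsilon> * measure lebesgue (J i) \<le> \<bar>measure lborel (J i) * f (fst i) - integral (J i) f\<bar>" if i: "i \<in> P" for i
      proof -
        obtain x y where xy: "i = (x, y)" by force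
        have iK: "(x, y) \<in> K" using i P C xy by auto
        have c: "measure lborel (J i) = \<bar>y - x\<bar>" "measure lebesgue (J i) = \<bar>y - x\<bar>"
          by (auto simp: J_def xy)
        have eq: "\<bar>measure lborel (J i) * f x - integral (J i) f\<bar> = \<bar>I y - I x - f x * (y - x)\<bar>"
        proof (cases "x \<le> y")
          case True
          then have "integral (J i) f = I y - I x" using Idiff[of x y] iK by (simp add: J_def xy K_def)
          then show ?thesis using True by (simp add: c algebra_simps abs_minus_commute)
        next
          case False
          then have "integral (J i) f = I x - I y" using Idiff[of y x] iK by (simp add: J_def xy K_def)
          then show ?thesis using False by (simp add: c algebra_simps)
        qed
        have "\<epsilon> * \<bar>y - x\<bar> \<le> \<bar>I y - I x - f x * (y - x)\<bar>" using iK by (simp add: K_def)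
        moreover have "fst i = x" by (simp add: xy)
        ultimately show ?thesis by (simp only: c(2) eq)
      qed
      have "\<epsilon> * measure lebesgue (\<Union>i\<in>P. J i) \<le> \<epsilon> * (\<Sum>i\<in>P. measure lebesgue (J i))"
        using \<epsilon> P by (intro mult_left_mono measure_UNION_le) (auto simp: J_def)
      also have "\<dots> \<le> (\<Sum>i\<in>P. \<bar>measure lborel (J i) * f (fst i) - integral (J i) f\<bar>)"
        unfolding sum_distrib_left by (rule sum_mono) (rule each)
      also have "\<dots> \<le> \<epsilon> * \<eta>" using lt by simp
      finally show ?thesis using \<epsilon> by simp
    qed
    let ?W = "\<Union>i\<in>C. J i"
    have W: "?W \<in> lmeasurable" "measure lebesgue ?W \<le> \<eta>"
      using fmeasurable_UN_bound[OF C(1) _ finle] measure_UN_bound[OF C(1) _ finle] by (auto simp: J_def)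
    have nW: "negligible (bad \<epsilon> - ?W)" using nC by (simp add: cb J_def)
    show "\<exists>T. bad \<epsilon> \<subseteq> T \<and> T \<in> lmeasurable \<and> measure lebesgue T \<le> \<eta>"
    proof (intro exI conjI)
      show "bad \<epsilon> \<subseteq> (bad \<epsilon> - ?W) \<union> ?W" by auto
      show "(bad \<epsilon> - ?W) \<union> ?W \<in> lmeasurable" using W nW negligible_imp_measurable by blast
      show "measure lebesgue ((bad \<epsilon> - ?W) \<union> ?W) \<le> \<eta>"
        using measure_Un_le[of "bad \<epsilon> - ?W" lebesgue ?W] W nW
        by (simp add: negligible_imp_measure0 negligible_imp_sets fmeasurableD)
    qed
  qed
  define N where "N = (\<Union>n::nat. bad (1 / Suc n))"
  have "negligible N" unfolding N_def 
    by (rule negligible_countable_Union) (auto intro: neg)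
  moreover have "((\<lambda>t. integral {a..t} f) has_real_derivative f x) (at x within {a..b})" if x: "x \<in> {a..b} - N" for x
    unfolding has_field_derivative_def has_derivative_within_alt
  proof (intro conjI allI impI)
    fix e :: real assume "e > 0"
    then obtain n where n: "1 / Suc n < e" using nat_approx_posE by blast
    have "x \<notin> bad (1 / Suc n)" using x by (auto simp: N_def)
    then obtain d where d: "d > 0" "\<And>y. y \<in> {a..b} \<Longrightarrow> \<bar>y - x\<bar> < d \<Longrightarrow> \<bar>I y - I x - f x * (y - x)\<bar> \<le> 1 / Suc n * \<bar>y - x\<bar>"
    proof -
      have "\<exists>d>0. \<forall>y\<in>{a..b}. \<bar>y - x\<bar> < d \<longrightarrow> \<bar>I y - I x - f x * (y - x)\<bar> \<le> 1 / Suc n * \<bar>y - x\<bar>"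
        using \<open>x \<notin> bad (1 / Suc n)\<close> x unfolding bad_def by (auto simp del: of_nat_Suc simp: not_less) (meson not_le)
      then show thesis using that by blast
    qed
    show "\<exists>d>0. \<forall>y\<in>{a..b}. norm (y - x) < d \<longrightarrow>
       norm (integral {a..y} f - integral {a..x} f - f x * (y - x)) \<le> e * norm (y - x)"
    proof (intro exI[of _ d] conjI ballI impI d(1))
      fix y assume "y \<in> {a..b}" "norm (y - x) < d"
      then have "\<bar>I y - I x - f x * (y - x)\<bar> \<le> 1 / Suc n * \<bar>y - x\<bar>" using d(2) by simp
      also have "\<dots> \<le> e * \<bar>y - x\<bar>" using n by (intro mult_right_mono) auto
      finally show "norm (integral {a..y} f - integral {a..x} f - f x * (y - x)) \<le> e * norm (y - x)"
        by (simp add: I_def)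
    qed
  qed (rule bounded_linear_mult_right)
  ultimately show ?thesis by blast
qed

lemma negligible_Int_nonoverlapping:
  fixes a b c d :: real
  assumes "b \<le> c \<or> d \<le> a"
  shows "negligible ({a..b} \<inter> {c..d})"
proof (rule negligible_subset)
  show "{a..b} \<inter> {c..d} \<subseteq> {b, d}" using assms by auto
qed (rule negligible_finite, simp)

lemma sum_integral_nonoverlapping_le:
  fixes f :: "real \<Rightarrow> real"
  assumes f: "f integrable_on {a..b}" and pos: "\<And>x. x \<in> {a..b} \<Longrightarrow> 0 \<le> f x"
    and I: "finite I" "\<And>i. i \<in> I \<Longrightarrow> a \<le> xs i \<and> xs i \<le> ys i \<and> ys i \<le> b"
    and disj: "\<And>i j. i \<in> I \<Longrightarrow> j \<in> I \<Longrightarrow> i \<noteq> j \<Longrightarrow> ys i \<le> xs j \<or> ys j \<le> xs i"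
  shows "(\<Sum>i\<in>I. integral {xs i..ys i} f) \<le> integral {a..b} f"
proof -
  have sub: "{xs i..ys i} \<subseteq> {a..b}" if "i \<in> I" for i using I(2)[OF that] by auto
  have hi: "(f has_integral (\<Sum>i\<in>I. integral {xs i..ys i} f)) (\<Union>i\<in>I. {xs i..ys i})"
  proof (rule has_integral_UN[OF I(1)])
    show "(f has_integral integral {xs i..ys i} f) {xs i..ys i}" if "i \<in> I" for i
      using integrable_on_subinterval[OF f sub[OF that]] by (rule integrable_integral)
    show "pairwise (\<lambda>i i'. negligible ({xs i..ys i} \<inter> {xs i'..ys i'})) I"
      using disj by (intro pairwiseI negligible_Int_nonoverlapping) auto
  qed
  then have "(\<Sum>i\<in>I. integral {xs i..ys i} f) = integral (\<Union>i\<in>I. {xs i..ys i}) f"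
    by (simp add: integral_unique)
  also have "\<dots> \<le> integral {a..b} f"
  proof (rule integral_subset_le)
    show "(\<Union>i\<in>I. {xs i..ys i}) \<subseteq> {a..b}" by (rule UN_least) (rule sub)
  qed (use hi f pos in \<open>auto simp only: has_integral_integrable\<close>)
  finally show ?thesis .
qed

text \<open>Cutting \<open>\<bar>f\<bar>\<close> off at a large height \<open>n\<close> leaves an
  excess \<open>h\<close> whose integral over the whole interval is already small; the part below
  the cut contributes at most \<open>n\<close> times the total length of the intervals.\<close>

theorem abs_cont_on_indefinite_integral:
  fixes f :: "real \<Rightarrow> real"
  assumes f: "f absolutely_integrable_on {a..b}"
  shows "abs_cont_on (\<lambda>t. integral {a..t} f) a b"
  unfolding abs_cont_on_def
proof (intro allI impI)
  fix \<epsilon> :: real assume \<epsilon>: "\<epsilon> > 0"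
  have af: "(\<lambda>x. \<bar>f x\<bar>) absolutely_integrable_on {a..b}"
    using absolutely_integrable_norm[OF f] by (simp add: o_def)
  define g where "g n x = min \<bar>f x\<bar> (real n)" for n x
  have gi: "g n integrable_on {a..b}" for n
  proof -
    have "(\<lambda>x. min \<bar>f x\<bar> (real n)) absolutely_integrable_on {a..b}"
      by (rule absolutely_integrable_min_1[OF af]) (rule absolutely_integrable_on_const, simp)
    then show ?thesis by (simp add: g_def[abs_def] absolutely_integrable_on_def)
  qed
  have "(\<lambda>n. integral {a..b} (g n)) \<longlonglongrightarrow> integral {a..b} (\<lambda>x. \<bar>f x\<bar>)"
  proof (rule dominated_convergence(2)[OF gi, of "\<lambda>x. \<bar>f x\<bar>"])
    show "(\<lambda>x. \<bar>f x\<bar>) integrable_on {a..b}" using af by (simp add: absolutely_integrable_on_def)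
    show "norm (g n x) \<le> \<bar>f x\<bar>" for n x by (auto simp: g_def)
    show "(\<lambda>n. g n x) \<longlonglongrightarrow> \<bar>f x\<bar>" for x
    proof (rule tendsto_eventually)
      obtain N where "\<bar>f x\<bar> \<le> real N" using real_arch_simple by blast
      then show "eventually (\<lambda>n. g n x = \<bar>f x\<bar>) sequentially"
        by (intro eventually_sequentiallyI[of N]) (auto simp: g_def min_def)
    qed
  qed
  then have "eventually (\<lambda>n. integral {a..b} (g n) > integral {a..b} (\<lambda>x. \<bar>f x\<bar>) - \<epsilon> / 2) sequentially"
    using \<epsilon> by (intro order_tendstoD(1)) auto
  then obtain n where n: "integral {a..b} (g n) > integral {a..b} (\<lambda>x. \<bar>f x\<bar>) - \<epsilon> / 2"
    by (auto simp: eventually_sequentially)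
  define h where "h x = \<bar>f x\<bar> - g n x" for x
  have fi: "f integrable_on {a..b}" "(\<lambda>x. \<bar>f x\<bar>) integrable_on {a..b}"
    using f af by (auto simp: absolutely_integrable_on_def)
  have hi: "h integrable_on {a..b}" unfolding h_def using fi gi by (intro integrable_diff)
  have hsmall: "integral {a..b} h < \<epsilon> / 2"
    using n integral_diff[OF fi(2) gi[of n]] by (simp add: h_def[abs_def])
  have h0: "0 \<le> h x" for x by (simp add: h_def g_def)
  \<comment> \<open>The part below the cut then costs at most \<epsilon> / 2; the summand 1 covers
    \<open>n = 0\<close>.\<close>
  define \<delta> where "\<delta> = \<epsilon> / (2 * (real n + 1))"
  show "\<exists>\<delta>>0. \<forall>(k::nat) (xs::nat \<Rightarrow> real) (ys::nat \<Rightarrow> real).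
        (\<forall>i<k. a \<le> xs i \<and> xs i \<le> ys i \<and> ys i \<le> b) \<and>
        (\<forall>i<k. \<forall>j<k. i \<noteq> j \<longrightarrow> ys i \<le> xs j \<or> ys j \<le> xs i) \<and>
        (\<Sum>i<k. ys i - xs i) < \<delta>
        \<longrightarrow> (\<Sum>i<k. \<bar>integral {a..ys i} f - integral {a..xs i} f\<bar>) < \<epsilon>"
  proof (intro exI[of _ \<delta>] conjI allI impI, goal_cases)
    case 1 show ?case using \<epsilon> by (simp add: \<delta>_def)
  next
    case (2 k xs ys)
    then have I: "\<And>i. i \<in> {..<k} \<Longrightarrow> a \<le> xs i \<and> xs i \<le> ys i \<and> ys i \<le> b"
      and disj: "\<And>i j. i \<in> {..<k} \<Longrightarrow> j \<in> {..<k} \<Longrightarrow> i \<noteq> j \<Longrightarrow> ys i \<le> xs j \<or> ys j \<le> xs i"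
      and len: "(\<Sum>i<k. ys i - xs i) < \<delta>" by simp_all
    have each: "\<bar>integral {a..ys i} f - integral {a..xs i} f\<bar> \<le> real n * (ys i - xs i) + integral {xs i..ys i} h"
      if "i \<in> {..<k}" for i
    proof -
      note Ii = I[OF that]
      have sub: "{xs i..ys i} \<subseteq> {a..b}" "{a..ys i} \<subseteq> {a..b}" using Ii by auto
      have fii: "f integrable_on {xs i..ys i}" "h integrable_on {xs i..ys i}"
        using integrable_on_subinterval[OF _ sub(1)] fi hi by auto
      have "integral {a..xs i} f + integral {xs i..ys i} f = integral {a..ys i} f"
        using Ii integrable_on_subinterval[OF fi(1) sub(2)]
        by (intro Henstock_Kurzweil_Integration.integral_combine) auto
      then have "\<bar>integral {a..ys i} f - integral {a..xs i} f\<bar> = \<bar>integral {xs i..ys i} f\<bar>" by linarith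
      also have "\<dots> \<le> integral {xs i..ys i} (\<lambda>x. real n + h x)"
      proof -
        have "norm (integral {xs i..ys i} f) \<le> integral {xs i..ys i} (\<lambda>x. real n + h x)"
          by (intro integral_norm_bound_integral fii integrable_add integrable_const_ivl)
            (auto simp: h_def g_def)
        then show ?thesis by simp
      qed
      also have "\<dots> = real n * (ys i - xs i) + integral {xs i..ys i} h"
        using Ii integral_add[OF integrable_const_ivl[of "real n" "xs i" "ys i"] fii(2)] by simp
      finally show ?thesis .
    qed
    have "(\<Sum>i<k. \<bar>integral {a..ys i} f - integral {a..xs i} f\<bar>) \<le>
        (\<Sum>i<k. real n * (ys i - xs i) + integral {xs i..ys i} h)"
      by (rule sum_mono) (rule each)
    also have "\<dots> = real n * (\<Sum>i<k. ys i - xs i) + (\<Sum>i<k. integral {xs i..ys i} h)"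
      by (simp add: sum.distrib sum_distrib_left)
    also have "(\<Sum>i<k. integral {xs i..ys i} h) \<le> integral {a..b} h"
      by (rule sum_integral_nonoverlapping_le[OF hi h0 finite_lessThan I disj])
    also have "real n * (\<Sum>i<k. ys i - xs i) \<le> real n * \<delta>"
      using len by (intro mult_left_mono) auto
    also have "real n * \<delta> \<le> \<epsilon> / 2" using \<epsilon> by (simp add: \<delta>_def field_simps)
    finally show ?case using hsmall by linarith
  qed
qed

section \<open>The integrated equation and a priori bounds\<close>

lemma indefinite_integral_diff_le:
  fixes f g :: "real \<Rightarrow> real"
  assumes f: "f integrable_on {a..b}" and g: "g integrable_on {a..b}"
    and le: "\<And>x. x \<in> {a..b} \<Longrightarrow> \<bar>f x\<bar> \<le> g x" and xy: "x \<in> {a..b}" "y \<in> {a..b}"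
  shows "\<bar>integral {a..x} f - integral {a..y} f\<bar> \<le> integral {a..b} g"
proof -
  have *: "\<bar>integral {a..x} f - integral {a..y} f\<bar> \<le> integral {a..b} g"
    if "a \<le> y" "y \<le> x" "x \<le> b" for x y
  proof -
    have sub: "{a..x} \<subseteq> {a..b}" "{y..x} \<subseteq> {a..b}" using that by auto
    have "integral {a..y} f + integral {y..x} f = integral {a..x} f"
      using that integrable_on_subinterval[OF f sub(1)]
      by (intro Henstock_Kurzweil_Integration.integral_combine) auto
    then have "\<bar>integral {a..x} f - integral {a..y} f\<bar> = norm (integral {y..x} f)" by simp
    also have "\<dots> \<le> integral {y..x} g"
      using sub(2) le by (intro integral_norm_bound_integral integrable_on_subinterval[OF f]
        integrable_on_subinterval[OF g]) auto
    also have "\<dots> \<le> integral {a..b} g"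
    proof (rule integral_subset_le[OF sub(2)])
      show "g integrable_on {y..x}" by (rule integrable_on_subinterval[OF g sub(2)])
      show "\<forall>z\<in>{a..b}. 0 \<le> g z" using le by fastforce
    qed (rule g)
    finally show ?thesis .
  qed
  show ?thesis
    using *[of y x] *[of x y] xy by (cases "y \<le> x") (auto simp: abs_minus_commute)
qed

lemma continuous_has_antiderivative:
  fixes f :: "real \<Rightarrow> real"
  assumes "continuous_on UNIV f"
  shows "\<exists>F. \<forall>x. (F has_real_derivative f x) (at x)"
proof -
  have "\<exists>F. \<forall>x::real. -\<infinity> < ereal x \<longrightarrow> ereal x < \<infinity> \<longrightarrow> (F has_vector_derivative f x) (at x)"
    using assms by (intro einterval_antiderivative) (auto simp: continuous_on_eq_continuous_at)
  then show ?thesis by (simp add: has_real_derivative_iff_has_vector_derivative)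
qed

text \<open>\<open>\<eta>(u) u'\<close> is the derivative of a periodic function, hence has mean zero.\<close>
lemma periodic_test_function:
  fixes u v \<eta> :: "real \<Rightarrow> real"
  assumes T: "0 < T" and u: "\<And>t. t \<in> {0..T} \<Longrightarrow> (u has_real_derivative v t) (at t within {0..T})"
    and v: "continuous_on {0..T} v" and per: "u 0 = u T" and \<eta>: "continuous_on UNIV \<eta>"
    and pos: "\<And>t. t \<in> {0..T} \<Longrightarrow> 0 \<le> \<eta> (u t) * v t" and t: "t \<in> {0..T}"
  shows "\<eta> (u t) * v t = 0"
proof -
  obtain X where X: "\<And>x. (X has_real_derivative \<eta> x) (at x)"
    using continuous_has_antiderivative[OF \<eta>] by blast
  have cu: "continuous_on {0..T} u" using u by (rule DERIV_continuous_on)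
  have der: "((\<lambda>t. X (u t)) has_real_derivative \<eta> (u t) * v t) (at t within {0..T})" if "t \<in> {0..T}" for t
    using DERIV_chain2[OF X u[OF that]] .
  have "((\<lambda>t. \<eta> (u t) * v t) has_integral (X (u T) - X (u 0))) {0..T}"
    using T der by (intro fundamental_theorem_of_calculus)
      (auto simp flip: has_real_derivative_iff_has_vector_derivative)
  then have "integral {0..T} (\<lambda>t. \<eta> (u t) * v t) = 0" using per by (simp add: integral_unique)
  moreover have "continuous_on {0..T} (\<lambda>t. \<eta> (u t) * v t)"
    by (intro continuous_intros v continuous_on_compose2[OF \<eta> cu]) auto
  ultimately show ?thesis using integral_eq_0_iff[of 0 T "\<lambda>t. \<eta> (u t) * v t"] T pos t by blast
qed

text \<open>The bounds on \<open>a\<close> hold everywhere, not just almost everywhere; the final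
  theorem passes to a suitable version of its coefficient. The homeomorphism enters through its
  inverse \<open>psi\<close>, which recovers the slope from the momentum.\<close>

locale lienard =
  fixes T M :: real and phi psi f F a e :: "real \<Rightarrow> real"
  assumes T: "0 < T"
    and psi: "continuous_on UNIV psi" "strict_mono psi" "psi 0 = 0"
    and phi_psi: "\<And>y. phi (psi y) = y" and psi_phi: "\<And>x. psi (phi x) = x"
    and F: "\<And>x. (F has_real_derivative f x) (at x)" and f: "continuous_on UNIV f"
    and a: "a integrable_on {0..T}" "\<And>t. 0 \<le> a t" "\<And>t. a t \<le> M" "0 < integral {0..T} a"
    and e: "e absolutely_integrable_on {0..T}" "integral {0..T} e = 0"
begin

definition H :: "(real \<Rightarrow> real) \<Rightarrow> real \<Rightarrow> (real \<Rightarrow> real) \<Rightarrow> real \<Rightarrow> real" where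
  "H q s w t = s * t + integral {0..t} e - integral {0..t} (\<lambda>x. a x * q (w x))"

definition slope :: "(real \<Rightarrow> real) \<Rightarrow> (real \<Rightarrow> real) \<Rightarrow> real \<Rightarrow> real \<Rightarrow> (real \<Rightarrow> real) \<Rightarrow> real \<Rightarrow> real" where
  "slope G q s c w t = psi (c + H q s w t - G (w t))"

text \<open>The equation integrated once, in the form \<open>\<phi>(u') + G(u) = c + H\<close> with \<open>G\<close> in the role of the primitive \<open>F\<close>
  of \<open>f\<close>. Keeping \<open>G\<close> merely continuous admits truncations of \<open>F\<close>.\<close>
definition sol :: "(real \<Rightarrow> real) \<Rightarrow> (real \<Rightarrow> real) \<Rightarrow> real \<Rightarrow> real \<Rightarrow> (real \<Rightarrow> real) \<Rightarrow> bool" where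
  "sol G q s c u \<longleftrightarrow> continuous_on {0..T} u \<and> u 0 = u T \<and>
     integral {0..T} (\<lambda>x. a x * q (u x)) = s * T \<and>
     (\<forall>t\<in>{0..T}. u t = u 0 + integral {0..t} (slope G q s c u))"

text \<open>Origin of the constants: when only \<open>q x \<le> C\<close> is known,
  \<open>\<bar>q x\<bar> \<le> 2 * C - q x\<close>, and the mean condition turns the weighted
  integral of the right side into \<open>2 * C * integral {0..T} a - s * T\<close>. The other
  multiple of \<open>\<bar>s\<bar> * T\<close> comes from the linear term of
  \<open>H\<close>.\<close>

definition momentum_bound :: "real \<Rightarrow> real \<Rightarrow> real" where
  "momentum_bound s C = 2 * \<bar>s\<bar> * T + integral {0..T} (\<lambda>t. \<bar>e t\<bar>) + 2 * C * integral {0..T} a"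

definition speed_bound :: "real \<Rightarrow> real" where
  "speed_bound K = max (psi K) (- psi (- K))"

lemma e_integrable: "e integrable_on {0..T}" "(\<lambda>t. \<bar>e t\<bar>) integrable_on {0..T}"
  using e(1) absolutely_integrable_norm[OF e(1)] by (auto simp: absolutely_integrable_on_def)

lemma aq_absolutely_integrable:
  assumes "continuous_on {0..T} w" "continuous_on UNIV q"
  shows "(\<lambda>x. a x * q (w x)) absolutely_integrable_on {0..T}"
proof -
  have c: "continuous_on {0..T} (\<lambda>x. q (w x))"
    by (rule continuous_on_compose2[OF assms(2,1)]) auto
  have "(\<lambda>x. q (w x) * a x) absolutely_integrable_on {0..T}"
  proof (rule absolutely_integrable_bounded_measurable_product_real)
    show "(\<lambda>x. q (w x)) \<in> borel_measurable (lebesgue_on {0..T})"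
      by (rule continuous_imp_measurable_on_sets_lebesgue[OF c]) auto
    show "bounded ((\<lambda>x. q (w x)) ` {0..T})"
      by (intro compact_imp_bounded compact_continuous_image c) auto
    show "a absolutely_integrable_on {0..T}"
      using a by (intro nonnegative_absolutely_integrable_1) auto
  qed auto
  then show ?thesis by (simp add: mult.commute)
qed

lemma aq_integrable:
  assumes "continuous_on {0..T} w" "continuous_on UNIV q"
  shows "(\<lambda>x. a x * q (w x)) integrable_on {0..T}"
  using aq_absolutely_integrable[OF assms] by (simp add: absolutely_integrable_on_def)

lemma H_continuous:
  assumes "continuous_on {0..T} w" "continuous_on UNIV q"
  shows "continuous_on {0..T} (H q s w)"
  unfolding H_def[abs_def]
  by (intro continuous_intros indefinite_integral_continuous_1 aq_integrable assms e_integrable)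

lemma slope_continuous:
  assumes "continuous_on {0..T} w" "continuous_on UNIV q" "continuous_on UNIV G"
  shows "continuous_on {0..T} (slope G q s c w)"
  unfolding slope_def[abs_def]
  by (rule continuous_on_compose2[OF psi(1)])
    (auto intro!: continuous_intros H_continuous assms continuous_on_compose2[OF assms(3,1)])

lemma psi_pos: "0 < y \<Longrightarrow> 0 < psi y" and psi_neg: "y < 0 \<Longrightarrow> psi y < 0"
  using strict_monoD[OF psi(2), of 0 y] strict_monoD[OF psi(2), of y 0] psi(3) by auto

lemma psi_mono: "x \<le> y \<Longrightarrow> psi x \<le> psi y"
  using psi(2) by (simp add: strict_mono_less_eq)

lemma H_ends: "H q s w 0 = 0" "integral {0..T} (\<lambda>x. a x * q (w x)) = s * T \<Longrightarrow> H q s w T = 0"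
  using e(2) by (auto simp: H_def)

text \<open>The mean condition makes \<open>H\<close> vanish at both ends of the period, so
  periodicity of \<open>u\<close> carries over to its slope.\<close>

lemma sol_periodic_slope:
  assumes "sol G q s c u"
  shows "slope G q s c u 0 = slope G q s c u T"
  using assms by (simp add: sol_def slope_def H_ends)

lemma sol_has_derivative:
  assumes "sol G q s c u" "continuous_on UNIV q" "continuous_on UNIV G" "t \<in> {0..T}"
  shows "(u has_real_derivative slope G q s c u t) (at t within {0..T})"
proof -
  have cu: "continuous_on {0..T} u" using assms(1) by (simp add: sol_def)
  have "((\<lambda>x. u 0 + integral {0..x} (slope G q s c u)) has_real_derivative slope G q s c u t) (at t within {0..T})"
    by (rule DERIV_const[THEN DERIV_add, THEN DERIV_cong])
       (rule integral_has_real_derivative[OF slope_continuous[OF cu assms(2,3)] assms(4)], simp)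
  then show ?thesis
  proof (rule has_field_derivative_transform_within[OF _ zero_less_one assms(4)])
    show "u 0 + integral {0..x} (slope G q s c u) = u x" if "x \<in> {0..T}" for x
      using assms(1) that unfolding sol_def by (elim conjE) (drule (1) bspec, erule sym)
  qed
qed

lemma H_diff_le:
  assumes u: "continuous_on {0..T} u" and q: "continuous_on UNIV q" "\<And>x. q x \<le> C" and C: "0 \<le> C"
    and per: "integral {0..T} (\<lambda>x. a x * q (u x)) = s * T" and xy: "x \<in> {0..T}" "y \<in> {0..T}"
  shows "\<bar>H q s u x - H q s u y\<bar> \<le> momentum_bound s C"
proof -
  have E: "\<bar>integral {0..x} e - integral {0..y} e\<bar> \<le> integral {0..T} (\<lambda>t. \<bar>e t\<bar>)"
    by (intro indefinite_integral_diff_le e_integrable xy) auto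
  have gi: "(\<lambda>x. a x * (2 * C) - a x * q (u x)) integrable_on {0..T}"
    by (intro integrable_diff aq_integrable u q(1) integrable_on_mult_left a(1))
  have "\<bar>integral {0..x} (\<lambda>x. a x * q (u x)) - integral {0..y} (\<lambda>x. a x * q (u x))\<bar>
      \<le> integral {0..T} (\<lambda>x. a x * (2 * C) - a x * q (u x))"
  proof (rule indefinite_integral_diff_le[OF aq_integrable[OF u q(1)] gi _ xy])
    fix x
    have "\<bar>q (u x)\<bar> \<le> 2 * C - q (u x)" using q(2)[of "u x"] C by linarith
    then have "a x * \<bar>q (u x)\<bar> \<le> a x * (2 * C - q (u x))" using a(2) by (rule mult_left_mono)
    then show "\<bar>a x * q (u x)\<bar> \<le> a x * (2 * C) - a x * q (u x)"
      using a(2)[of x] by (simp add: abs_mult right_diff_distrib)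
  qed
  also have "\<dots> = 2 * C * integral {0..T} a - s * T"
    using per integral_diff[OF integrable_on_mult_left[OF a(1), of "2 * C"] aq_integrable[OF u q(1)]] by simp
  finally have A: "\<bar>integral {0..x} (\<lambda>x. a x * q (u x)) - integral {0..y} (\<lambda>x. a x * q (u x))\<bar>
      \<le> 2 * C * integral {0..T} a + \<bar>s\<bar> * T"
    using T mult_right_mono[of "- s" "\<bar>s\<bar>" T] by (simp, linarith)
  have "\<bar>s * x - s * y\<bar> \<le> \<bar>s\<bar> * T"
    using xy by (auto simp: abs_mult simp flip: right_diff_distrib intro!: mult_left_mono)
  then show ?thesis using A E unfolding H_def momentum_bound_def by linarith
qed

text \<open>The a priori bound does not involve \<open>G\<close>: where \<open>G(u)\<close> lies below (above) all values of
  \<open>c + H\<close>, the solution would be strictly monotone across that level, which periodicity forbids.\<close>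
lemma sol_bound:
  assumes S: "sol G q s c u" and q: "continuous_on UNIV q" "\<And>x. q x \<le> C" "0 \<le> C"
    and G: "continuous_on UNIV G" and t: "t \<in> {0..T}"
  shows "\<bar>c + H q s u t - G (u t)\<bar> \<le> momentum_bound s C"
proof -
  have cu: "continuous_on {0..T} u" and per: "u 0 = u T" "integral {0..T} (\<lambda>x. a x * q (u x)) = s * T"
    using S by (auto simp: sol_def)
  let ?g = "\<lambda>x. c + H q s u x"
  have cg: "continuous_on {0..T} ?g" by (intro continuous_intros H_continuous cu q)
  have ne: "{0..T} \<noteq> {}" using T by auto
  obtain x1 where x1: "x1 \<in> {0..T}" "\<And>x. x \<in> {0..T} \<Longrightarrow> ?g x1 \<le> ?g x"
    using continuous_attains_inf[OF _ ne cg] by auto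
  obtain x2 where x2: "x2 \<in> {0..T}" "\<And>x. x \<in> {0..T} \<Longrightarrow> ?g x \<le> ?g x2"
    using continuous_attains_sup[OF _ ne cg] by auto
  note der = sol_has_derivative[OF S q(1) G]
  note cs = slope_continuous[OF cu q(1) G]
  have lower: "?g x1 \<le> G (u t)"
  proof (rule ccontr)
    assume less: "\<not> ?g x1 \<le> G (u t)"
    \<comment> \<open>Supported where \<open>G\<close> lies below the minimum of \<open>?g\<close>.
      There the slope is positive, so the product has one sign and
      \<open>periodic_test_function\<close> makes it vanish.\<close>
    define \<eta> where "\<eta> y = max 0 (?g x1 - G y)" for y
    have "\<eta> (u t) * slope G q s c u t = 0"
    proof (rule periodic_test_function[OF T der cs per(1) _ _ t])
      show "continuous_on UNIV \<eta>" unfolding \<eta>_def[abs_def] by (intro continuous_intros G)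
      fix x assume x: "x \<in> {0..T}"
      show "0 \<le> \<eta> (u x) * slope G q s c u x"
      proof (cases "G (u x) < ?g x1")
        case True
        then have "0 < slope G q s c u x"
          unfolding slope_def using x1(2)[OF x] by (intro psi_pos) linarith
        then show ?thesis by (simp add: \<eta>_def)
      qed (simp add: \<eta>_def)
    qed
    moreover have "0 < \<eta> (u t)" using less by (simp add: \<eta>_def)
    moreover have "0 < slope G q s c u t"
      unfolding slope_def using x1(2)[OF t] less by (intro psi_pos) linarith
    ultimately show False by simp
  qed
  have upper: "G (u t) \<le> ?g x2"
  proof (rule ccontr)
    assume less: "\<not> G (u t) \<le> ?g x2"
    define \<eta> where "\<eta> y = - max 0 (G y - ?g x2)" for y
    have "\<eta> (u t) * slope G q s c u t = 0"
    proof (rule periodic_test_function[OF T der cs per(1) _ _ t])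
      show "continuous_on UNIV \<eta>" unfolding \<eta>_def[abs_def] by (intro continuous_intros G)
      fix x assume x: "x \<in> {0..T}"
      show "0 \<le> \<eta> (u x) * slope G q s c u x"
      proof (cases "?g x2 < G (u x)")
        case True
        then have "slope G q s c u x < 0"
          unfolding slope_def using x2(2)[OF x] by (intro psi_neg) linarith
        then show ?thesis by (simp add: \<eta>_def mult_nonneg_nonpos)
      qed (simp add: \<eta>_def)
    qed
    moreover have "\<eta> (u t) < 0" using less by (simp add: \<eta>_def)
    moreover have "slope G q s c u t < 0"
      unfolding slope_def using x2(2)[OF t] less by (intro psi_neg) linarith
    ultimately show False by simp
  qed
  have "\<bar>H q s u x1 - H q s u x2\<bar> \<le> momentum_bound s C"
    using H_diff_le[OF cu q per(2) x1(1) x2(1)] .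
  then show ?thesis using lower upper x1(2)[OF t] x2(2)[OF t] by linarith
qed

lemma speed_bound_bound: "\<bar>y\<bar> \<le> K \<Longrightarrow> \<bar>psi y\<bar> \<le> speed_bound K"
  using psi_mono[of y K] psi_mono[of "- K" y] unfolding speed_bound_def abs_le_iff by linarith

lemma speed_bound_nonneg: "0 \<le> K \<Longrightarrow> 0 \<le> speed_bound K"
  using speed_bound_bound[of 0 K] psi(3) by simp

lemma speed_bound_mono: "K \<le> K' \<Longrightarrow> speed_bound K \<le> speed_bound K'"
  using psi_mono[of K K'] psi_mono[of "- K'" "- K"] unfolding speed_bound_def by linarith

lemma momentum_bound_nonneg: "0 \<le> C \<Longrightarrow> 0 \<le> momentum_bound s C"
proof -
  have "0 \<le> integral {0..T} (\<lambda>t. \<bar>e t\<bar>)" by (intro integral_nonneg e_integrable) auto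
  then show "0 \<le> C \<Longrightarrow> 0 \<le> momentum_bound s C" using T a(4) by (simp add: momentum_bound_def)
qed

lemma lipschitz_from_derivative:
  assumes der: "\<And>t. t \<in> {0..T} \<Longrightarrow> (u has_real_derivative v t) (at t within {0..T})"
    and v: "\<And>t. t \<in> {0..T} \<Longrightarrow> \<bar>v t\<bar> \<le> L" and xy: "x \<in> {0..T}" "y \<in> {0..T}"
  shows "\<bar>u x - u y\<bar> \<le> L * \<bar>x - y\<bar>"
proof -
  have "norm (u x - u y) \<le> L * norm (x - y)"
    by (rule field_differentiable_bound[of "{0..T}" u v]) (use der v xy in auto)
  then show ?thesis by simp
qed

lemma sol_lipschitz:
  assumes "sol G q s c u" "continuous_on UNIV q" "\<And>x. q x \<le> C" "0 \<le> C"
    and "continuous_on UNIV G" "x \<in> {0..T}" "y \<in> {0..T}"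
  shows "\<bar>u x - u y\<bar> \<le> speed_bound (momentum_bound s C) * \<bar>x - y\<bar>"
proof (rule lipschitz_from_derivative[OF sol_has_derivative[OF assms(1,2,5)] _ assms(6,7)])
  show "\<bar>slope G q s c u t\<bar> \<le> speed_bound (momentum_bound s C)" if "t \<in> {0..T}" for t
    unfolding slope_def by (rule speed_bound_bound[OF sol_bound[OF assms(1-5) that]])
qed

text \<open>A solution that is far out at one point is therefore far out on the whole period, by an
  amount that does not depend on \<open>G\<close>.\<close>

lemma sol_oscillation:
  assumes "sol G q s c u" "continuous_on UNIV q" "\<And>x. q x \<le> C" "0 \<le> C"
    and "continuous_on UNIV G" "x \<in> {0..T}" "y \<in> {0..T}"
  shows "\<bar>u x - u y\<bar> \<le> speed_bound (momentum_bound s C) * T"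
proof -
  have "\<bar>u x - u y\<bar> \<le> speed_bound (momentum_bound s C) * \<bar>x - y\<bar>" by (rule sol_lipschitz[OF assms])
  also have "\<dots> \<le> speed_bound (momentum_bound s C) * T"
    using assms(6,7) speed_bound_nonneg[OF momentum_bound_nonneg[OF assms(4)]] by (intro mult_left_mono) auto
  finally show ?thesis .
qed

end

section \<open>Equivalence with periodic solutions, and comparison\<close>

lemma abs_cont_on_cong:
  assumes "abs_cont_on h a b" "\<And>x. x \<in> {a..b} \<Longrightarrow> g x = C + h x"
  shows "abs_cont_on g a b"
  unfolding abs_cont_on_def
proof (intro allI impI)
  fix \<epsilon> :: real assume "\<epsilon> > 0"
  then obtain \<delta> where \<delta>: "\<delta> > 0" and ac: "\<forall>(n::nat) (xs::nat \<Rightarrow> real) (ys::nat \<Rightarrow> real).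
        (\<forall>i<n. a \<le> xs i \<and> xs i \<le> ys i \<and> ys i \<le> b) \<and>
        (\<forall>i<n. \<forall>j<n. i \<noteq> j \<longrightarrow> ys i \<le> xs j \<or> ys j \<le> xs i) \<and>
        (\<Sum>i<n. ys i - xs i) < \<delta>
        \<longrightarrow> (\<Sum>i<n. \<bar>h (ys i) - h (xs i)\<bar>) < \<epsilon>"
    using assms(1) unfolding abs_cont_on_def by blast
  show "\<exists>\<delta>>0. \<forall>(n::nat) (xs::nat \<Rightarrow> real) (ys::nat \<Rightarrow> real).
        (\<forall>i<n. a \<le> xs i \<and> xs i \<le> ys i \<and> ys i \<le> b) \<and>
        (\<forall>i<n. \<forall>j<n. i \<noteq> j \<longrightarrow> ys i \<le> xs j \<or> ys j \<le> xs i) \<and>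
        (\<Sum>i<n. ys i - xs i) < \<delta>
        \<longrightarrow> (\<Sum>i<n. \<bar>g (ys i) - g (xs i)\<bar>) < \<epsilon>"
  proof (rule exI[of _ \<delta>], intro conjI \<delta> allI impI)
    fix n :: nat and xs ys :: "nat \<Rightarrow> real"
    assume *: "(\<forall>i<n. a \<le> xs i \<and> xs i \<le> ys i \<and> ys i \<le> b) \<and>
        (\<forall>i<n. \<forall>j<n. i \<noteq> j \<longrightarrow> ys i \<le> xs j \<or> ys j \<le> xs i) \<and> (\<Sum>i<n. ys i - xs i) < \<delta>"
    have "g (ys i) - g (xs i) = h (ys i) - h (xs i)" if "i < n" for i
    proof -
      have "xs i \<in> {a..b}" "ys i \<in> {a..b}" using * that by auto
      then show ?thesis by (simp add: assms(2))
    qed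
    then have "(\<Sum>i<n. \<bar>g (ys i) - g (xs i)\<bar>) = (\<Sum>i<n. \<bar>h (ys i) - h (xs i)\<bar>)"
      by (intro sum.cong) auto
    then show "(\<Sum>i<n. \<bar>g (ys i) - g (xs i)\<bar>) < \<epsilon>" using ac[rule_format, OF *] by simp
  qed
qed

lemma abs_cont_on_subinterval:
  assumes "abs_cont_on g a b" "b' \<le> b"
  shows "abs_cont_on g a b'"
  unfolding abs_cont_on_def
proof (intro allI impI)
  fix \<epsilon> :: real assume "\<epsilon> > 0"
  then obtain \<delta> where \<delta>: "\<delta> > 0" and ac: "\<forall>(n::nat) (xs::nat \<Rightarrow> real) (ys::nat \<Rightarrow> real).
        (\<forall>i<n. a \<le> xs i \<and> xs i \<le> ys i \<and> ys i \<le> b) \<and>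
        (\<forall>i<n. \<forall>j<n. i \<noteq> j \<longrightarrow> ys i \<le> xs j \<or> ys j \<le> xs i) \<and>
        (\<Sum>i<n. ys i - xs i) < \<delta>
        \<longrightarrow> (\<Sum>i<n. \<bar>g (ys i) - g (xs i)\<bar>) < \<epsilon>"
    using assms(1) unfolding abs_cont_on_def by blast
  show "\<exists>\<delta>>0. \<forall>(n::nat) (xs::nat \<Rightarrow> real) (ys::nat \<Rightarrow> real).
        (\<forall>i<n. a \<le> xs i \<and> xs i \<le> ys i \<and> ys i \<le> b') \<and>
        (\<forall>i<n. \<forall>j<n. i \<noteq> j \<longrightarrow> ys i \<le> xs j \<or> ys j \<le> xs i) \<and>
        (\<Sum>i<n. ys i - xs i) < \<delta>
        \<longrightarrow> (\<Sum>i<n. \<bar>g (ys i) - g (xs i)\<bar>) < \<epsilon>"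
  proof (rule exI[of _ \<delta>], intro conjI \<delta> allI impI)
    fix n :: nat and xs ys :: "nat \<Rightarrow> real"
    assume *: "(\<forall>i<n. a \<le> xs i \<and> xs i \<le> ys i \<and> ys i \<le> b') \<and>
        (\<forall>i<n. \<forall>j<n. i \<noteq> j \<longrightarrow> ys i \<le> xs j \<or> ys j \<le> xs i) \<and> (\<Sum>i<n. ys i - xs i) < \<delta>"
    then have "\<forall>i<n. a \<le> xs i \<and> xs i \<le> ys i \<and> ys i \<le> b" using assms(2) by force
    then show "(\<Sum>i<n. \<bar>g (ys i) - g (xs i)\<bar>) < \<epsilon>" using ac * by blast
  qed
qed

text \<open>Allows the coefficient to be replaced by a version with bounds valid at every
  point.\<close>

lemma periodic_sol_cong_AE:
  assumes "AE t in lebesgue. t \<in> {0..T} \<longrightarrow> a t = b t" "periodic_sol phi f a q e s T u"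
  shows "periodic_sol phi f b q e s T u"
proof -
  obtain u' where 1: "\<forall>t\<in>{0..T}. (u has_real_derivative u' t) (at t within {0..T})"
    "continuous_on {0..T} u'" "u 0 = u T" "u' 0 = u' T" "abs_cont_on (\<lambda>t. phi (u' t)) 0 T"
    and ae: "AE t in lebesgue. t \<in> {0..T} \<longrightarrow>
              (\<exists>D. ((\<lambda>\<tau>. phi (u' \<tau>)) has_real_derivative D) (at t within {0..T}) \<and>
                   D + f (u t) * u' t + a t * q (u t) = s + e t)"
    using assms(2) unfolding periodic_sol_def by blast
  have "AE t in lebesgue. t \<in> {0..T} \<longrightarrow>
              (\<exists>D. ((\<lambda>\<tau>. phi (u' \<tau>)) has_real_derivative D) (at t within {0..T}) \<and>
                   D + f (u t) * u' t + b t * q (u t) = s + e t)"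
    using ae assms(1) by eventually_elim auto
  then show ?thesis using 1 unfolding periodic_sol_def by blast
qed

context lienard
begin

lemma F_continuous: "continuous_on UNIV F"
  using F by (meson DERIV_continuous_on has_field_derivative_at_within)

text \<open>The friction term is an exact derivative along \<open>u\<close>, so integrating it
  leaves only boundary values of \<open>F\<close>.\<close>

lemma equation_has_integral:
  assumes u: "\<And>t. t \<in> {0..T} \<Longrightarrow> (u has_real_derivative v t) (at t within {0..T})"
    and v: "continuous_on {0..T} v" and q: "continuous_on UNIV q" and t: "t \<in> {0..T}"
  shows "(\<lambda>x. s + e x - a x * q (u x) - f (u x) * v x) absolutely_integrable_on {0..T}"
    and "((\<lambda>x. s + e x - a x * q (u x) - f (u x) * v x) has_integral
      (H q s u t - (F (u t) - F (u 0)))) {0..t}"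
proof -
  have cu: "continuous_on {0..T} u" using u by (rule DERIV_continuous_on)
  have cfv: "continuous_on {0..T} (\<lambda>x. f (u x) * v x)"
    by (intro continuous_intros v continuous_on_compose2[OF f cu]) auto
  show "(\<lambda>x. s + e x - a x * q (u x) - f (u x) * v x) absolutely_integrable_on {0..T}"
    by (intro set_integral_diff(1) set_integral_add(1) aq_absolutely_integrable cu q e
        absolutely_integrable_continuous_real cfv continuous_on_const)
  have sub: "{0..t} \<subseteq> {0..T}" using t by auto
  have 1: "((\<lambda>x. f (u x) * v x) has_integral (F (u t) - F (u 0))) {0..t}"
  proof (rule fundamental_theorem_of_calculus)
    show "0 \<le> t" using t by auto
    fix x assume x: "x \<in> {0..t}"
    then have "(u has_real_derivative v x) (at x within {0..t})"
      using DERIV_subset[OF u sub] sub by blast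
    from DERIV_chain2[OF F this]
    show "((\<lambda>x. F (u x)) has_vector_derivative f (u x) * v x) (at x within {0..t})"
      by (simp add: has_real_derivative_iff_has_vector_derivative)
  qed
  have 2: "(e has_integral integral {0..t} e) {0..t}"
    by (rule integrable_integral[OF integrable_on_subinterval[OF e_integrable(1) sub]])
  have 3: "((\<lambda>x. a x * q (u x)) has_integral integral {0..t} (\<lambda>x. a x * q (u x))) {0..t}"
    by (rule integrable_integral[OF integrable_on_subinterval[OF aq_integrable[OF cu q] sub]])
  have 4: "((\<lambda>x. s) has_integral s * t) {0..t}"
    using has_integral_const_real[of s 0 t] t by (simp add: mult.commute)
  show "((\<lambda>x. s + e x - a x * q (u x) - f (u x) * v x) has_integral
      (H q s u t - (F (u t) - F (u 0)))) {0..t}"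
    unfolding H_def by (intro has_integral_diff has_integral_add 1 2 3 4)
qed

text \<open>Along a solution \<open>phi (u')\<close> is a constant plus the indefinite integral of
  \<open>k\<close>; hence it is absolutely continuous and has derivative \<open>k\<close> almost
  everywhere.\<close>

lemma sol_imp_periodic_sol:
  assumes S: "sol F q s c u" and q: "continuous_on UNIV q"
  shows "periodic_sol phi f a q e s T u"
proof -
  have cu: "continuous_on {0..T} u" using S by (simp add: sol_def)
  define v where "v = slope F q s c u"
  have der: "(u has_real_derivative v t) (at t within {0..T})" if "t \<in> {0..T}" for t
    using sol_has_derivative[OF S q F_continuous that] by (simp add: v_def)
  have cv: "continuous_on {0..T} v" unfolding v_def by (rule slope_continuous[OF cu q F_continuous])
  define k where "k x = s + e x - a x * q (u x) - f (u x) * v x" for x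
  have "0 \<in> {0..T}" using T by auto
  then have kai: "k absolutely_integrable_on {0..T}"
    unfolding k_def[abs_def] using equation_has_integral(1)[OF der cv q] by blast
  have ki: "k integrable_on {0..T}" using kai by (simp add: absolutely_integrable_on_def)
  have phv: "phi (v t) = (c - F (u 0)) + integral {0..t} k" if "t \<in> {0..T}" for t
  proof -
    have "integral {0..t} k = H q s u t - (F (u t) - F (u 0))"
      unfolding k_def[abs_def] by (rule integral_unique[OF equation_has_integral(2)[OF der cv q that]])
    then show ?thesis by (simp add: v_def slope_def phi_psi)
  qed
  obtain N where N: "negligible N"
    "\<And>t. t \<in> {0..T} - N \<Longrightarrow> ((\<lambda>t. integral {0..t} k) has_real_derivative k t) (at t within {0..T})"
    using AE_indefinite_integral_derivative[OF ki] by blast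
  have D: "((\<lambda>t. phi (v t)) has_real_derivative k t) (at t within {0..T})" if t: "t \<in> {0..T}" "t \<notin> N" for t
  proof -
    have "((\<lambda>t. (c - F (u 0)) + integral {0..t} k) has_real_derivative 0 + k t) (at t within {0..T})"
      by (rule DERIV_add[OF DERIV_const N(2)]) (use t in auto)
    then show ?thesis
      by (simp, elim has_field_derivative_transform_within[OF _ zero_less_one t(1)]) (simp add: phv)
  qed
  show ?thesis unfolding periodic_sol_def
  proof (intro exI[of _ v] conjI ballI)
    show "u 0 = u T" using S by (simp add: sol_def)
    show "v 0 = v T" unfolding v_def by (rule sol_periodic_slope[OF S])
    show "abs_cont_on (\<lambda>t. phi (v t)) 0 T"
      by (rule abs_cont_on_cong[OF abs_cont_on_indefinite_integral[OF kai] phv])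
    have "AE t in lebesgue. t \<notin> N" using N(1) by (simp add: AE_not_in negligible_iff_null_sets)
    then show "AE t in lebesgue. t \<in> {0..T} \<longrightarrow>
        (\<exists>D. ((\<lambda>\<tau>. phi (v \<tau>)) has_real_derivative D) (at t within {0..T}) \<and>
          D + f (u t) * v t + a t * q (u t) = s + e t)"
    proof eventually_elim
      case (elim t)
      show ?case using D[OF _ elim] by (auto simp: k_def)
    qed
  qed (use der cv in auto)
qed

text \<open>Absolute continuity is what allows \<open>phi (u')\<close> to be recovered from its
  derivative, known only almost everywhere; the constant \<open>c\<close> is the value of
  \<open>phi (u') + F u\<close> at time 0.\<close>

lemma periodic_sol_imp_sol:
  assumes P: "periodic_sol phi f a q e s T u" and q: "continuous_on UNIV q"
  shows "\<exists>c. sol F q s c u"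
proof -
  obtain v where der: "\<And>t. t \<in> {0..T} \<Longrightarrow> (u has_real_derivative v t) (at t within {0..T})"
    and cv: "continuous_on {0..T} v" and per: "u 0 = u T" "v 0 = v T"
    and ac: "abs_cont_on (\<lambda>t. phi (v t)) 0 T"
    and ae: "AE t in lebesgue. t \<in> {0..T} \<longrightarrow>
              (\<exists>D. ((\<lambda>\<tau>. phi (v \<tau>)) has_real_derivative D) (at t within {0..T}) \<and>
                   D + f (u t) * v t + a t * q (u t) = s + e t)"
    using P unfolding periodic_sol_def by blast
  have cu: "continuous_on {0..T} u" using der by (rule DERIV_continuous_on)
  define k where "k x = s + e x - a x * q (u x) - f (u x) * v x" for x
  obtain N where N: "negligible N" "{t. \<not> (t \<in> {0..T} \<longrightarrow>
              (\<exists>D. ((\<lambda>\<tau>. phi (v \<tau>)) has_real_derivative D) (at t within {0..T}) \<and>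
                   D + f (u t) * v t + a t * q (u t) = s + e t))} \<subseteq> N"
    using ae by (auto simp: eventually_ae_filter negligible_iff_null_sets)
  have D: "((\<lambda>t. phi (v t)) has_real_derivative k t) (at t within {0..T})" if t: "t \<in> {0..T}" "t \<notin> N" for t
  proof -
    obtain D where "((\<lambda>\<tau>. phi (v \<tau>)) has_real_derivative D) (at t within {0..T})"
      "D + f (u t) * v t + a t * q (u t) = s + e t" using N(2) t by blast
    moreover from this have "D = k t" by (simp add: k_def)
    ultimately show ?thesis by simp
  qed
  define c where "c = phi (v 0) + F (u 0)"
  have phv: "phi (v t) = c + H q s u t - F (u t)" if t: "t \<in> {0..T}" for t
  proof -
    have "(k has_integral (phi (v t) - phi (v 0))) {0..t}"
    proof (rule abs_cont_on_has_integral[OF abs_cont_on_subinterval[OF ac] _ N(1)])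
      fix x assume "x \<in> {0..t}" "x \<notin> N"
      then show "((\<lambda>t. phi (v t)) has_real_derivative k x) (at x within {0..t})"
        using t by (intro DERIV_subset[OF D]) auto
    qed (use t in auto)
    moreover have "(k has_integral (H q s u t - (F (u t) - F (u 0)))) {0..t}"
      unfolding k_def[abs_def] by (rule equation_has_integral(2)[OF der cv q t])
    ultimately have "phi (v t) - phi (v 0) = H q s u t - (F (u t) - F (u 0))"
      by (rule has_integral_unique)
    then show ?thesis by (simp add: c_def)
  qed
  have sl: "v t = slope F q s c u t" if "t \<in> {0..T}" for t
    unfolding slope_def using phv[OF that] psi_phi by metis
  have T0: "0 \<in> {0..T}" "T \<in> {0..T}" using T by auto
  \<comment> \<open>Both \<open>u\<close> and \<open>v\<close> agree at the ends, so
    \<open>phv\<close> forces \<open>H\<close> to agree there too. As \<open>e\<close> has mean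
    zero, this is the mean condition.\<close>
  have "H q s u T = 0" using phv[OF T0(1)] phv[OF T0(2)] per H_ends(1)[of q s u] by simp
  then have mean: "integral {0..T} (\<lambda>x. a x * q (u x)) = s * T" using e(2) by (simp add: H_def)
  have "u t = u 0 + integral {0..t} (slope F q s c u)" if t: "t \<in> {0..T}" for t
  proof -
    have sub: "{0..t} \<subseteq> {0..T}" using t by auto
    have "(v has_integral (u t - u 0)) {0..t}"
      using DERIV_subset[OF der sub] sub t
      by (intro fundamental_theorem_of_calculus) (auto simp flip: has_real_derivative_iff_has_vector_derivative)
    then have "integral {0..t} v = u t - u 0" by (rule integral_unique)
    moreover have "integral {0..t} v = integral {0..t} (slope F q s c u)"
      using sl sub by (intro integral_cong) auto
    ultimately show ?thesis by simp
  qed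
  then have "sol F q s c u" unfolding sol_def using cu per mean by blast
  then show ?thesis ..
qed

text \<open>At a contact point the two trajectories have equal position and slope. Since \<open>\<sigma> < s'\<close>,
  the momentum of \<open>u\<close> then falls behind that of \<open>\<alpha>\<close> at a linear rate, which the friction terms
  \<open>F(u) - F(\<alpha>)\<close>, being of smaller order, cannot compensate.\<close>
lemma no_contact_with_lower_solution:
  assumes U: "sol F q \<sigma> c u" and A: "sol F q s' d \<alpha>" and less: "\<sigma> < s'" and q: "continuous_on UNIV q"
    and le: "\<And>t. t \<in> {0..T} \<Longrightarrow> \<alpha> t \<le> u t" and contact: "t1 \<in> {0..T}" "u t1 = \<alpha> t1"
  shows False
proof -
  have cu: "continuous_on {0..T} u" "continuous_on {0..T} \<alpha>" and per: "u 0 = u T" "\<alpha> 0 = \<alpha> T"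
    using U A by (auto simp: sol_def)
  define v where "v = slope F q \<sigma> c u"
  define w where "w = slope F q s' d \<alpha>"
  have du: "(u has_real_derivative v t) (at t within {0..T})" if "t \<in> {0..T}" for t
    using sol_has_derivative[OF U q F_continuous that] by (simp add: v_def)
  have da: "(\<alpha> has_real_derivative w t) (at t within {0..T})" if "t \<in> {0..T}" for t
    using sol_has_derivative[OF A q F_continuous that] by (simp add: w_def)
  define p where "p t = u t - \<alpha> t" for t
  have dp: "(p has_real_derivative (v t - w t)) (at t within {0..T})" if "t \<in> {0..T}" for t
    unfolding p_def[abs_def] by (rule DERIV_diff[OF du da]) (rule that)+
  have p0: "0 \<le> p t" if "t \<in> {0..T}" for t using le[OF that] by (simp add: p_def)
  have right: "0 \<le> v t - w t" if t: "0 \<le> t" "t < T" "p t = 0" for t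
  proof (rule ccontr)
    assume "\<not> 0 \<le> v t - w t"
    then obtain \<eta> where \<eta>: "\<eta> > 0" "\<And>h. 0 < h \<Longrightarrow> t + h \<in> {0..T} \<Longrightarrow> h < \<eta> \<Longrightarrow> p (t + h) < p t"
      using has_real_derivative_neg_dec_right[OF dp[of t]] t by (auto simp: not_le)
    define h where "h = min (\<eta> / 2) (T - t)"
    have "0 < h" "h < \<eta>" "t + h \<in> {0..T}" using \<eta>(1) t by (auto simp: h_def)
    then show False using \<eta>(2)[of h] p0[of "t + h"] t by simp
  qed
  have left: "v t - w t \<le> 0" if t: "0 < t" "t \<le> T" "p t = 0" for t
  proof (rule ccontr)
    assume "\<not> v t - w t \<le> 0"
    then obtain \<eta> where \<eta>: "\<eta> > 0" "\<And>h. 0 < h \<Longrightarrow> t - h \<in> {0..T} \<Longrightarrow> h < \<eta> \<Longrightarrow> p (t - h) < p t"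
      using has_real_derivative_pos_inc_left[OF dp[of t]] t by (auto simp: not_le)
    define h where "h = min (\<eta> / 2) t"
    have "0 < h" "h < \<eta>" "t - h \<in> {0..T}" using \<eta>(1) t by (auto simp: h_def)
    then show False using \<eta>(2)[of h] p0[of "t - h"] t by simp
  qed
  \<comment> \<open>At an interior contact both one-sided inequalities hold. At an end of the period
    each end gives one of them, and periodicity joins the two. Choosing \<open>t0 < T\<close> leaves
    room to move to the right.\<close>
  obtain t0 where t0: "0 \<le> t0" "t0 < T" "p t0 = 0" "v t0 = w t0"
  proof (cases "t1 = 0 \<or> t1 = T")
    case True
    then have "p 0 = 0" "p T = 0" using contact per by (auto simp: p_def)
    moreover have "v 0 = v T" "w 0 = w T"
      unfolding v_def w_def using sol_periodic_slope[OF U] sol_periodic_slope[OF A] by auto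
    ultimately show ?thesis using that[of 0] right[of 0] left[of T] T by auto
  next
    case False
    then show ?thesis using that[of t1] right[of t1] left[of t1] contact by (auto simp: p_def)
  qed
  have ut0: "u t0 = \<alpha> t0" using t0(3) by (simp add: p_def)
  have t0T: "t0 \<in> {0..T}" using t0 by auto
  define m where "m t = (c + H q \<sigma> u t) - (d + H q s' \<alpha> t)" for t
  have m0: "m t0 = 0"
    using t0(4) strict_mono_eq[OF psi(2)] ut0 unfolding v_def w_def slope_def m_def by simp
  define \<delta> where "\<delta> = s' - \<sigma>"
  have \<delta>: "\<delta> > 0" using less by (simp add: \<delta>_def)
  have M0: "0 \<le> M" using a(2,3) by (rule order_trans)
  define r where "r t = F (u t) - F (\<alpha> t)" for t
  have "(r has_real_derivative (f (u t0) * v t0 - f (\<alpha> t0) * w t0)) (at t0 within {0..T})"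
    unfolding r_def[abs_def] by (rule DERIV_diff[OF DERIV_chain2[OF F du[OF t0T]] DERIV_chain2[OF F da[OF t0T]]])
  then have dr: "(r has_real_derivative 0) (at t0 within {0..T})" using ut0 t0(4) by simp
  \<comment> \<open>Budget for the rate \<delta>: at most a half is lost to the difference of the
    \<open>q\<close> terms and a quarter to friction, so a quarter remains. Friction is this small
    because \<open>r\<close> vanishes at \<open>t0\<close> together with its derivative.\<close>
  have "\<delta> / 4 > 0" using \<delta> by simp
  then obtain \<eta>1 where \<eta>1: "\<eta>1 > 0"
    "\<And>t. t \<in> {0..T} \<Longrightarrow> \<bar>t - t0\<bar> < \<eta>1 \<Longrightarrow> \<bar>r t\<bar> \<le> \<delta> / 4 * \<bar>t - t0\<bar>"
  proof -
    have "r t0 = 0" by (simp add: r_def ut0)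
    then have "\<forall>e>0. \<exists>d>0. \<forall>y\<in>{0..T}. \<bar>y - t0\<bar> < d \<longrightarrow> \<bar>r y\<bar> \<le> e * \<bar>y - t0\<bar>"
      using dr unfolding has_field_derivative_def has_derivative_within_alt by simp
    with \<open>\<delta> / 4 > 0\<close> show thesis using that by blast
  qed
  have "continuous_on {0..T} (\<lambda>t. q (u t) - q (\<alpha> t))"
    by (intro continuous_intros continuous_on_compose2[OF q cu(1)] continuous_on_compose2[OF q cu(2)]) auto
  moreover have "\<delta> / (2 * (M + 1)) > 0" using \<delta> M0 by simp
  ultimately obtain \<eta>2 where \<eta>2: "\<eta>2 > 0"
    "\<And>t. t \<in> {0..T} \<Longrightarrow> \<bar>t - t0\<bar> < \<eta>2 \<Longrightarrow> \<bar>q (u t) - q (\<alpha> t)\<bar> < \<delta> / (2 * (M + 1))"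
    using t0T unfolding continuous_on_iff dist_real_def by (metis diff_self diff_zero ut0)
  define b where "b = t0 + min (min \<eta>1 \<eta>2) (T - t0) / 2"
  have b: "t0 < b" "b < T" "b - t0 < \<eta>1" "b - t0 < \<eta>2"
    using \<eta>1(1) \<eta>2(1) t0 unfolding b_def by (auto simp: min_def field_simps)
  have neg: "v t - w t < 0" if t: "t0 < t" "t < b" for t
  proof -
    have tT: "t \<in> {0..T}" and sub: "{t0..t} \<subseteq> {0..T}" "{0..t} \<subseteq> {0..T}" using t t0 b by auto
    have comb: "integral {0..t} g - integral {0..t0} g = integral {t0..t} g" if "g integrable_on {0..T}" for g :: "real \<Rightarrow> real"
      using Henstock_Kurzweil_Integration.integral_combine[OF t0(1) _ integrable_on_subinterval[OF that sub(2)]] t by simp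
    note i1 = aq_integrable[OF cu(1) q] and i2 = aq_integrable[OF cu(2) q]
    have "norm (integral {t0..t} (\<lambda>x. a x * q (\<alpha> x) - a x * q (u x))) \<le> integral {t0..t} (\<lambda>x. \<delta> / 2)"
    proof (rule integral_norm_bound_integral)
      show "(\<lambda>x. a x * q (\<alpha> x) - a x * q (u x)) integrable_on {t0..t}"
        by (intro integrable_diff integrable_on_subinterval[OF i1 sub(1)] integrable_on_subinterval[OF i2 sub(1)])
      fix x assume x: "x \<in> {t0..t}"
      have "\<bar>q (u x) - q (\<alpha> x)\<bar> \<le> \<delta> / (2 * (M + 1))"
        using \<eta>2(2)[of x] x sub b t by fastforce
      then have "a x * \<bar>q (u x) - q (\<alpha> x)\<bar> \<le> M * (\<delta> / (2 * (M + 1)))"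
        using a(2,3)[of x] M0 by (intro mult_mono) auto
      also have "\<dots> \<le> \<delta> / 2" using M0 \<delta> by (simp add: field_simps)
      finally show "norm (a x * q (\<alpha> x) - a x * q (u x)) \<le> \<delta> / 2"
        using a(2)[of x] by (simp add: abs_mult abs_minus_commute flip: right_diff_distrib)
    qed auto
    also have "\<dots> = \<delta> / 2 * (t - t0)" using t by simp
    finally have I: "\<bar>integral {t0..t} (\<lambda>x. a x * q (\<alpha> x)) - integral {t0..t} (\<lambda>x. a x * q (u x))\<bar> \<le> \<delta> / 2 * (t - t0)"
      using integral_diff[OF integrable_on_subinterval[OF i2 sub(1)] integrable_on_subinterval[OF i1 sub(1)]] by simp
    have "m t - m t0 = - \<delta> * (t - t0) + (integral {t0..t} (\<lambda>x. a x * q (\<alpha> x)) - integral {t0..t} (\<lambda>x. a x * q (u x)))"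
      unfolding m_def H_def comb[OF i1, symmetric] comb[OF i2, symmetric] \<delta>_def by (simp add: algebra_simps)
    then have "m t \<le> - \<delta> * (t - t0) + \<delta> / 2 * (t - t0)" using I m0 by linarith
    moreover have "\<bar>r t\<bar> \<le> \<delta> / 4 * (t - t0)" using \<eta>1(2)[OF tT] t b by auto
    moreover have "0 < \<delta> / 4 * (t - t0)" using \<delta> t by simp
    ultimately have "m t - r t < 0" by (simp add: field_simps)
    then have "c + H q \<sigma> u t - F (u t) < d + H q s' \<alpha> t - F (\<alpha> t)" by (simp add: m_def r_def)
    then show ?thesis unfolding v_def w_def slope_def using strict_monoD[OF psi(2)] by simp
  qed
  have "p b < p t0"
  proof (rule DERIV_neg_imp_decreasing_open[OF b(1)])
    show "\<exists>y. (p has_real_derivative y) (at x) \<and> y < 0" if "t0 < x" "x < b" for x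
    proof -
      have "at x within {0..T} = at x" using that t0 b by (intro at_within_Icc_at) auto
      then show ?thesis using dp[of x] neg[OF that] that t0 b by (intro exI[of _ "v x - w x"]) auto
    qed
    have "continuous_on {0..T} p" unfolding p_def[abs_def] by (intro continuous_intros cu)
    then show "continuous_on {t0..b} p" by (rule continuous_on_subset) (use t0 b in auto)
  qed
  moreover have "0 \<le> p b" using b t0 by (intro p0) auto
  ultimately show False using t0(3) by simp
qed

end

section \<open>A compact set of candidate solutions\<close>

lemma continuous_bounded_on_cball:
  fixes q :: "real \<Rightarrow> real"
  assumes "continuous_on UNIV q"
  obtains Q where "0 \<le> Q" "\<And>x. \<bar>x\<bar> \<le> B \<Longrightarrow> \<bar>q x\<bar> \<le> Q"
proof -
  have "compact (q ` {-B..B})"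
    by (intro compact_continuous_image continuous_on_subset[OF assms]) auto
  then obtain Q where Q: "\<And>y. y \<in> q ` {-B..B} \<Longrightarrow> norm y \<le> Q"
    using compact_imp_bounded bounded_iff by metis
  show ?thesis
  proof (rule that[of "max 0 Q"])
    fix x :: real assume "\<bar>x\<bar> \<le> B"
    then have "x \<in> {-B..B}" by auto
    then show "\<bar>q x\<bar> \<le> max 0 Q" using Q[of "q x"] by auto
  qed simp
qed

context lienard
begin

definition clamp_period :: "real \<Rightarrow> real" where "clamp_period t = max 0 (min T t)"

lemma clamp_period: "clamp_period t \<in> {0..T}" "t \<in> {0..T} \<Longrightarrow> clamp_period t = t" "\<bar>clamp_period x - clamp_period y\<bar> \<le> \<bar>x - y\<bar>" "clamp_period (clamp_period t) = clamp_period t"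
  using T by (auto simp: clamp_period_def)

text \<open>Functions on the period are encoded as bounded continuous functions on the line that are
  constant on either side of the period. This places them in a normed space with the sup norm, as
  \<open>schauder\<close> requires.\<close>

definition lipschitz_ball :: "real \<Rightarrow> real \<Rightarrow> (real \<Rightarrow>\<^sub>C real) set" where
  "lipschitz_ball B L = {w :: real \<Rightarrow>\<^sub>C real. (\<forall>t. \<bar>w t\<bar> \<le> B) \<and> (\<forall>x y. \<bar>w x - w y\<bar> \<le> L * \<bar>x - y\<bar>) \<and> (\<forall>t. w t = w (clamp_period t))}"

definition extension :: "(real \<Rightarrow> real) \<Rightarrow> (real \<Rightarrow>\<^sub>C real)" where
  "extension v = Bcontfun (\<lambda>t. v (clamp_period t))"

lemma extension:
  assumes B: "\<And>t. t \<in> {0..T} \<Longrightarrow> \<bar>v t\<bar> \<le> B"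
    and L: "\<And>x y. x \<in> {0..T} \<Longrightarrow> y \<in> {0..T} \<Longrightarrow> \<bar>v x - v y\<bar> \<le> L * \<bar>x - y\<bar>" "0 \<le> L"
  shows "apply_bcontfun (extension v) = (\<lambda>t. v (clamp_period t))" "extension v \<in> lipschitz_ball B L"
proof -
  have lip: "\<bar>v (clamp_period x) - v (clamp_period y)\<bar> \<le> L * \<bar>x - y\<bar>" for x y
    by (rule order_trans[OF L(1)[OF clamp_period(1) clamp_period(1)]]) (intro mult_left_mono clamp_period(3) L(2))
  have "L-lipschitz_on UNIV (\<lambda>t. v (clamp_period t))"
    using lip L(2) by (intro lipschitz_onI) (auto simp: dist_real_def)
  then have "continuous_on UNIV (\<lambda>t. v (clamp_period t))" by (rule lipschitz_on_continuous_on)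
  then have "(\<lambda>t. v (clamp_period t)) \<in> bcontfun"
    by (rule bcontfun_normI[where b = B]) (use B clamp_period(1) in auto)
  then show *: "apply_bcontfun (extension v) = (\<lambda>t. v (clamp_period t))"
    by (simp add: extension_def Bcontfun_inverse)
  show "extension v \<in> lipschitz_ball B L"
    using B lip clamp_period(1,4) by (simp add: lipschitz_ball_def *)
qed

lemma lipschitz_ball_convex: "convex (lipschitz_ball B L)"
proof (rule convexI)
  fix v w :: "real \<Rightarrow>\<^sub>C real" and x y :: real
  assume v: "v \<in> lipschitz_ball B L" and w: "w \<in> lipschitz_ball B L" and xy: "0 \<le> x" "0 \<le> y" "x + y = 1"
  have 1: "\<bar>x * v t + y * w t\<bar> \<le> B" for t
  proof -
    have "\<bar>x * v t + y * w t\<bar> \<le> x * \<bar>v t\<bar> + y * \<bar>w t\<bar>"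
      using xy abs_triangle_ineq[of "x * v t" "y * w t"] by (simp add: abs_mult)
    also have "\<dots> \<le> x * B + y * B"
      using v w xy by (intro add_mono mult_left_mono) (auto simp: lipschitz_ball_def)
    also have "\<dots> = B" using xy(3) by (simp flip: distrib_right)
    finally show ?thesis .
  qed
  have 2: "\<bar>(x * v s + y * w s) - (x * v t + y * w t)\<bar> \<le> L * \<bar>s - t\<bar>" for s t
  proof -
    have "(x * v s + y * w s) - (x * v t + y * w t) = x * (v s - v t) + y * (w s - w t)"
      by (simp add: algebra_simps)
    then have "\<bar>(x * v s + y * w s) - (x * v t + y * w t)\<bar> \<le> x * \<bar>v s - v t\<bar> + y * \<bar>w s - w t\<bar>"
      using xy abs_triangle_ineq[of "x * (v s - v t)" "y * (w s - w t)"] by (simp add: abs_mult)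
    also have "\<dots> \<le> x * (L * \<bar>s - t\<bar>) + y * (L * \<bar>s - t\<bar>)"
      using v w xy by (intro add_mono mult_left_mono) (auto simp: lipschitz_ball_def)
    also have "\<dots> = L * \<bar>s - t\<bar>" using xy(3) by (simp flip: distrib_right)
    finally show ?thesis .
  qed
  have 3: "x * v t + y * w t = x * v (clamp_period t) + y * w (clamp_period t)" for t
  proof -
    have "v t = v (clamp_period t)" "w t = w (clamp_period t)" using v w unfolding lipschitz_ball_def by blast+
    then show ?thesis by simp
  qed
  show "x *\<^sub>R v + y *\<^sub>R w \<in> lipschitz_ball B L"
    unfolding lipschitz_ball_def using 1 2 3 by simp
qed

lemma lipschitz_ball_tendsto_apply:
  assumes "v \<longlonglongrightarrow> w"
  shows "(\<lambda>n. apply_bcontfun (v n) t) \<longlonglongrightarrow> apply_bcontfun w t"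
proof (rule tendsto_dist_iff[THEN iffD2], rule Lim_null_comparison)
  show "eventually (\<lambda>n. norm (dist (apply_bcontfun (v n) t) (apply_bcontfun w t)) \<le> dist (v n) w) sequentially"
    by (simp add: dist_bounded)
  show "(\<lambda>n. dist (v n) w) \<longlonglongrightarrow> 0" by (rule tendsto_dist_iff[THEN iffD1, OF assms])
qed

text \<open>Arzela-Ascoli on the period: the bounds pass to the limit, and clamping turns uniform
  convergence on the period into uniform convergence on the line.\<close>

lemma lipschitz_ball_compact: 
  assumes "0 \<le> L"
  shows "compact (lipschitz_ball B L)"
  unfolding compact_def
proof (intro allI impI)
  fix h :: "nat \<Rightarrow> (real \<Rightarrow>\<^sub>C real)" assume h: "\<forall>n. h n \<in> lipschitz_ball B L"
  have hB: "\<bar>h n t\<bar> \<le> B" and hL: "\<bar>h n x - h n y\<bar> \<le> L * \<bar>x - y\<bar>" and hc: "h n t = h n (clamp_period t)" for n t x y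
    using h unfolding lipschitz_ball_def by blast+
  obtain g k where gk: "continuous_on {0..T} g" "strict_mono (k :: nat \<Rightarrow> nat)"
    "\<And>e. 0 < e \<Longrightarrow> \<exists>N. \<forall>n x. n \<ge> N \<and> x \<in> {0..T} \<longrightarrow> norm (h (k n) x - g x) < e"
  proof (rule Arzela_Ascoli[of "{0..T}" "\<lambda>n t. h n t" B])
    fix x e :: real assume "0 < e"
    show "\<exists>d>0. \<forall>n y. y \<in> {0..T} \<and> norm (x - y) < d \<longrightarrow> norm (h n x - h n y) < e"
    proof (intro exI[of _ "e / (L + 1)"] conjI allI impI)
      show "0 < e / (L + 1)" using \<open>0 < e\<close> assms by simp
      fix n y assume "y \<in> {0..T} \<and> norm (x - y) < e / (L + 1)"
      then have "\<bar>x - y\<bar> * (L + 1) < e" using assms by (simp add: pos_less_divide_eq)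
      moreover have "\<bar>h n x - h n y\<bar> \<le> L * \<bar>x - y\<bar>" by (rule hL)
      moreover have "L * \<bar>x - y\<bar> \<le> \<bar>x - y\<bar> * (L + 1)" by (simp add: algebra_simps)
      ultimately show "norm (h n x - h n y) < e" unfolding real_norm_def by linarith
    qed
  qed (use hB in auto)
  have lim: "(\<lambda>n. h (k n) t) \<longlonglongrightarrow> g t" if "t \<in> {0..T}" for t
    unfolding lim_sequentially dist_real_def using gk(3) that by (metis real_norm_def)
  have gB: "\<bar>g t\<bar> \<le> B" if "t \<in> {0..T}" for t
    by (rule LIMSEQ_le_const2[OF tendsto_rabs[OF lim[OF that]]]) (use hB in auto)
  have gL: "\<bar>g x - g y\<bar> \<le> L * \<bar>x - y\<bar>" if "x \<in> {0..T}" "y \<in> {0..T}" for x y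
    by (rule LIMSEQ_le_const2[OF tendsto_rabs[OF tendsto_diff[OF lim[OF that(1)] lim[OF that(2)]]]]) (use hL in auto)
  have eg: "apply_bcontfun (extension g) = (\<lambda>t. g (clamp_period t))" "extension g \<in> lipschitz_ball B L"
    using extension[of g B L] gB gL assms by blast+
  have "(h \<circ> k) \<longlonglongrightarrow> extension g"
    unfolding lim_sequentially
  proof (intro allI impI)
    fix e :: real assume "e > 0"
    then obtain N where N: "\<And>n x. n \<ge> N \<Longrightarrow> x \<in> {0..T} \<Longrightarrow> norm (h (k n) x - g x) < e / 2"
      using gk(3)[of "e / 2"] by auto
    have "dist ((h \<circ> k) n) (extension g) < e" if "n \<ge> N" for n
    proof -
      have "dist ((h \<circ> k) n) (extension g) \<le> e / 2"
      proof (rule dist_bound)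
        fix t
        have "apply_bcontfun (h (k n)) t = h (k n) (clamp_period t)" by (rule hc)
        then show "dist (apply_bcontfun ((h \<circ> k) n) t) (apply_bcontfun (extension g) t) \<le> e / 2"
          using N[OF that clamp_period(1)[of t]] by (simp add: eg(1) dist_real_def)
      qed
      then show ?thesis using \<open>e > 0\<close> by simp
    qed
    then show "\<exists>no. \<forall>n\<ge>no. dist ((h \<circ> k) n) (extension g) < e" by blast
  qed
  then show "\<exists>l\<in>lipschitz_ball B L. \<exists>r. strict_mono r \<and> (h \<circ> r) \<longlonglongrightarrow> l"
    using eg(2) gk(2) by blast
qed

text \<open>In a compact set pointwise limits are norm limits: a subsequence staying away from
  \<open>w\<close> would have a norm limit in the set, which agrees with \<open>w\<close> pointwise.
  Continuity of the fixed point map thus reduces to dominated convergence.\<close>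

lemma lipschitz_ball_tendstoI:
  assumes L: "0 \<le> L" and v: "\<And>n. v n \<in> lipschitz_ball B L" and w: "w \<in> lipschitz_ball B L"
    and lim: "\<And>t. t \<in> {0..T} \<Longrightarrow> (\<lambda>n. apply_bcontfun (v n) t) \<longlonglongrightarrow> apply_bcontfun w t"
  shows "v \<longlonglongrightarrow> w"
proof (rule ccontr)
  assume "\<not> v \<longlonglongrightarrow> w"
  then obtain \<epsilon> where \<epsilon>: "\<epsilon> > 0" "\<And>N. \<exists>n\<ge>N. dist (v n) w \<ge> \<epsilon>"
    unfolding lim_sequentially by (meson not_less)
  then have "infinite {n. dist (v n) w \<ge> \<epsilon>}"
    by (subst infinite_nat_iff_unbounded_le) auto
  then obtain r :: "nat \<Rightarrow> nat" where r: "strict_mono r" "\<And>n. dist (v (r n)) w \<ge> \<epsilon>"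
    using infinite_enumerate by blast
  obtain l j where l: "l \<in> lipschitz_ball B L" "strict_mono (j :: nat \<Rightarrow> nat)" "((\<lambda>n. v (r n)) \<circ> j) \<longlonglongrightarrow> l"
    using lipschitz_ball_compact[OF L] v unfolding compact_def by (metis (no_types, lifting))
  have "apply_bcontfun l t = apply_bcontfun w t" if "t \<in> {0..T}" for t
  proof (rule LIMSEQ_unique)
    show "(\<lambda>n. apply_bcontfun (v (r (j n))) t) \<longlonglongrightarrow> apply_bcontfun l t"
      using lipschitz_ball_tendsto_apply[OF l(3)] by simp
    show "(\<lambda>n. apply_bcontfun (v (r (j n))) t) \<longlonglongrightarrow> apply_bcontfun w t"
      using LIMSEQ_subseq_LIMSEQ[OF lim[OF that] strict_mono_o[OF r(1) l(2)]] by (simp add: o_def)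
  qed
  then have "apply_bcontfun l t = apply_bcontfun w t" for t
    using l(1) w clamp_period(1)[of t] unfolding lipschitz_ball_def by (metis (mono_tags, lifting) mem_Collect_eq)
  then have "l = w" by (rule bcontfun_eqI)
  then have "eventually (\<lambda>n. dist (v (r (j n))) w < \<epsilon>) sequentially"
    using l(3) \<epsilon>(1) by (simp add: tendsto_iff o_def)
  then obtain n where "dist (v (r (j n))) w < \<epsilon>" by (auto simp: eventually_sequentially)
  then show False using r(2)[of "j n"] by simp
qed

section \<open>Passing to the limit in the integrated equation\<close>

context
  fixes w :: "nat \<Rightarrow> real \<Rightarrow> real" and w' q G :: "real \<Rightarrow> real" and s c :: "nat \<Rightarrow> real" and s' c' B :: real
  assumes w: "\<And>n. continuous_on {0..T} (w n)" "\<And>n t. t \<in> {0..T} \<Longrightarrow> \<bar>w n t\<bar> \<le> B"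
    and w': "continuous_on {0..T} w'" "\<And>t. t \<in> {0..T} \<Longrightarrow> (\<lambda>n. w n t) \<longlonglongrightarrow> w' t"
    and s: "s \<longlonglongrightarrow> s'" and c: "c \<longlonglongrightarrow> c'"
    and q: "continuous_on UNIV q" and G: "continuous_on UNIV G"
begin

lemma tendsto_compose_cont: "t \<in> {0..T} \<Longrightarrow> continuous_on UNIV g \<Longrightarrow> (\<lambda>n. g (w n t)) \<longlonglongrightarrow> g (w' t)"
  for g :: "real \<Rightarrow> real"
  using continuous_on_tendsto_compose[of UNIV g "\<lambda>n. w n t" "w' t"] w'(2) by simp

lemma tendsto_integral_aq:
  assumes t: "t \<in> {0..T}"
  shows "(\<lambda>n. integral {0..t} (\<lambda>x. a x * q (w n x))) \<longlonglongrightarrow> integral {0..t} (\<lambda>x. a x * q (w' x))"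
proof -
  obtain Q where Q: "0 \<le> Q" "\<And>x. \<bar>x\<bar> \<le> B \<Longrightarrow> \<bar>q x\<bar> \<le> Q"
    using continuous_bounded_on_cball[OF q] by blast
  have sub: "{0..t} \<subseteq> {0..T}" using t by auto
  show ?thesis
  proof (rule dominated_convergence(2)[where h = "\<lambda>x. a x * Q"])
    show "(\<lambda>x. a x * q (w k x)) integrable_on {0..t}" for k
      by (rule integrable_on_subinterval[OF aq_integrable[OF w(1) q] sub])
    show "(\<lambda>x. a x * Q) integrable_on {0..t}"
      by (intro integrable_on_mult_left integrable_on_subinterval[OF a(1) sub])
    fix x assume "x \<in> {0..t}"
    then have x: "x \<in> {0..T}" using sub by auto
    show "norm (a x * q (w k x)) \<le> a x * Q" for k
      using Q(2)[OF w(2)[OF x]] a(2)[of x] by (simp add: abs_mult mult_left_mono)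
    show "(\<lambda>k. a x * q (w k x)) \<longlonglongrightarrow> a x * q (w' x)"
      by (intro tendsto_intros tendsto_compose_cont x q)
  qed
qed

lemma tendsto_H: "t \<in> {0..T} \<Longrightarrow> (\<lambda>n. H q (s n) (w n) t) \<longlonglongrightarrow> H q s' w' t"
  unfolding H_def by (intro tendsto_intros tendsto_integral_aq s)

lemma tendsto_integral_slope:
  assumes t: "t \<in> {0..T}"
  shows "(\<lambda>n. integral {0..t} (slope G q (s n) (c n) (w n))) \<longlonglongrightarrow> integral {0..t} (slope G q s' c' w')"
proof -
  obtain Q where Q: "0 \<le> Q" "\<And>x. \<bar>x\<bar> \<le> B \<Longrightarrow> \<bar>q x\<bar> \<le> Q"
    using continuous_bounded_on_cball[OF q] by blast
  obtain \<Gamma> where \<Gamma>: "0 \<le> \<Gamma>" "\<And>x. \<bar>x\<bar> \<le> B \<Longrightarrow> \<bar>G x\<bar> \<le> \<Gamma>"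
    using continuous_bounded_on_cball[OF G] by blast
  obtain S where S: "\<And>n. \<bar>s n\<bar> \<le> S" using convergent_imp_Bseq[of s] s by (auto simp: convergent_def Bseq_def)
  obtain C where C: "\<And>n. \<bar>c n\<bar> \<le> C" using convergent_imp_Bseq[of c] c by (auto simp: convergent_def Bseq_def)
  define R where "R = C + (S * T + integral {0..T} (\<lambda>t. \<bar>e t\<bar>) + integral {0..T} (\<lambda>x. a x * Q)) + \<Gamma>"
  have sub: "{0..t} \<subseteq> {0..T}" using t by auto
  show ?thesis
  proof (rule dominated_convergence(2)[where h = "\<lambda>x. speed_bound R"])
    show "slope G q (s k) (c k) (w k) integrable_on {0..t}" for k
      by (rule integrable_on_subinterval[OF integrable_continuous_real[OF slope_continuous[OF w(1) q G]] sub])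
    fix x assume "x \<in> {0..t}"
    then have x: "x \<in> {0..T}" using sub by auto
    show "norm (slope G q (s k) (c k) (w k) x) \<le> speed_bound R" for k
    proof -
      have "\<bar>integral {0..x} e - integral {0..0} e\<bar> \<le> integral {0..T} (\<lambda>t. \<bar>e t\<bar>)"
        by (intro indefinite_integral_diff_le e_integrable x) (use T in auto)
      moreover have "\<bar>integral {0..x} (\<lambda>x. a x * q (w k x)) - integral {0..0} (\<lambda>x. a x * q (w k x))\<bar>
          \<le> integral {0..T} (\<lambda>x. a x * Q)"
      proof (rule indefinite_integral_diff_le[OF aq_integrable[OF w(1) q] _ _ x])
        show "(\<lambda>x. a x * Q) integrable_on {0..T}" by (intro integrable_on_mult_left a)
        show "\<bar>a y * q (w k y)\<bar> \<le> a y * Q" if "y \<in> {0..T}" for y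
          using Q(2)[OF w(2)[OF that]] a(2)[of y] by (simp add: abs_mult mult_left_mono)
      qed (use T in auto)
      moreover have "\<bar>s k * x\<bar> \<le> S * T"
        using S[of k] x by (auto simp: abs_mult intro!: mult_mono)
      ultimately have "\<bar>c k + H q (s k) (w k) x - G (w k x)\<bar> \<le> R"
        using C[of k] \<Gamma>(2)[OF w(2)[OF x], of k] unfolding H_def R_def by simp
      then show ?thesis unfolding slope_def real_norm_def by (rule speed_bound_bound)
    qed
    have "isCont psi (c' + H q s' w' x - G (w' x))" using psi(1) by (simp add: continuous_on_eq_continuous_at)
    then show "(\<lambda>k. slope G q (s k) (c k) (w k) x) \<longlonglongrightarrow> slope G q s' c' w' x"
      unfolding slope_def
      by (rule isCont_tendsto_compose) (intro tendsto_intros tendsto_H tendsto_compose_cont c x G)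
  qed (rule integrable_const_ivl)
qed

end

end

section \<open>Continuation of solutions\<close>

lemma continuous_on_Icc_bounded:
  fixes h :: "real \<Rightarrow> real"
  assumes "continuous_on {a..b} h"
  shows "\<exists>B. \<forall>t\<in>{a..b}. \<bar>h t\<bar> \<le> B"
  using compact_imp_bounded[OF compact_continuous_image[OF assms compact_Icc]] by (auto simp: bounded_iff)

context lienard
begin

definition gap_min :: "real \<Rightarrow> (real \<Rightarrow> real) \<Rightarrow> (real \<Rightarrow> real) \<Rightarrow> bool" where
  "gap_min r \<alpha> u \<longleftrightarrow> (\<forall>t\<in>{0..T}. r \<le> u t - \<alpha> t) \<and> (\<exists>t\<in>{0..T}. u t - \<alpha> t = r)"

text \<open>Being a solution involves \<open>G\<close> and \<open>q\<close> only at values that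
  \<open>u\<close> takes. Every truncation below is undone by this remark once the range of
  \<open>u\<close> is bounded.\<close>

lemma sol_cong:
  assumes S: "sol G q s c u" and eq: "\<And>t. t \<in> {0..T} \<Longrightarrow> G (u t) = G' (u t)" "\<And>t. t \<in> {0..T} \<Longrightarrow> q (u t) = q' (u t)"
  shows "sol G' q' s c u"
proof -
  have aq: "integral {0..t} (\<lambda>x. a x * q (u x)) = integral {0..t} (\<lambda>x. a x * q' (u x))" if "t \<in> {0..T}" for t
    using eq(2) that by (intro integral_cong) auto
  have sl: "slope G q s c u t = slope G' q' s c u t" if "t \<in> {0..T}" for t
    unfolding slope_def H_def by (simp only: aq[OF that] eq(1)[OF that])
  have "integral {0..t} (slope G q s c u) = integral {0..t} (slope G' q' s c u)" if "t \<in> {0..T}" for t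
    using sl that by (intro integral_cong) auto
  moreover have "T \<in> {0..T}" using T by simp
  ultimately show ?thesis using S aq unfolding sol_def by metis
qed

lemma integral_aq_bound:
  assumes w: "continuous_on {0..T} w" and q: "continuous_on UNIV q" "\<And>x. \<bar>q x\<bar> \<le> Q" and t: "t \<in> {0..T}"
  shows "\<bar>integral {0..t} (\<lambda>x. a x * q (w x))\<bar> \<le> Q * integral {0..T} a"
proof -
  have "\<bar>integral {0..t} (\<lambda>x. a x * q (w x)) - integral {0..0} (\<lambda>x. a x * q (w x))\<bar> \<le> integral {0..T} (\<lambda>x. a x * Q)"
  proof (rule indefinite_integral_diff_le[OF aq_integrable[OF w q(1)] _ _ t])
    show "(\<lambda>x. a x * Q) integrable_on {0..T}" by (intro integrable_on_mult_left a)
    show "\<bar>a x * q (w x)\<bar> \<le> a x * Q" for x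
      using q(2)[of "w x"] a(2)[of x] by (simp add: abs_mult mult_left_mono)
  qed (use T in auto)
  then show ?thesis by (simp add: mult.commute)
qed

lemma sol_mean_bound:
  assumes "sol G q s c u" "continuous_on UNIV q" "\<And>x. \<bar>q x\<bar> \<le> Q"
  shows "\<bar>s\<bar> * T \<le> Q * integral {0..T} a"
proof -
  have "continuous_on {0..T} u" "integral {0..T} (\<lambda>x. a x * q (u x)) = s * T"
    using assms(1) by (auto simp: sol_def)
  then show ?thesis using integral_aq_bound[OF _ assms(2,3), of u T] T by (simp add: abs_mult)
qed

text \<open>The unknowns are the constant \<open>c\<close> and the profile \<open>w\<close>. The
  level \<open>S w\<close> is read off from the mean condition and \<open>U c w\<close> is the
  integrated slope. The first component of \<open>V\<close> moves \<open>c\<close> until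
  \<open>U c w\<close> returns to zero at \<open>T\<close>, which is periodicity; the second shifts
  the profile so that its smallest gap above \<alpha> is \<open>r\<close>. Fixed points are then
  solutions with prescribed gap, and \<open>g\<close> tests their level.\<close>

proposition solution_continuation_bounded:
  assumes q: "continuous_on UNIV q" "\<And>x. \<bar>q x\<bar> \<le> Q"
    and G: "continuous_on UNIV G" "\<And>x. \<bar>G x\<bar> \<le> \<Gamma>"
    and \<alpha>: "continuous_on {0..T} \<alpha>" and r: "r1 < r2"
    and g: "continuous_on UNIV (\<lambda>z. g (fst z) (snd z))"
    and neg: "\<And>s c u. sol G q s c u \<Longrightarrow> gap_min r1 \<alpha> u \<Longrightarrow> g r1 s < 0"
    and pos: "\<And>s c u. sol G q s c u \<Longrightarrow> gap_min r2 \<alpha> u \<Longrightarrow> g r2 s > (0::real)"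
  shows "\<exists>r\<in>{r1..r2}. \<exists>s c u. sol G q s c u \<and> gap_min r \<alpha> u \<and> g r s = 0"
proof -
  have Q0: "0 \<le> Q" and \<Gamma>0: "0 \<le> \<Gamma>" using q(2)[of 0] G(2)[of 0] by linarith+
  have ne: "{0..T} \<noteq> {}" and T0: "0 \<in> {0..T}" "T \<in> {0..T}" using T by auto
  define S :: "(real \<Rightarrow>\<^sub>C real) \<Rightarrow> real" where "S w = integral {0..T} (\<lambda>x. a x * q (w x)) / T" for w
  have ST: "integral {0..T} (\<lambda>x. a x * q (w x)) = S w * T" for w :: "real \<Rightarrow>\<^sub>C real"
    using T by (simp add: S_def)
  define Hb where "Hb = 2 * Q * integral {0..T} a + integral {0..T} (\<lambda>t. \<bar>e t\<bar>)"
  \<comment> \<open>The extra 1 gives the slope a strict sign throughout when \<open>c\<close> is at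
    either end of its range, so that clamping cannot hide a nonzero value of
    \<open>U c w T\<close>.\<close>
  define Cc where "Cc = Hb + \<Gamma> + 1"
  define P where "P = speed_bound (Cc + Hb + \<Gamma>)"
  have E0: "0 \<le> integral {0..T} (\<lambda>t. \<bar>e t\<bar>)" by (intro integral_nonneg e_integrable) auto
  have Hb0: "0 \<le> Hb" using E0 Q0 a(4) by (simp add: Hb_def)
  have Cc0: "0 < Cc" using Hb0 \<Gamma>0 by (simp add: Cc_def)
  have P0: "0 \<le> P" unfolding P_def using Hb0 \<Gamma>0 Cc0 by (intro speed_bound_nonneg) auto
  have cw: "continuous_on {0..T} (apply_bcontfun w)" for w :: "real \<Rightarrow>\<^sub>C real" by auto
  have Hbound: "\<bar>H q (S w) w x\<bar> \<le> Hb" if x: "x \<in> {0..T}" for w :: "real \<Rightarrow>\<^sub>C real" and x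
  proof -
    have 1: "\<bar>integral {0..x} (\<lambda>x. a x * q (w x))\<bar> \<le> Q * integral {0..T} a"
      by (rule integral_aq_bound[OF cw q x])
    have "\<bar>S w\<bar> * \<bar>x\<bar> \<le> \<bar>S w\<bar> * T" using x by (intro mult_left_mono) auto
    also have "\<dots> \<le> Q * integral {0..T} a"
      using integral_aq_bound[OF cw[of w] q T0(2)] T by (simp add: ST abs_mult)
    finally have 2: "\<bar>S w * x\<bar> \<le> Q * integral {0..T} a" by (simp add: abs_mult)
    have "\<bar>integral {0..x} e - integral {0..0} e\<bar> \<le> integral {0..T} (\<lambda>t. \<bar>e t\<bar>)"
      by (rule indefinite_integral_diff_le[OF e_integrable _ x T0(1)]) simp
    then show ?thesis using 1 2 unfolding H_def Hb_def by simp
  qed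
  define U :: "real \<Rightarrow> (real \<Rightarrow>\<^sub>C real) \<Rightarrow> real \<Rightarrow> real" where
    "U c w t = integral {0..t} (slope G q (S w) c w)" for c w t
  have csl: "continuous_on {0..T} (slope G q (S w) c w)" for c and w :: "real \<Rightarrow>\<^sub>C real"
    by (rule slope_continuous[OF cw q(1) G(1)])
  have Ulip: "\<bar>U c w x - U c w y\<bar> \<le> P * \<bar>x - y\<bar>"
    if c: "\<bar>c\<bar> \<le> Cc" and xy: "x \<in> {0..T}" "y \<in> {0..T}" for c w x y
  proof (rule lipschitz_from_derivative[OF _ _ xy])
    fix t assume t: "t \<in> {0..T}"
    show "(U c w has_real_derivative slope G q (S w) c w t) (at t within {0..T})"
      unfolding U_def[abs_def] by (rule integral_has_real_derivative[OF csl t])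
    show "\<bar>slope G q (S w) c w t\<bar> \<le> P"
      unfolding slope_def P_def using Hbound[OF t, of w] G(2)[of "w t"] c by (intro speed_bound_bound) linarith
  qed
  have U0: "U c w 0 = 0" for c w by (simp add: U_def)
  have Ub: "\<bar>U c w t\<bar> \<le> P * T" if c: "\<bar>c\<bar> \<le> Cc" and t: "t \<in> {0..T}" for c w t
  proof -
    have "\<bar>U c w t\<bar> \<le> P * \<bar>t\<bar>" using Ulip[OF c t T0(1), of w] by (simp add: U0)
    also have "\<dots> \<le> P * T" using t P0 by (intro mult_left_mono) auto
    finally show ?thesis .
  qed
  obtain \<alpha>b where \<alpha>b: "\<And>t. t \<in> {0..T} \<Longrightarrow> \<bar>\<alpha> t\<bar> \<le> \<alpha>b"
    using continuous_on_Icc_bounded[OF \<alpha>] by blast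
  define N where "N v = Inf ((\<lambda>t. v t - \<alpha> t) ` {0..T})" for v :: "real \<Rightarrow> real"
  have N: "(\<exists>t\<in>{0..T}. v t - \<alpha> t = N v) \<and> (\<forall>t\<in>{0..T}. N v \<le> v t - \<alpha> t)" if "continuous_on {0..T} v" for v
  proof -
    have "continuous_on {0..T} (\<lambda>t. v t - \<alpha> t)" by (intro continuous_intros that \<alpha>)
    then obtain t where t: "t \<in> {0..T}" "\<And>t'. t' \<in> {0..T} \<Longrightarrow> v t - \<alpha> t \<le> v t' - \<alpha> t'"
      using continuous_attains_inf[OF compact_Icc ne] by blast
    have "N v = v t - \<alpha> t"
      unfolding N_def by (rule cInf_eq_minimum) (use t in auto)
    then show ?thesis using t by auto
  qed
  have cU: "continuous_on {0..T} (U c w)" for c w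
    unfolding U_def[abs_def] by (rule indefinite_integral_continuous_1[OF integrable_continuous_real[OF csl]])
  have Nb: "\<bar>N (U c w)\<bar> \<le> P * T + \<alpha>b" if c: "\<bar>c\<bar> \<le> Cc" for c w
  proof -
    obtain t where "t \<in> {0..T}" "U c w t - \<alpha> t = N (U c w)" using N[OF cU[of c w]] by blast
    then show ?thesis using Ub[OF c, of t w] \<alpha>b[of t] by linarith
  qed
  \<comment> \<open>Adds up \<open>P * T\<close> for \<open>U\<close>,
    \<open>P * T + \<alpha>b\<close> for \<open>N\<close> and the size of \<open>r\<close>, so that
    the shifted profile stays in the ball.\<close>
  define B where "B = \<bar>r1\<bar> + \<bar>r2\<bar> + \<alpha>b + 2 * (P * T)"
  define V where "V r z = (max (- Cc) (min Cc (fst z - U (fst z) (snd z) T)),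
      extension (\<lambda>t. U (fst z) (snd z) t + (r - N (U (fst z) (snd z)))))" for r z
  define K where "K = {-Cc..Cc} \<times> lipschitz_ball B P"
  have ext0: "apply_bcontfun (extension (U c w)) = (\<lambda>t. U c w (clamp_period t))" "extension (U c w) \<in> lipschitz_ball (P * T) P"
    if c: "\<bar>c\<bar> \<le> Cc" for c w
    using extension[of "U c w" "P * T" P] Ub[OF c] Ulip[OF c] P0 by blast+
  have ext1: "apply_bcontfun (extension (\<lambda>t. U c w t + (r - N (U c w)))) = (\<lambda>t. U c w (clamp_period t) + (r - N (U c w)))"
      "extension (\<lambda>t. U c w t + (r - N (U c w))) \<in> lipschitz_ball B P"
    if c: "\<bar>c\<bar> \<le> Cc" and r: "r \<in> {r1..r2}" for c w r
  proof -
    have 1: "\<bar>U c w t + (r - N (U c w))\<bar> \<le> B" if "t \<in> {0..T}" for t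
      using Ub[OF c that, of w] Nb[OF c, of w] r unfolding B_def by auto
    have 2: "\<bar>(U c w x + (r - N (U c w))) - (U c w y + (r - N (U c w)))\<bar> \<le> P * \<bar>x - y\<bar>"
      if "x \<in> {0..T}" "y \<in> {0..T}" for x y using Ulip[OF c that, of w] by simp
    show "apply_bcontfun (extension (\<lambda>t. U c w t + (r - N (U c w)))) = (\<lambda>t. U c w (clamp_period t) + (r - N (U c w)))"
      "extension (\<lambda>t. U c w t + (r - N (U c w))) \<in> lipschitz_ball B P"
      using extension[of "\<lambda>t. U c w t + (r - N (U c w))" B P] 1 2 P0 by blast+
  qed
  have K: "compact K" "convex K" "K \<noteq> {}"
  proof -
    show "compact K" unfolding K_def by (intro compact_Times compact_Icc lipschitz_ball_compact P0)
    show "convex K" unfolding K_def by (intro convex_Times lipschitz_ball_convex) (simp add: convex_real_interval)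
    have "(0, extension (\<lambda>t. U 0 0 t + (r1 - N (U 0 0)))) \<in> K"
      using ext1(2)[of 0 r1 0] Cc0 r by (simp add: K_def)
    then show "K \<noteq> {}" by auto
  qed
  have maps: "V r z \<in> K" if "r \<in> {r1..r2}" "z \<in> K" for r z
    using that ext1(2)[of "fst z" r "snd z"] Cc0 by (auto simp: V_def K_def)
  have lims: "(\<lambda>n. S (w n)) \<longlonglongrightarrow> S w'" "\<And>t. t \<in> {0..T} \<Longrightarrow> (\<lambda>n. U (c n) (w n) t) \<longlonglongrightarrow> U c' w' t"
    if w: "\<And>n. w n \<in> lipschitz_ball B P" "w \<longlonglongrightarrow> w'" and c: "c \<longlonglongrightarrow> c'" for w w' c c'
  proof -
    have wB: "\<bar>w n t\<bar> \<le> B" for n t using w(1)[of n] by (simp add: lipschitz_ball_def)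
    note lim = lipschitz_ball_tendsto_apply[OF w(2)]
    have zero: "(\<lambda>n::nat. 0::real) \<longlonglongrightarrow> 0" by simp
    show SL: "(\<lambda>n. S (w n)) \<longlonglongrightarrow> S w'"
      unfolding S_def using T
      by (intro tendsto_intros tendsto_integral_aq[OF cw wB cw lim zero zero q(1) G(1) T0(2)]) auto
    show "(\<lambda>n. U (c n) (w n) t) \<longlonglongrightarrow> U c' w' t" if "t \<in> {0..T}" for t
      unfolding U_def by (rule tendsto_integral_slope[OF cw wB cw lim SL c q(1) G(1) that])
  qed
  have seq: "(\<lambda>n. V (r n) (c n, w n)) \<longlonglongrightarrow> V r' (c', w') \<and> (\<lambda>n. S (w n)) \<longlonglongrightarrow> S w'"
    if "\<And>n. r n \<in> {r1..r2}" "r' \<in> {r1..r2}" "\<And>n. (c n, w n) \<in> K" "(c', w') \<in> K"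
      and rl: "r \<longlonglongrightarrow> r'" and c: "c \<longlonglongrightarrow> c'" and w: "w \<longlonglongrightarrow> w'" for r r' c c' w w'
  proof -
    have cC: "\<bar>c n\<bar> \<le> Cc" "\<bar>c'\<bar> \<le> Cc" for n using that(3)[of n] that(4) by (auto simp: K_def)
    have wK: "w n \<in> lipschitz_ball B P" "w' \<in> lipschitz_ball B P" for n using that(3)[of n] that(4) by (auto simp: K_def)
    note L = lims[OF wK(1) w c]
    have el: "(\<lambda>n. extension (U (c n) (w n))) \<longlonglongrightarrow> extension (U c' w')"
    proof (rule lipschitz_ball_tendstoI[OF P0 ext0(2)[OF cC(1)] ext0(2)[OF cC(2)]])
      fix t assume "t \<in> {0..T}"
      then show "(\<lambda>n. apply_bcontfun (extension (U (c n) (w n))) t) \<longlonglongrightarrow> apply_bcontfun (extension (U c' w')) t"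
        unfolding ext0(1)[OF cC(1)] ext0(1)[OF cC(2)] by (intro L(2) clamp_period(1))
    qed
    have Nd: "N (U c1 w1) \<le> N (U c2 w2) + dist (extension (U c1 w1)) (extension (U c2 w2))"
      if C: "\<bar>c1\<bar> \<le> Cc" "\<bar>c2\<bar> \<le> Cc" for c1 c2 w1 w2
    proof -
      obtain t where t: "t \<in> {0..T}" "U c2 w2 t - \<alpha> t = N (U c2 w2)" using N[OF cU[of c2 w2]] by blast
      have "N (U c1 w1) \<le> U c1 w1 t - \<alpha> t" using N[OF cU[of c1 w1]] t(1) by blast
      moreover have "dist (extension (U c1 w1) t) (extension (U c2 w2) t) \<le> dist (extension (U c1 w1)) (extension (U c2 w2))"
        by (rule dist_bounded)
      then have "\<bar>U c1 w1 t - U c2 w2 t\<bar> \<le> dist (extension (U c1 w1)) (extension (U c2 w2))"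
        using t(1) by (simp add: ext0(1)[OF C(1)] ext0(1)[OF C(2)] clamp_period(2) dist_real_def)
      ultimately show ?thesis using t(2) by linarith
    qed
    have Nl: "(\<lambda>n. N (U (c n) (w n))) \<longlonglongrightarrow> N (U c' w')"
    proof (rule tendsto_dist_iff[THEN iffD2], rule Lim_null_comparison)
      show "eventually (\<lambda>n. norm (dist (N (U (c n) (w n))) (N (U c' w')))
          \<le> dist (extension (U (c n) (w n))) (extension (U c' w'))) sequentially"
      proof (intro always_eventually allI)
        fix n
        show "norm (dist (N (U (c n) (w n))) (N (U c' w'))) \<le> dist (extension (U (c n) (w n))) (extension (U c' w'))"
          using Nd[OF cC(1)[of n] cC(2), of "w n" w'] Nd[OF cC(2) cC(1)[of n], of w' "w n"]
          by (simp add: dist_real_def dist_commute)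
      qed
      show "(\<lambda>n. dist (extension (U (c n) (w n))) (extension (U c' w'))) \<longlonglongrightarrow> 0"
        by (rule tendsto_dist_iff[THEN iffD1, OF el])
    qed
    have "(\<lambda>n. extension (\<lambda>t. U (c n) (w n) t + (r n - N (U (c n) (w n))))) \<longlonglongrightarrow>
        extension (\<lambda>t. U c' w' t + (r' - N (U c' w')))"
    proof (rule lipschitz_ball_tendstoI[OF P0 ext1(2)[OF cC(1) that(1)] ext1(2)[OF cC(2) that(2)]])
      fix t assume "t \<in> {0..T}"
      show "(\<lambda>n. apply_bcontfun (extension (\<lambda>t. U (c n) (w n) t + (r n - N (U (c n) (w n))))) t) \<longlonglongrightarrow>
        apply_bcontfun (extension (\<lambda>t. U c' w' t + (r' - N (U c' w')))) t"
        unfolding ext1(1)[OF cC(1) that(1)] ext1(1)[OF cC(2) that(2)]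
        by (intro tendsto_intros L(2) clamp_period(1) rl Nl)
    qed
    moreover have "(\<lambda>n. max (- Cc) (min Cc (c n - U (c n) (w n) T))) \<longlonglongrightarrow> max (- Cc) (min Cc (c' - U c' w' T))"
      by (intro tendsto_intros L(2) c T0)
    ultimately show ?thesis using L(1) unfolding V_def by (auto intro: tendsto_Pair)
  qed
  have cV: "continuous_on ({r1..r2} \<times> K) (\<lambda>z. V (fst z) (snd z))"
    unfolding continuous_on_sequentially
  proof (intro allI ballI impI, elim conjE)
    fix x l assume x: "\<forall>n. x n \<in> {r1..r2} \<times> K" and l: "l \<in> {r1..r2} \<times> K" and xl: "x \<longlonglongrightarrow> l"
    have "(\<lambda>n. V (fst (x n)) (fst (snd (x n)), snd (snd (x n)))) \<longlonglongrightarrow> V (fst l) (fst (snd l), snd (snd l))"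
      using x l by (intro seq[THEN conjunct1] tendsto_fst tendsto_snd xl) (auto simp: mem_Times_iff)
    then show "((\<lambda>z. V (fst z) (snd z)) \<circ> x) \<longlonglongrightarrow> V (fst l) (snd l)" by (simp add: o_def)
  qed
  have cg: "continuous_on ({r1..r2} \<times> K) (\<lambda>z. g (fst z) (S (snd (snd z))))"
    unfolding continuous_on_sequentially
  proof (intro allI ballI impI, elim conjE)
    fix x l assume x: "\<forall>n. x n \<in> {r1..r2} \<times> K" and l: "l \<in> {r1..r2} \<times> K" and xl: "x \<longlonglongrightarrow> l"
    have "(\<lambda>n. S (snd (snd (x n)))) \<longlonglongrightarrow> S (snd (snd l))"
      using x by (intro lims(1)[OF _ _ tendsto_fst[OF tendsto_snd[OF xl]]] tendsto_snd xl) (auto simp: mem_Times_iff K_def)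
    then have "(\<lambda>n. (fst (x n), S (snd (snd (x n))))) \<longlonglongrightarrow> (fst l, S (snd (snd l)))"
      by (intro tendsto_Pair tendsto_fst xl)
    from continuous_on_tendsto_compose[OF g this]
    show "((\<lambda>z. g (fst z) (S (snd (snd z)))) \<circ> x) \<longlonglongrightarrow> g (fst l) (S (snd (snd l)))" by (simp add: o_def)
  qed
  have fixp: "sol G q (S (snd z)) (fst z) (snd z) \<and> gap_min r \<alpha> (snd z)"
    if rz: "r \<in> {r1..r2}" "z \<in> K" and fp: "V r z = z" for r z
  proof -
    obtain c w where z: "z = (c, w)" by force
    have c: "\<bar>c\<bar> \<le> Cc" using rz(2) by (auto simp: K_def z)
    have fc: "max (- Cc) (min Cc (c - U c w T)) = c" and
      fw: "extension (\<lambda>t. U c w t + (r - N (U c w))) = w" using fp by (auto simp: V_def z)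
    have wt: "w t = U c w t + (r - N (U c w))" if "t \<in> {0..T}" for t
    proof -
      have "w t = extension (\<lambda>t. U c w t + (r - N (U c w))) t" by (simp only: fw)
      then show ?thesis unfolding ext1(1)[OF c rz(1)] clamp_period(2)[OF that] .
    qed
    have UT: "U c w T = 0"
    proof (rule ccontr)
      assume "U c w T \<noteq> 0"
      then consider "c = - Cc" "0 < U c w T" | "c = Cc" "U c w T < 0"
        using fc Cc0 by (auto simp: max_def min_def split: if_splits)
      then show False
      proof cases
        case 1
        have "slope G q (S w) c w x \<le> 0" if "x \<in> {0..T}" for x
          unfolding slope_def using Hbound[OF that, of w] G(2)[of "w x"] 1(1) unfolding Cc_def
          by (intro less_imp_le psi_neg) linarith
        then have "U c w T \<le> 0"
          unfolding U_def by (intro integral_le[OF integrable_continuous_real[OF csl] integrable_0, simplified]) auto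
        then show False using 1 by simp
      next
        case 2
        have "0 \<le> slope G q (S w) c w x" if "x \<in> {0..T}" for x
          unfolding slope_def using Hbound[OF that, of w] G(2)[of "w x"] 2(1) unfolding Cc_def
          by (intro less_imp_le psi_pos) linarith
        then have "0 \<le> U c w T"
          unfolding U_def by (intro integral_nonneg integrable_continuous_real csl) auto
        then show False using 2 by simp
      qed
    qed
    have w0: "w 0 = r - N (U c w)" using wt[OF T0(1)] by (simp add: U0)
    have "sol G q (S w) c w"
      unfolding sol_def
    proof (intro conjI ballI)
      show "w 0 = w T" using wt[OF T0(2)] by (simp add: UT w0)
      fix t assume "t \<in> {0..T}"
      then show "w t = w 0 + integral {0..t} (slope G q (S w) c w)"
        using wt[of t] by (simp add: w0 U_def)
    qed (auto simp: ST)
    moreover have "gap_min r \<alpha> w"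
    proof -
      have 1: "\<exists>t\<in>{0..T}. U c w t - \<alpha> t = N (U c w)" "\<forall>t\<in>{0..T}. N (U c w) \<le> U c w t - \<alpha> t"
        using N[OF cU[of c w]] by auto
      have "r \<le> w t - \<alpha> t" if "t \<in> {0..T}" for t using wt[OF that] 1(2) that by fastforce
      moreover obtain t where "t \<in> {0..T}" "U c w t - \<alpha> t = N (U c w)" using 1(1) by blast
      then have "t \<in> {0..T} \<and> w t - \<alpha> t = r" using wt[of t] by simp
      ultimately show ?thesis unfolding gap_min_def by blast
    qed
    ultimately show ?thesis by (simp add: z)
  qed
  have r12: "r1 \<in> {r1..r2}" "r2 \<in> {r1..r2}" using r by auto
  have "\<exists>r\<in>{r1..r2}. \<exists>z\<in>K. V r z = z \<and> g r (S (snd z)) = 0"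
    by (rule fixpoint_continuation[OF r K cV maps cg]) (use neg pos fixp r12 in blast)+
  then show ?thesis using fixp by blast
qed

text \<open>The bound of \<open>sol_oscillation\<close> with the level eliminated:
  \<open>sol_mean_bound\<close> replaces \<open>\<bar>s\<bar> * T\<close> by
  \<open>Q * integral {0..T} a\<close>, which turns the factor 2 into 4. This makes it uniform over
  the unknown levels of the continuation.\<close>

definition osc_bound :: "real \<Rightarrow> real" where
  "osc_bound Q = speed_bound (4 * Q * integral {0..T} a + integral {0..T} (\<lambda>t. \<bar>e t\<bar>)) * T"

lemma sol_oscillation_bounded:
  assumes S: "sol G q s c u" and q: "continuous_on UNIV q" "\<And>x. \<bar>q x\<bar> \<le> Q"
    and G: "continuous_on UNIV G" and xy: "x \<in> {0..T}" "y \<in> {0..T}"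
  shows "\<bar>u x - u y\<bar> \<le> osc_bound Q"
proof -
  have qQ: "q x \<le> Q" for x using q(2)[of x] by linarith
  have Q0: "0 \<le> Q" using q(2)[of 0] by linarith
  have "\<bar>s\<bar> * T \<le> Q * integral {0..T} a" by (rule sol_mean_bound[OF S q])
  then have "speed_bound (momentum_bound s Q) \<le> speed_bound (4 * Q * integral {0..T} a + integral {0..T} (\<lambda>t. \<bar>e t\<bar>))"
    by (intro speed_bound_mono) (simp add: momentum_bound_def)
  then have "speed_bound (momentum_bound s Q) * T \<le> osc_bound Q" unfolding osc_bound_def using T by (intro mult_right_mono) auto
  then show ?thesis using sol_oscillation[OF S q(1) qQ Q0 G xy] by linarith
qed

text \<open>Every solution whose gap lies in the given range stays in the interval from
  \<open>- B\<close> to \<open>B\<close>, by an oscillation bound that does not see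
  \<open>G\<close>. Freezing \<open>F\<close> outside that interval therefore makes it bounded
  without creating or losing such solutions.\<close>

proposition solution_continuation:
  assumes q: "continuous_on UNIV q" "\<And>x. \<bar>q x\<bar> \<le> Q"
    and \<alpha>: "continuous_on {0..T} \<alpha>" and r: "r1 < r2"
    and g: "continuous_on UNIV (\<lambda>z. g (fst z) (snd z))"
    and neg: "\<And>s c u. sol F q s c u \<Longrightarrow> gap_min r1 \<alpha> u \<Longrightarrow> g r1 s < 0"
    and pos: "\<And>s c u. sol F q s c u \<Longrightarrow> gap_min r2 \<alpha> u \<Longrightarrow> g r2 s > (0::real)"
  shows "\<exists>r\<in>{r1..r2}. \<exists>s c u. sol F q s c u \<and> gap_min r \<alpha> u \<and> g r s = 0"
proof -
  obtain \<alpha>b where \<alpha>b: "\<And>t. t \<in> {0..T} \<Longrightarrow> \<bar>\<alpha> t\<bar> \<le> \<alpha>b"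
    using continuous_on_Icc_bounded[OF \<alpha>] by blast
  define B where "B = \<bar>r1\<bar> + \<bar>r2\<bar> + \<alpha>b + osc_bound Q"
  define G where "G x = F (max (- B) (min B x))" for x
  have cG: "continuous_on UNIV G"
    unfolding G_def[abs_def] by (intro continuous_on_compose2[OF F_continuous] continuous_intros) auto
  obtain \<Gamma>0 where \<Gamma>0: "0 \<le> \<Gamma>0" "\<And>x. \<bar>x\<bar> \<le> \<bar>B\<bar> \<Longrightarrow> \<bar>F x\<bar> \<le> \<Gamma>0"
    using continuous_bounded_on_cball[OF F_continuous] by blast
  have bG: "\<bar>G x\<bar> \<le> \<Gamma>0" for x unfolding G_def by (rule \<Gamma>0(2)) auto
  have conv: "sol F q s c u" if S: "sol G q s c u" and t: "gap_min r \<alpha> u" and r: "r \<in> {r1..r2}" for r s c u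
  proof -
    obtain t0 where t0: "t0 \<in> {0..T}" "u t0 - \<alpha> t0 = r" using t by (auto simp: gap_min_def)
    have "\<bar>u x\<bar> \<le> B" if "x \<in> {0..T}" for x
      using sol_oscillation_bounded[OF S q cG that t0(1)] \<alpha>b[OF t0(1)] t0(2) r unfolding B_def by auto
    then have "G (u x) = F (u x)" if "x \<in> {0..T}" for x
      using that unfolding G_def by (metis abs_le_D1 abs_le_D2 max.absorb2 min.absorb2 minus_le_iff)
    then show ?thesis by (intro sol_cong[OF S]) auto
  qed
  have "\<exists>r\<in>{r1..r2}. \<exists>s c u. sol G q s c u \<and> gap_min r \<alpha> u \<and> g r s = 0"
  proof (rule solution_continuation_bounded[OF q cG bG \<alpha> r g])
    show "g r1 s < 0" if "sol G q s c u" "gap_min r1 \<alpha> u" for s c u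
      using neg conv[OF that] that(2) r by force
    show "0 < g r2 s" if "sol G q s c u" "gap_min r2 \<alpha> u" for s c u
      using pos conv[OF that] that(2) r by force
  qed
  then show ?thesis using conv by blast
qed

end

section \<open>Lower solutions and limits\<close>

context lienard
begin

lemma solD:
  assumes "sol G q s c u"
  shows "continuous_on {0..T} u" "u 0 = u T" "integral {0..T} (\<lambda>x. a x * q (u x)) = s * T"
    "\<And>t. t \<in> {0..T} \<Longrightarrow> u t = u 0 + integral {0..t} (slope G q s c u)"
  using assms unfolding sol_def by blast+

text \<open>The strict inequality survives the weight \<open>a\<close>, which may vanish on large
  sets, because \<open>q (u t)\<close> attains its maximum on the period.\<close>

lemma mean_less:
  assumes S: "sol G q s c u" and q: "continuous_on UNIV q" and less: "\<And>t. t \<in> {0..T} \<Longrightarrow> q (u t) < \<sigma>"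
  shows "s * T < \<sigma> * integral {0..T} a"
proof -
  have cu: "continuous_on {0..T} u" and m: "integral {0..T} (\<lambda>x. a x * q (u x)) = s * T"
    by (fact solD[OF S])+
  have "continuous_on {0..T} (\<lambda>t. q (u t))" by (rule continuous_on_compose2[OF q cu]) auto
  then obtain t0 where t0: "t0 \<in> {0..T}" "\<And>t. t \<in> {0..T} \<Longrightarrow> q (u t) \<le> q (u t0)"
    using continuous_attains_sup[of "{0..T}" "\<lambda>t. q (u t)"] T by auto
  have "s * T \<le> integral {0..T} (\<lambda>x. a x * q (u t0))"
    unfolding m[symmetric]
    by (intro integral_le aq_integrable cu q integrable_on_mult_left a(1) mult_left_mono t0(2) a(2))
  also have "\<dots> = q (u t0) * integral {0..T} a" by (simp add: mult.commute)
  also have "\<dots> < \<sigma> * integral {0..T} a" using less[OF t0(1)] a(4) by simp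
  finally show ?thesis .
qed

lemma mean_greater:
  assumes S: "sol G q s c u" and q: "continuous_on UNIV q" and less: "\<And>t. t \<in> {0..T} \<Longrightarrow> \<sigma> < q (u t)"
  shows "\<sigma> * integral {0..T} a < s * T"
proof -
  have cu: "continuous_on {0..T} u" and m: "integral {0..T} (\<lambda>x. a x * q (u x)) = s * T"
    by (fact solD[OF S])+
  have "continuous_on {0..T} (\<lambda>t. q (u t))" by (rule continuous_on_compose2[OF q cu]) auto
  then obtain t0 where t0: "t0 \<in> {0..T}" "\<And>t. t \<in> {0..T} \<Longrightarrow> q (u t0) \<le> q (u t)"
    using continuous_attains_inf[of "{0..T}" "\<lambda>t. q (u t)"] T by auto
  have "\<sigma> * integral {0..T} a < q (u t0) * integral {0..T} a" using less[OF t0(1)] a(4) by simp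
  also have "\<dots> = integral {0..T} (\<lambda>x. a x * q (u t0))" by (simp add: mult.commute)
  also have "\<dots> \<le> s * T"
    unfolding m[symmetric]
    by (intro integral_le aq_integrable cu q integrable_on_mult_left a(1) mult_left_mono t0(2) a(2))
  finally show ?thesis .
qed

definition amean :: real where "amean = integral {0..T} a / T"

lemma amean: "0 < amean" "amean * T = integral {0..T} a" "s * T = s / amean * integral {0..T} a"
  using a(4) T by (auto simp: amean_def)

text \<open>By the mean condition the \<open>a\<close>-weighted average of \<open>q (u t)\<close> is
  \<open>s / amean\<close>, so no solution at level \<open>s\<close> can stay where \<open>q\<close>
  lies strictly on one side of that value. To the left only levels above the limit are considered,
  so \<open>q\<close> is below; to the right either side may occur.\<close>

definition confines :: "(real \<Rightarrow> real) \<Rightarrow> real \<Rightarrow> real \<Rightarrow> bool" where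
  "confines q s \<rho> \<longleftrightarrow> (\<forall>x\<le>-\<rho>. q x < s / amean) \<and> ((\<forall>x\<ge>\<rho>. q x < s / amean) \<or> (\<forall>x\<ge>\<rho>. q x > s / amean))"

text \<open>One value beyond the bound would keep the whole trajectory beyond \<rho>, against the
  mean condition. The constant \<open>K\<close> is separate from \<open>momentum_bound s C\<close>
  so that a single bound can serve a sequence of levels.\<close>

lemma sol_location:
  assumes S: "sol F q s c u" and q: "continuous_on UNIV q" "\<And>x. q x \<le> C" "0 \<le> C"
    and K: "momentum_bound s C \<le> K" and conf: "confines q s \<rho>" and t: "t \<in> {0..T}"
  shows "\<bar>u t\<bar> \<le> \<rho> + speed_bound K * T"
proof -
  have osc: "\<bar>u x - u y\<bar> \<le> speed_bound K * T" if "x \<in> {0..T}" "y \<in> {0..T}" for x y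
  proof -
    have "speed_bound (momentum_bound s C) * T \<le> speed_bound K * T" using speed_bound_mono[OF K] T by (intro mult_right_mono) auto
    then show ?thesis using sol_oscillation[OF S q F_continuous that] by linarith
  qed
  have no_less: "\<not> (\<forall>t\<in>{0..T}. q (u t) < s / amean)"
  proof
    assume "\<forall>t\<in>{0..T}. q (u t) < s / amean"
    then have "s * T < s / amean * integral {0..T} a" by (intro mean_less[OF S q(1)]) blast
    then show False using amean(3)[of s] by linarith
  qed
  have no_greater: "\<not> (\<forall>t\<in>{0..T}. q (u t) > s / amean)"
  proof
    assume "\<forall>t\<in>{0..T}. q (u t) > s / amean"
    then have "s / amean * integral {0..T} a < s * T" by (intro mean_greater[OF S q(1)]) blast
    then show False using amean(3)[of s] by linarith
  qed
  have "u t \<le> \<rho> + speed_bound K * T"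
  proof (rule ccontr)
    assume "\<not> u t \<le> \<rho> + speed_bound K * T"
    then have "u x \<ge> \<rho>" if "x \<in> {0..T}" for x using osc[OF t that] by linarith
    then show False using no_less no_greater conf unfolding confines_def by blast
  qed
  moreover have "- (\<rho> + speed_bound K * T) \<le> u t"
  proof (rule ccontr)
    assume "\<not> - (\<rho> + speed_bound K * T) \<le> u t"
    then have "u x \<le> - \<rho>" if "x \<in> {0..T}" for x using osc[OF t that] by linarith
    then show False using no_less conf unfolding confines_def by blast
  qed
  ultimately show ?thesis by linarith
qed

text \<open>The continuation principle is applied to the test function \<open>r' - r\<close>, which
  has the right signs at \<open>r - 1\<close> and \<open>r + 1\<close> for trivial reasons: the gap
  is prescribed and the level is left free.\<close>

lemma sol_exists:
  assumes q: "continuous_on UNIV q" "\<And>x. \<bar>q x\<bar> \<le> Q" and \<alpha>: "continuous_on {0..T} \<alpha>"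
  shows "\<exists>s c u. sol F q s c u \<and> gap_min r \<alpha> u"
proof -
  have "\<exists>r'\<in>{r - 1..r + 1}. \<exists>s c u. sol F q s c u \<and> gap_min r' \<alpha> u \<and> r' - r = 0"
    by (rule solution_continuation[OF q \<alpha>]) (auto intro!: continuous_intros)
  then show ?thesis by auto
qed

lemma sol_cong_solution:
  assumes S: "sol G q s c u" and eq: "\<And>t. t \<in> {0..T} \<Longrightarrow> w t = u t"
  shows "sol G q s c w"
proof -
  have aq: "integral {0..t} (\<lambda>x. a x * q (u x)) = integral {0..t} (\<lambda>x. a x * q (w x))" if "t \<in> {0..T}" for t
    using eq that by (intro integral_cong) auto
  have sl: "slope G q s c u t = slope G q s c w t" if "t \<in> {0..T}" for t
    unfolding slope_def H_def by (simp only: aq[OF that] eq[OF that])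
  have int: "integral {0..t} (slope G q s c u) = integral {0..t} (slope G q s c w)" if "t \<in> {0..T}" for t
    using sl that by (intro integral_cong) auto
  have T0: "0 \<in> {0..T}" "T \<in> {0..T}" using T by auto
  show ?thesis unfolding sol_def
  proof (intro conjI ballI)
    show "continuous_on {0..T} w"
      using solD(1)[OF S] by (rule continuous_on_cong[OF refl, THEN iffD2, rotated]) (rule eq)
    show "w 0 = w T" unfolding eq[OF T0(1)] eq[OF T0(2)] by (rule solD(2)[OF S])
    show "integral {0..T} (\<lambda>x. a x * q (w x)) = s * T"
      unfolding aq[OF T0(2), symmetric] by (rule solD(3)[OF S])
    show "w t = w 0 + integral {0..t} (slope G q s c w)" if "t \<in> {0..T}" for t
      unfolding eq[OF that] eq[OF T0(1)] int[OF that, symmetric] by (rule solD(4)[OF S that])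
  qed
qed

text \<open>The a priori bounds make \<open>(c, u)\<close> range in a compact set, so solutions survive in the limit.\<close>
lemma sol_limit:
  assumes S: "\<And>n. sol F q (s n) (c n) (u n)" and s: "s \<longlonglongrightarrow> s'"
    and B: "\<And>n t. t \<in> {0..T} \<Longrightarrow> \<bar>u n t\<bar> \<le> B" and K: "\<And>n. momentum_bound (s n) C \<le> K"
    and q: "continuous_on UNIV q" "\<And>x. q x \<le> C" "0 \<le> C"
  shows "\<exists>c u. sol F q s' c u"
proof -
  define L where "L = speed_bound K"
  have T0: "0 \<in> {0..T}" "T \<in> {0..T}" using T by auto
  have "0 \<le> K" using momentum_bound_nonneg[OF q(3)] K[of 0] by (rule order_trans)
  then have L0: "0 \<le> L" unfolding L_def by (rule speed_bound_nonneg)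
  have lip: "\<bar>u n x - u n y\<bar> \<le> L * \<bar>x - y\<bar>" if "x \<in> {0..T}" "y \<in> {0..T}" for n x y
  proof -
    have "speed_bound (momentum_bound (s n) C) * \<bar>x - y\<bar> \<le> L * \<bar>x - y\<bar>"
      unfolding L_def by (intro mult_right_mono speed_bound_mono K) auto
    then show ?thesis using sol_lipschitz[OF S q F_continuous that, of n] by linarith
  qed
  \<comment> \<open>Outside the period \<open>u n\<close> is arbitrary; its extension solves the
    same equation and lies in the compact set.\<close>
  define w where "w n = extension (u n)" for n
  have w: "apply_bcontfun (w n) = (\<lambda>t. u n (clamp_period t))" "w n \<in> lipschitz_ball B L" for n
    unfolding w_def using extension[of "u n" B L] B lip L0 by blast+
  have Sw: "sol F q (s n) (c n) (w n)" for n
    by (rule sol_cong_solution[OF S]) (simp add: w clamp_period(2))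
  obtain \<Gamma> where \<Gamma>: "0 \<le> \<Gamma>" "\<And>x. \<bar>x\<bar> \<le> B \<Longrightarrow> \<bar>F x\<bar> \<le> \<Gamma>"
    using continuous_bounded_on_cball[OF F_continuous] by blast
  \<comment> \<open>\<open>H\<close> vanishes at time 0, so there the momentum bound becomes a bound
    on \<open>c n\<close> itself.\<close>
  have cb: "c n \<in> {- (K + \<Gamma>)..K + \<Gamma>}" for n
  proof -
    have "\<bar>c n + H q (s n) (u n) 0 - F (u n 0)\<bar> \<le> K"
      using sol_bound[OF S q F_continuous T0(1), of n] K[of n] by linarith
    then show ?thesis using \<Gamma>(2)[OF B[OF T0(1)], of n] by (auto simp: H_ends)
  qed
  have comp: "compact ({- (K + \<Gamma>)..K + \<Gamma>} \<times> lipschitz_ball B L)"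
    by (intro compact_Times compact_Icc lipschitz_ball_compact L0)
  have mem: "\<forall>n. (c n, w n) \<in> {- (K + \<Gamma>)..K + \<Gamma>} \<times> lipschitz_ball B L" using cb w(2) by simp
  obtain l k where k: "strict_mono (k :: nat \<Rightarrow> nat)" "((\<lambda>n. (c n, w n)) \<circ> k) \<longlonglongrightarrow> l"
    by (rule seq_compactE[OF compact_imp_seq_compact[OF comp] mem])
  define c' where "c' = fst l"
  define w' where "w' = snd l"
  have clamp_period': "(\<lambda>n. c (k n)) \<longlonglongrightarrow> c'" and wl: "(\<lambda>n. w (k n)) \<longlonglongrightarrow> w'"
    using tendsto_fst[OF k(2)] tendsto_snd[OF k(2)] by (auto simp: c'_def w'_def o_def)
  have sl: "(\<lambda>n. s (k n)) \<longlonglongrightarrow> s'" using LIMSEQ_subseq_LIMSEQ[OF s k(1)] by (simp add: o_def)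
  have cw: "continuous_on {0..T} (apply_bcontfun v)" for v :: "real \<Rightarrow>\<^sub>C real" by auto
  have wB: "\<bar>w n t\<bar> \<le> B" for n t using w(2)[of n] by (simp add: lipschitz_ball_def)
  note lim = lipschitz_ball_tendsto_apply[OF wl]
  have "sol F q s' c' w'"
    unfolding sol_def
  proof (intro conjI ballI)
    have eq: "w (k n) 0 = w (k n) T" for n by (rule solD(2)[OF Sw])
    show "w' 0 = w' T" by (rule LIMSEQ_unique[OF lim[of 0]]) (unfold eq, rule lim)
    have eq2: "integral {0..T} (\<lambda>x. a x * q (w (k n) x)) = s (k n) * T" for n
      by (rule solD(3)[OF Sw])
    have "(\<lambda>n. integral {0..T} (\<lambda>x. a x * q (w (k n) x))) \<longlonglongrightarrow> integral {0..T} (\<lambda>x. a x * q (w' x))"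
      by (rule tendsto_integral_aq[OF cw wB cw lim sl clamp_period' q(1) F_continuous T0(2)])
    then have "(\<lambda>n. s (k n) * T) \<longlonglongrightarrow> integral {0..T} (\<lambda>x. a x * q (w' x))" unfolding eq2 .
    then show "integral {0..T} (\<lambda>x. a x * q (w' x)) = s' * T"
      using tendsto_mult_right[OF sl, of T] by (rule LIMSEQ_unique)
    fix t assume t: "t \<in> {0..T}"
    have eq3: "w (k n) t = w (k n) 0 + integral {0..t} (slope F q (s (k n)) (c (k n)) (w (k n)))" for n
      by (rule solD(4)[OF Sw t])
    have "(\<lambda>n. w (k n) 0 + integral {0..t} (slope F q (s (k n)) (c (k n)) (w (k n)))) \<longlonglongrightarrow>
        w' 0 + integral {0..t} (slope F q s' c' w')"
      by (intro tendsto_add lim tendsto_integral_slope[OF cw wB cw lim sl clamp_period' q(1) F_continuous t])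
    then have "(\<lambda>n. w (k n) t) \<longlonglongrightarrow> w' 0 + integral {0..t} (slope F q s' c' w')"
      unfolding eq3[symmetric] .
    then show "w' t = w' 0 + integral {0..t} (slope F q s' c' w')"
      using lim[of t] by (rule LIMSEQ_unique[rotated])
  qed (rule cw)
  then show ?thesis by blast
qed

section \<open>Solutions on either side of a solution at a higher level\<close>

context
  fixes q :: "real \<Rightarrow> real" and C s s' \<rho> d :: real and \<alpha> :: "real \<Rightarrow> real"
  assumes q: "continuous_on UNIV q" "\<And>x. q x \<le> C" "0 \<le> C"
    and A: "sol F q s' d \<alpha>" and less: "s < s'" and conf: "confines q s \<rho>"
begin

text \<open>Truncating \<open>q\<close> at a level beyond the a priori bounds makes it bounded without changing the
  solutions at level \<open>s\<close>, and makes it constant far out, where a solution thus has an explicit \<open>s\<close>.\<close>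
lemma truncation:
  "\<exists>R p Q. \<rho> \<le> R \<and> 0 < R \<and> continuous_on UNIV p \<and> (\<forall>x. \<bar>p x\<bar> \<le> Q) \<and> sol F p s' d \<alpha> \<and>
    (\<forall>c u. sol F p s c u \<longrightarrow> sol F q s c u) \<and> (\<forall>x\<le>-R. p x = q (- R)) \<and> (\<forall>x\<ge>R. p x = q R) \<and>
    (\<forall>t\<in>{0..T}. \<bar>\<alpha> t\<bar> \<le> R)"
proof -
  have "continuous_on {0..T} \<alpha>" by (rule solD(1)[OF A])
  then obtain \<alpha>b where \<alpha>b: "\<And>t. t \<in> {0..T} \<Longrightarrow> \<bar>\<alpha> t\<bar> \<le> \<alpha>b"
    using continuous_on_Icc_bounded by blast
  define W where "W = speed_bound (momentum_bound s C) * T"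
  have W0: "0 \<le> W" unfolding W_def using speed_bound_nonneg[OF momentum_bound_nonneg[OF q(3)]] T by simp
  \<comment> \<open>Large enough to leave \<alpha> untouched, through \<open>\<alpha>b\<close>, and
    all solutions at level \<open>s\<close>, through \<open>\<rho> + W\<close>. The width
    \<open>W\<close> rests on the upper bound \<open>C\<close>, which \<open>q\<close> and its
    truncation share, so that the choice of \<open>R\<close> is not circular.\<close>
  define R where "R = max 1 (max \<alpha>b (\<rho> + W))"
  have R: "1 \<le> R" "\<alpha>b \<le> R" "\<rho> + W \<le> R" by (auto simp: R_def)
  define p where "p x = q (max (- R) (min R x))" for x
  have cp: "continuous_on UNIV p"
    unfolding p_def[abs_def] by (intro continuous_on_compose2[OF q(1)] continuous_intros) auto
  have pC: "p x \<le> C" for x unfolding p_def by (rule q(2))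
  obtain Q where Q: "0 \<le> Q" "\<And>x. \<bar>x\<bar> \<le> R \<Longrightarrow> \<bar>q x\<bar> \<le> Q"
    using continuous_bounded_on_cball[OF q(1)] by blast
  have pq: "p x = q x" if "\<bar>x\<bar> \<le> R" for x
  proof -
    have "max (- R) (min R x) = x" using that by (simp add: max_def min_def abs_le_iff)
    then show ?thesis by (simp add: p_def)
  qed
  have conf': "confines p s \<rho>"
  proof -
    have 1: "max (- R) (min R x) \<le> - \<rho>" if "x \<le> - \<rho>" for x using that R W0 by auto
    have 2: "\<rho> \<le> max (- R) (min R x)" if "\<rho> \<le> x" for x using that R W0 by auto
    show ?thesis using conf 1 2 unfolding confines_def p_def by blast
  qed
  show ?thesis
  proof (rule exI[of _ R], rule exI[of _ p], rule exI[of _ Q], intro conjI allI ballI impI)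
    show "\<rho> \<le> R" "0 < R" using R W0 by auto
    show "continuous_on UNIV p" by (rule cp)
    show "\<bar>p x\<bar> \<le> Q" for x unfolding p_def using R by (intro Q(2)) auto
    show "sol F p s' d \<alpha>"
    proof (rule sol_cong[OF A])
      show "q (\<alpha> t) = p (\<alpha> t)" if "t \<in> {0..T}" for t using pq[of "\<alpha> t"] \<alpha>b[OF that] R by simp
    qed simp
    show "sol F q s c u" if S: "sol F p s c u" for c u
    proof (rule sol_cong[OF S])
      fix t assume t: "t \<in> {0..T}"
      have "\<bar>u t\<bar> \<le> \<rho> + W"
        unfolding W_def by (rule sol_location[OF S cp pC q(3) order_refl conf' t])
      then show "p (u t) = q (u t)" using R by (intro pq) linarith
    qed simp
    show "p x = q (- R)" if "x \<le> - R" for x using that R by (simp add: p_def)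
    show "p x = q R" if "R \<le> x" for x using that R by (simp add: p_def)
    show "\<bar>\<alpha> t\<bar> \<le> R" if "t \<in> {0..T}" for t using \<alpha>b[OF that] R by linarith
  qed
qed

lemma solution_not_above_lower_solution: "\<exists>c u. sol F q s c u \<and> (\<exists>t\<in>{0..T}. u t < \<alpha> t)"
proof -
  have c\<alpha>: "continuous_on {0..T} \<alpha>" by (rule solD(1)[OF A])
  obtain R p Q where R: "\<rho> \<le> R" "0 < R" and p: "continuous_on UNIV p" "\<And>x. \<bar>p x\<bar> \<le> Q"
    and Ap: "sol F p s' d \<alpha>" and pq: "\<And>c u. sol F p s c u \<Longrightarrow> sol F q s c u"
    and far: "\<And>x. x \<le> - R \<Longrightarrow> p x = q (- R)" "\<And>x. R \<le> x \<Longrightarrow> p x = q R" and \<alpha>R: "\<And>t. t \<in> {0..T} \<Longrightarrow> \<bar>\<alpha> t\<bar> \<le> R"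
    using truncation by blast
  have touch: "s < \<sigma>" if S: "sol F p \<sigma> c u" and t: "gap_min 0 \<alpha> u" for \<sigma> c u
  proof (rule ccontr)
    assume "\<not> s < \<sigma>"
    obtain t0 where "t0 \<in> {0..T}" "u t0 = \<alpha> t0" using t by (auto simp: gap_min_def)
    then show False
      using no_contact_with_lower_solution[OF S Ap _ p(1)] t \<open>\<not> s < \<sigma>\<close> less by (auto simp: gap_min_def)
  qed
  have W0: "0 \<le> osc_bound Q"
  proof -
    have "0 \<in> {0..T}" using T by auto
    then show ?thesis using sol_oscillation_bounded[OF Ap p F_continuous] by fastforce
  qed
  \<comment> \<open>Where the gap is attained \<open>u\<close> is at most \<open>R + r1\<close>; the
    oscillation then keeps \<open>u\<close> below \<open>- R\<close> on the whole period, where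
    \<open>p\<close> is constant and below \<open>s / amean\<close>.\<close>
  define r1 where "r1 = - (2 * R + osc_bound Q + 1)"
  have "\<exists>r\<in>{r1..0}. \<exists>\<sigma> c u. sol F p \<sigma> c u \<and> gap_min r \<alpha> u \<and> \<sigma> - s = 0"
  proof (rule solution_continuation[OF p c\<alpha>])
    show "r1 < 0" using R W0 by (simp add: r1_def)
    show "continuous_on UNIV (\<lambda>z :: real \<times> real. snd z - s)" by (intro continuous_intros)
    show "0 < \<sigma> - s" if "sol F p \<sigma> c u" "gap_min 0 \<alpha> u" for \<sigma> c u using touch[OF that] by simp
    show "\<sigma> - s < 0" if S: "sol F p \<sigma> c u" and t: "gap_min r1 \<alpha> u" for \<sigma> c u
    proof -
      obtain t0 where t0: "t0 \<in> {0..T}" "u t0 - \<alpha> t0 = r1" using t by (auto simp: gap_min_def)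
      have "p (u x) < s / amean" if "x \<in> {0..T}" for x
      proof -
        have "u x \<le> - R"
          using sol_oscillation_bounded[OF S p F_continuous that t0(1)] \<alpha>R[OF t0(1)] t0(2) unfolding r1_def by linarith
        then show ?thesis using far(1) R conf by (simp add: confines_def)
      qed
      then have "\<sigma> * T < s / amean * integral {0..T} a" by (rule mean_less[OF S p(1)])
      then have "\<sigma> * T < s * T" using amean(3)[of s] by linarith
      then show ?thesis using T by simp
    qed
  qed
  then obtain r c u where u: "r \<le> 0" "sol F p s c u" "gap_min r \<alpha> u" by auto
  then have "r \<noteq> 0" using touch by blast
  then have "\<exists>t\<in>{0..T}. u t < \<alpha> t" using u by (force simp: gap_min_def)
  then show ?thesis using pq[OF u(2)] by blast
qed

lemma solution_above_lower_solution:
  assumes right: "\<And>x. \<rho> \<le> x \<Longrightarrow> q x < s / amean"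
  shows "\<exists>c u. sol F q s c u \<and> (\<forall>t\<in>{0..T}. \<alpha> t \<le> u t)"
proof -
  have c\<alpha>: "continuous_on {0..T} \<alpha>" by (rule solD(1)[OF A])
  obtain R p Q where R: "\<rho> \<le> R" "0 < R" and p: "continuous_on UNIV p" "\<And>x. \<bar>p x\<bar> \<le> Q"
    and Ap: "sol F p s' d \<alpha>" and pq: "\<And>c u. sol F p s c u \<Longrightarrow> sol F q s c u"
    and far: "\<And>x. x \<le> - R \<Longrightarrow> p x = q (- R)" "\<And>x. R \<le> x \<Longrightarrow> p x = q R" and \<alpha>R: "\<And>t. t \<in> {0..T} \<Longrightarrow> \<bar>\<alpha> t\<bar> \<le> R"
    using truncation by blast
  have W0: "0 \<le> osc_bound Q"
  proof -
    have "0 \<in> {0..T}" using T by auto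
    then show ?thesis using sol_oscillation_bounded[OF Ap p F_continuous] by fastforce
  qed
  define r2 where "r2 = 2 * R + osc_bound Q + 1"
  \<comment> \<open>The test is \<open>s - \<sigma>\<close> because now the level is too high at the
    lower end \<open>r = 0\<close>, by the contact argument, and too low at the upper end.\<close>
  have "\<exists>r\<in>{0..r2}. \<exists>\<sigma> c u. sol F p \<sigma> c u \<and> gap_min r \<alpha> u \<and> s - \<sigma> = 0"
  proof (rule solution_continuation[OF p c\<alpha>])
    show "0 < r2" using R W0 by (simp add: r2_def)
    show "continuous_on UNIV (\<lambda>z :: real \<times> real. s - snd z)" by (intro continuous_intros)
    show "s - \<sigma> < 0" if S: "sol F p \<sigma> c u" and t: "gap_min 0 \<alpha> u" for \<sigma> c u
    proof (rule ccontr)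
      assume "\<not> s - \<sigma> < 0"
      obtain t0 where "t0 \<in> {0..T}" "u t0 = \<alpha> t0" using t by (auto simp: gap_min_def)
      then show False
        using no_contact_with_lower_solution[OF S Ap _ p(1)] t \<open>\<not> s - \<sigma> < 0\<close> less by (auto simp: gap_min_def)
    qed
    show "0 < s - \<sigma>" if S: "sol F p \<sigma> c u" and t: "gap_min r2 \<alpha> u" for \<sigma> c u
    proof -
      have "p (u x) < s / amean" if x: "x \<in> {0..T}" for x
      proof -
        have "r2 \<le> u x - \<alpha> x" using t x by (auto simp: gap_min_def)
        then have "R \<le> u x" using \<alpha>R[OF x] R W0 unfolding r2_def by linarith
        then show ?thesis using far(2) right R by simp
      qed
      then have "\<sigma> * T < s / amean * integral {0..T} a" by (rule mean_less[OF S p(1)])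
      then have "\<sigma> * T < s * T" using amean(3)[of s] by linarith
      then show ?thesis using T by simp
    qed
  qed
  then obtain r c u where u: "0 \<le> r" "sol F p s c u" "gap_min r \<alpha> u" by auto
  then have "\<forall>t\<in>{0..T}. \<alpha> t \<le> u t" by (force simp: gap_min_def)
  then show ?thesis using pq[OF u(2)] by blast
qed

end

end

section \<open>The main theorem\<close>

lemma continuous_bounded_above:
  fixes q :: "real \<Rightarrow> real" and \<omega>m \<omega>p :: ereal
  assumes q: "continuous_on UNIV q"
    and m: "((\<lambda>u. ereal (q u)) \<longlongrightarrow> \<omega>m) at_bot" "\<omega>m < \<infinity>"
    and p: "((\<lambda>u. ereal (q u)) \<longlongrightarrow> \<omega>p) at_top" "\<omega>p < \<infinity>"
  obtains C where "0 \<le> C" "\<And>x. q x \<le> C"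
proof -
  obtain A where A: "\<omega>m < ereal A" using m(2) less_PInf_Ex_of_nat by force
  obtain B where B: "\<omega>p < ereal B" using p(2) less_PInf_Ex_of_nat by force
  obtain x0 where x0: "\<And>x. x \<le> x0 \<Longrightarrow> q x < A"
    using order_tendstoD(2)[OF m(1) A] by (auto simp: eventually_at_bot_linorder)
  obtain x1 where x1: "\<And>x. x \<ge> x1 \<Longrightarrow> q x < B"
    using order_tendstoD(2)[OF p(1) B] by (auto simp: eventually_at_top_linorder)
  obtain Q where Q: "0 \<le> Q" "\<And>x. \<bar>x\<bar> \<le> max \<bar>x0\<bar> \<bar>x1\<bar> \<Longrightarrow> \<bar>q x\<bar> \<le> Q"
    using continuous_bounded_on_cball[OF q] by blast
  show ?thesis
  proof (rule that[of "max Q (max A B)"])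
    fix x
    consider "x \<le> x0" | "x \<ge> x1" | "\<bar>x\<bar> \<le> max \<bar>x0\<bar> \<bar>x1\<bar>" by linarith
    then show "q x \<le> max Q (max A B)"
    proof cases
      case 1 then show ?thesis using x0[of x] by linarith
    next
      case 2 then show ?thesis using x1[of x] by linarith
    next
      case 3 then show ?thesis using Q(2)[of x] by linarith
    qed
  qed (use Q in auto)
qed

lemma ereal_mult_less_iff:
  assumes "0 < m"
  shows "ereal m * \<omega> < ereal s \<longleftrightarrow> \<omega> < ereal (s / m)"
  using assms by (cases \<omega>) (auto simp: field_simps)

context lienard
begin

section \<open>Solvable levels and their supremum\<close>

context
  fixes q :: "real \<Rightarrow> real" and D :: real and \<omega>m \<omega>p :: ereal
  assumes q: "continuous_on UNIV q"
    and lim_m: "((\<lambda>u. ereal (q u)) \<longlongrightarrow> \<omega>m) at_bot"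
    and lim_p: "((\<lambda>u. ereal (q u)) \<longlongrightarrow> \<omega>p) at_top"
    and q_m: "\<And>u. u \<le> - D \<Longrightarrow> \<omega>m < ereal (q u)"
    and q_p: "\<And>u. D \<le> u \<Longrightarrow> \<omega>p < ereal (q u)"
begin

text \<open>A limit strictly below some real value is not +\<infinity>. The upper bound on
  \<open>q\<close> behind all a priori estimates originates here.\<close>

lemma limits_finite_above: "\<omega>m < \<infinity>" "\<omega>p < \<infinity>"
  using q_m[of "- D"] q_p[of D] by (auto intro: less_trans)

lemma less_at_right:
  assumes "\<omega>p < ereal \<sigma>"
  shows "\<exists>\<rho>\<ge>0. \<forall>x\<ge>\<rho>. q x < \<sigma>"
proof -
  obtain x0 where "\<And>x. x \<ge> x0 \<Longrightarrow> q x < \<sigma>"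
    using order_tendstoD(2)[OF lim_p assms] by (auto simp: eventually_at_top_linorder)
  then show ?thesis by (intro exI[of _ "max 0 x0"]) auto
qed

lemma less_at_left:
  assumes "\<omega>m < ereal \<sigma>"
  shows "\<exists>\<rho>\<ge>0. \<forall>x\<le>-\<rho>. q x < \<sigma>"
proof -
  obtain x0 where "\<And>x. x \<le> x0 \<Longrightarrow> q x < \<sigma>"
    using order_tendstoD(2)[OF lim_m assms] by (auto simp: eventually_at_bot_linorder)
  then show ?thesis by (intro exI[of _ "max 0 (- x0)"]) auto
qed

text \<open>Convergence to a limit equal to \<sigma> says nothing about the side on which
  \<open>q\<close> lies; the strict inequality assumed beyond \<open>D\<close> does.\<close>

lemma greater_at_right:
  assumes "\<not> \<omega>p < ereal \<sigma>"
  shows "\<forall>x\<ge>D. q x > \<sigma>"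
proof (intro allI impI)
  fix x assume "D \<le> x"
  then have "ereal \<sigma> < ereal (q x)" using assms q_p[of x] by (meson le_less_trans not_less)
  then show "\<sigma> < q x" by simp
qed

text \<open>Uniformity in \<open>s\<close> on an interval ending at \<open>\<tau>\<close>: if \<open>\<tau> / amean > \<omega>p\<close>, then solutions far to
  the right have too small a mean of \<open>q(u)\<close>; otherwise the hypothesis on \<open>q\<close> makes this mean exceed \<open>\<tau> / amean\<close>.\<close>
lemma confines_near:
  assumes "\<omega>m < ereal (\<tau> / amean)"
  shows "\<exists>\<tau>'<\<tau>. \<exists>\<rho>\<ge>0. \<forall>s. \<tau>' < s \<and> s \<le> \<tau> \<longrightarrow> confines q s \<rho>"
proof -
  obtain \<sigma>1 where \<sigma>1: "\<omega>m < ereal \<sigma>1" "\<sigma>1 < \<tau> / amean"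
    using ereal_dense2[OF assms] by auto
  obtain \<rho>1 where \<rho>1: "0 \<le> \<rho>1" "\<And>x. x \<le> - \<rho>1 \<Longrightarrow> q x < \<sigma>1" using less_at_left[OF \<sigma>1(1)] by blast
  show ?thesis
  proof (cases "\<omega>p < ereal (\<tau> / amean)")
    case True
    obtain \<sigma>2 where \<sigma>2: "\<omega>p < ereal \<sigma>2" "\<sigma>2 < \<tau> / amean"
      using ereal_dense2[OF True] by auto
    obtain \<rho>2 where \<rho>2: "0 \<le> \<rho>2" "\<And>x. \<rho>2 \<le> x \<Longrightarrow> q x < \<sigma>2" using less_at_right[OF \<sigma>2(1)] by blast
    show ?thesis
    proof (rule exI[of _ "amean * max \<sigma>1 \<sigma>2"], rule conjI, goal_cases)
      case 1
      show ?case using \<sigma>1(2) \<sigma>2(2) amean(1) by (simp add: max_def field_simps)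
    next
      case 2
      have "confines q s (max \<rho>1 \<rho>2)" if "amean * max \<sigma>1 \<sigma>2 < s" for s
      proof -
        have *: "max \<sigma>1 \<sigma>2 < s / amean" using that amean(1) by (simp only: pos_less_divide_eq mult.commute)
        show ?thesis unfolding confines_def
        proof (intro conjI disjI1 allI impI)
          show "q x < s / amean" if "x \<le> - max \<rho>1 \<rho>2" for x using \<rho>1(2)[of x] that * by linarith
          show "q x < s / amean" if "max \<rho>1 \<rho>2 \<le> x" for x using \<rho>2(2)[of x] that * by linarith
        qed
      qed
      then show ?case using \<rho>1(1) by (intro exI[of _ "max \<rho>1 \<rho>2"]) auto
    qed
  next
    case False
    show ?thesis
    proof (rule exI[of _ "amean * \<sigma>1"], rule conjI, goal_cases)
      case 1
      show ?case using \<sigma>1(2) amean(1) by (simp add: field_simps)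
    next
      case 2
      have "confines q s (max \<rho>1 D)" if s: "amean * \<sigma>1 < s" "s \<le> \<tau>" for s
      proof -
        have 1: "\<sigma>1 < s / amean" using s(1) amean(1) by (simp only: pos_less_divide_eq mult.commute)
        have 2: "s / amean \<le> \<tau> / amean" using s(2) amean(1) by (simp add: divide_right_mono)
        show ?thesis unfolding confines_def
        proof (intro conjI disjI2 allI impI)
          show "q x < s / amean" if "x \<le> - max \<rho>1 D" for x using \<rho>1(2)[of x] that 1 by linarith
          show "s / amean < q x" if "max \<rho>1 D \<le> x" for x
            using greater_at_right[OF False, rule_format, of x] that 2 by linarith
        qed
      qed
      then show ?case using \<rho>1(1) by (intro exI[of _ "max \<rho>1 D"]) auto
    qed
  qed
qed

lemma confines_at:
  assumes "\<omega>m < ereal (s / amean)"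
  obtains \<rho> where "0 \<le> \<rho>" "confines q s \<rho>"
  using confines_near[OF assms] by blast

text \<open>If the left limit is -\<infinity>, any solvable level will do: the right limit is then
  real, so \<open>q\<close> frozen to the left of \<open>D\<close> is bounded, and a solution with
  minimum \<open>D\<close> sees only \<open>q\<close>. Otherwise \<open>q\<close> is frozen to the
  right of \<open>- D\<close>, and a solution below \<open>- D\<close> has \<open>q (u t)\<close>
  above the left limit throughout, hence also its mean.\<close>

lemma solvable_above_omega_minus:
  assumes max_fin: "max \<omega>m \<omega>p > -\<infinity>"
  shows "\<exists>s c u. sol F q s c u \<and> \<omega>m < ereal (s / amean)"
proof -
  obtain C where C: "0 \<le> C" "\<And>x. q x \<le> C"
    using continuous_bounded_above[OF q lim_m limits_finite_above(1) lim_p limits_finite_above(2)] by blast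
  have c0: "continuous_on {0..T} (\<lambda>_. 0::real)" by simp
  show ?thesis
  proof (cases "\<omega>m = -\<infinity>")
    case True
    then obtain b where b: "\<omega>p = ereal b" using max_fin limits_finite_above(2) by (cases \<omega>p) auto
    define p where "p x = q (max D x)" for x
    have cp: "continuous_on UNIV p"
      unfolding p_def[abs_def] by (intro continuous_on_compose2[OF q] continuous_intros) auto
    have pb: "\<bar>p x\<bar> \<le> C + \<bar>b\<bar>" for x
      using C(2)[of "max D x"] q_p[of "max D x"] C(1) unfolding p_def b by auto
    obtain s c u where u: "sol F p s c u" "gap_min D (\<lambda>_. 0) u" using sol_exists[OF cp pb c0] by blast
    have "sol F q s c u"
    proof (rule sol_cong[OF u(1)])
      fix t assume "t \<in> {0..T}"
      then have "D \<le> u t" using u(2) by (auto simp: gap_min_def)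
      then show "p (u t) = q (u t)" by (simp add: p_def)
    qed simp
    then show ?thesis using True by auto
  next
    case False
    then obtain b where b: "\<omega>m = ereal b" using limits_finite_above(1) by (cases \<omega>m) auto
    define p where "p x = q (min (- D) x)" for x
    have cp: "continuous_on UNIV p"
      unfolding p_def[abs_def] by (intro continuous_on_compose2[OF q] continuous_intros) auto
    have pb: "\<bar>p x\<bar> \<le> C + \<bar>b\<bar>" for x
      using C(2)[of "min (- D) x"] q_m[of "min (- D) x"] C(1) unfolding p_def b by auto
    \<comment> \<open>The minimum is placed one oscillation below \<open>- D\<close>, so that the
      maximum does not exceed \<open>- D\<close>.\<close>
    obtain s c u where u: "sol F p s c u" "gap_min (- D - osc_bound (C + \<bar>b\<bar>)) (\<lambda>_. 0) u"
      using sol_exists[OF cp pb c0] by blast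
    obtain t0 where t0: "t0 \<in> {0..T}" "u t0 = - D - osc_bound (C + \<bar>b\<bar>)"
      using u(2) by (auto simp: gap_min_def)
    have uD: "u t \<le> - D" if "t \<in> {0..T}" for t
      using sol_oscillation_bounded[OF u(1) cp pb F_continuous that t0(1)] t0(2) by linarith
    have S: "sol F q s c u"
    proof (rule sol_cong[OF u(1)])
      show "p (u t) = q (u t)" if "t \<in> {0..T}" for t using uD[OF that] by (simp add: p_def min_def)
    qed simp
    have "b * integral {0..T} a < s * T"
    proof (rule mean_greater[OF S q])
      show "b < q (u t)" if "t \<in> {0..T}" for t using q_m[OF uD[OF that]] by (simp add: b)
    qed
    then have "b * integral {0..T} a < s / amean * integral {0..T} a" using amean(3)[of s] by linarith
    then have "b < s / amean" using a(4) by (rule mult_right_less_imp_less[OF _ less_imp_le])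
    then show ?thesis using S b by auto
  qed
qed

theorem ambrosetti_prodi:
  assumes max_fin: "max \<omega>m \<omega>p > -\<infinity>"
  shows "\<exists>s0. \<omega>m < ereal (s0 / amean) \<and> (\<forall>s>s0. \<nexists>u c. sol F q s c u) \<and> (\<exists>u c. sol F q s0 c u) \<and>
    (\<forall>s. \<omega>m < ereal (s / amean) \<and> s < s0 \<longrightarrow> (\<exists>u c. sol F q s c u)) \<and>
    (\<forall>s. max \<omega>m \<omega>p < ereal (s / amean) \<and> s < s0 \<longrightarrow>
      (\<exists>u1 u2. (\<exists>c. sol F q s c u1) \<and> (\<exists>c. sol F q s c u2) \<and> (\<exists>t\<in>{0..T}. u1 t \<noteq> u2 t)))"
proof -
  obtain C where C: "0 \<le> C" "\<And>x. q x \<le> C"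
    using continuous_bounded_above[OF q lim_m limits_finite_above(1) lim_p limits_finite_above(2)] by blast
  define \<S> where "\<S> = {s. \<exists>c u. sol F q s c u}"
  obtain s1 where s1: "s1 \<in> \<S>" "\<omega>m < ereal (s1 / amean)"
    using solvable_above_omega_minus[OF max_fin] by (auto simp: \<S>_def)
  have upper: "s \<le> (C + 1) * amean" if s: "s \<in> \<S>" for s
  proof -
    obtain c u where S: "sol F q s c u" using s by (auto simp: \<S>_def)
    have "s * T < (C + 1) * integral {0..T} a"
    proof (rule mean_less[OF S q])
      show "q (u t) < C + 1" for t using C(2)[of "u t"] by simp
    qed
    then have "s * T < (C + 1) * amean * T" using amean(2) by (simp add: mult.assoc)
    then show ?thesis using T by simp
  qed
  have bdd: "bdd_above \<S>" using upper by (auto simp: bdd_above_def)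
  have ne: "\<S> \<noteq> {}" using s1 by auto
  define s0 where "s0 = Sup \<S>"
  have s10: "s1 \<le> s0" unfolding s0_def by (rule cSup_upper[OF s1(1) bdd])
  have less_mono: "\<omega>m < ereal (s / amean)" if "\<omega>m < ereal (r / amean)" "r \<le> s" for r s
    using that amean(1) by (metis divide_right_mono ereal_less_eq(3) less_imp_le less_le_trans)
  have s0m: "\<omega>m < ereal (s0 / amean)" by (rule less_mono[OF s1(2) s10])
  have none: "\<nexists>u c. sol F q s c u" if "s0 < s" for s
    using that cSup_upper[OF _ bdd, of s] by (auto simp: s0_def \<S>_def)
  have attained: "\<exists>u c. sol F q s0 c u"
  proof -
    obtain \<tau>' \<rho> where \<tau>: "\<tau>' < s0" "0 \<le> \<rho>" "\<And>s. \<tau>' < s \<Longrightarrow> s \<le> s0 \<Longrightarrow> confines q s \<rho>"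
      using confines_near[OF s0m] by blast
    \<comment> \<open>Levels are taken above \<open>\<tau>'\<close> so that one \<rho> confines all
      the solutions, which gives the uniform bound for \<open>sol_limit\<close>.\<close>
    have "\<exists>s c u. sol F q s c u \<and> max \<tau>' (s0 - 1 / Suc n) < s \<and> s \<le> s0" for n
    proof -
      have "max \<tau>' (s0 - 1 / Suc n) < Sup \<S>" using \<tau>(1) by (simp add: s0_def)
      then obtain s where "s \<in> \<S>" "max \<tau>' (s0 - 1 / Suc n) < s" using less_cSupE[OF _ ne] by blast
      then show ?thesis using cSup_upper[OF _ bdd, of s] unfolding \<S>_def s0_def by blast
    qed
    then obtain s c u where su: "\<And>n. sol F q (s n) (c n) (u n)"
      "\<And>n. max \<tau>' (s0 - 1 / Suc n) < s n" "\<And>n. s n \<le> s0" by metis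
    have sl: "s \<longlonglongrightarrow> s0"
    proof (rule tendsto_sandwich)
      show "eventually (\<lambda>n. s0 - 1 / Suc n \<le> s n) sequentially" using su(2) by (intro always_eventually) (auto intro: less_imp_le)
      show "eventually (\<lambda>n. s n \<le> s0) sequentially" using su(3) by simp
      have "(\<lambda>n. s0 - 1 / real (Suc n)) \<longlonglongrightarrow> s0 - 0"
        by (intro tendsto_diff tendsto_const LIMSEQ_Suc[OF lim_1_over_n])
      then show "(\<lambda>n. s0 - 1 / real (Suc n)) \<longlonglongrightarrow> s0" by simp
    qed simp
    define K where "K = 2 * (\<bar>\<tau>'\<bar> + \<bar>s0\<bar>) * T + integral {0..T} (\<lambda>t. \<bar>e t\<bar>) + 2 * C * integral {0..T} a"
    have K: "momentum_bound (s n) C \<le> K" for n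
    proof -
      have "\<bar>s n\<bar> \<le> \<bar>\<tau>'\<bar> + \<bar>s0\<bar>" using su(2,3)[of n] by linarith
      then show ?thesis unfolding momentum_bound_def K_def using T by simp
    qed
    have B: "\<bar>u n t\<bar> \<le> \<rho> + speed_bound K * T" if "t \<in> {0..T}" for n t
      using sol_location[OF su(1) q C(2,1) K \<tau>(3) that] su(2,3)[of n] by simp
    show ?thesis using sol_limit[OF su(1) sl B K q C(2,1)] by blast
  qed
  \<comment> \<open>The solution at the top level itself serves as \<alpha> for every smaller
    level.\<close>
  have below: "\<exists>s' d \<alpha>. s < s' \<and> sol F q s' d \<alpha>" if "s < s0" for s
    using attained that by blast
  have one: "\<exists>u c. sol F q s c u" if s: "\<omega>m < ereal (s / amean)" "s < s0" for s
  proof -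
    obtain \<rho> where "confines q s \<rho>" using confines_at[OF s(1)] by blast
    then show ?thesis
      using below[OF s(2)] solution_not_above_lower_solution[OF q C(2,1)] by blast
  qed
  have two: "\<exists>u1 u2. (\<exists>c. sol F q s c u1) \<and> (\<exists>c. sol F q s c u2) \<and> (\<exists>t\<in>{0..T}. u1 t \<noteq> u2 t)"
    if s: "max \<omega>m \<omega>p < ereal (s / amean)" "s < s0" for s
  proof -
    obtain \<rho>1 where \<rho>1: "0 \<le> \<rho>1" "\<forall>x\<le>-\<rho>1. q x < s / amean" using less_at_left[of "s / amean"] s(1) by auto
    obtain \<rho>2 where \<rho>2: "0 \<le> \<rho>2" "\<forall>x\<ge>\<rho>2. q x < s / amean" using less_at_right[of "s / amean"] s(1) by auto
    define \<rho> where "\<rho> = max \<rho>1 \<rho>2"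
    have right: "\<And>x. \<rho> \<le> x \<Longrightarrow> q x < s / amean" using \<rho>2 by (simp add: \<rho>_def)
    have conf: "confines q s \<rho>" unfolding confines_def using \<rho>1 right by (auto simp: \<rho>_def)
    obtain s' d \<alpha> where A: "s < s'" "sol F q s' d \<alpha>" using below[OF s(2)] by blast
    obtain c1 u1 where 1: "sol F q s c1 u1" "\<exists>t\<in>{0..T}. u1 t < \<alpha> t"
      using solution_not_above_lower_solution[OF q C(2,1) A(2,1) conf] by blast
    obtain c2 u2 where 2: "sol F q s c2 u2" "\<forall>t\<in>{0..T}. \<alpha> t \<le> u2 t"
      using solution_above_lower_solution[OF q C(2,1) A(2,1) conf right] by blast
    have "\<exists>t\<in>{0..T}. u1 t \<noteq> u2 t" using 1(2) 2(2) by force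
    then show ?thesis using 1(1) 2(1) by blast
  qed
  show ?thesis using s0m none attained one two by blast
qed

end

end

section \<open>From almost everywhere hypotheses to pointwise ones\<close>

theorem theorem4p4:
  fixes phi f q a e :: "real \<Rightarrow> real" and T D :: real and \<omega>m \<omega>p :: ereal
  assumes T: "T > 0"
    and phi_homeo: "strict_mono phi" "\<exists>g. homeomorphism UNIV UNIV phi g" "phi 0 = 0"
    and f_cont: "continuous_on UNIV f" and q_cont: "continuous_on UNIV q"
    and a_meas: "set_borel_measurable lebesgue {0..T} a"
    and a_bdd: "\<exists>M. AE t in lebesgue. t \<in> {0..T} \<longrightarrow> \<bar>a t\<bar> \<le> M"
    and a_nonneg: "AE t in lebesgue. t \<in> {0..T} \<longrightarrow> a t \<ge> 0"
    and a_mean: "(LINT t:{0..T}|lebesgue. a t) / T > 0"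
    and e_int: "set_integrable lebesgue {0..T} e"
    and e_mean: "(LINT t:{0..T}|lebesgue. e t) / T = 0"
    and lim_m: "((\<lambda>u. ereal (q u)) \<longlongrightarrow> \<omega>m) at_bot"
    and lim_p: "((\<lambda>u. ereal (q u)) \<longlongrightarrow> \<omega>p) at_top"
    and D: "D > 0"
    and q_m: "\<forall>u\<le>-D. ereal (q u) > \<omega>m"
    and q_p: "\<forall>u\<ge>D. ereal (q u) > \<omega>p"
    and max_fin: "max \<omega>m \<omega>p > -\<infinity>"
  shows "\<exists>s0::real.
      ereal ((LINT t:{0..T}|lebesgue. a t) / T) * \<omega>m < ereal s0 \<and>
      (\<forall>s>s0. \<not> (\<exists>u. periodic_sol phi f a q e s T u)) \<and>
      (\<exists>u. periodic_sol phi f a q e s0 T u) \<and>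
      (\<forall>s. ereal ((LINT t:{0..T}|lebesgue. a t) / T) * \<omega>m < ereal s \<and> s < s0 \<longrightarrow>
           (\<exists>u. periodic_sol phi f a q e s T u)) \<and>
      (\<forall>s. ereal ((LINT t:{0..T}|lebesgue. a t) / T) * max \<omega>m \<omega>p < ereal s \<and> s < s0 \<longrightarrow>
           (\<exists>u1 u2. periodic_sol phi f a q e s T u1 \<and> periodic_sol phi f a q e s T u2 \<and>
                    (\<exists>t\<in>{0..T}. u1 t \<noteq> u2 t)))"
proof -
  obtain psi where psi: "homeomorphism UNIV UNIV phi psi" using phi_homeo(2) by blast
  have pp: "phi (psi y) = y" "psi (phi x) = x" for x y
    using psi by (auto simp: homeomorphism_def)
  have psi_mono: "strict_mono psi"
  proof (rule strict_monoI)
    fix x y :: real assume "x < y"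
    then have "phi (psi x) < phi (psi y)" by (simp add: pp)
    then show "psi x < psi y" using strict_mono_less[OF phi_homeo(1)] by blast
  qed
  obtain F where F: "\<And>x. (F has_real_derivative f x) (at x)"
    using continuous_has_antiderivative[OF f_cont] by blast
  obtain M0 where M0: "AE t in lebesgue. t \<in> {0..T} \<longrightarrow> \<bar>a t\<bar> \<le> M0" using a_bdd by blast
  define M where "M = max 0 M0"
  \<comment> \<open>A version of \<open>a\<close> with values between 0 and \<open>M\<close>
    everywhere. The indicator turns measurability on the period into measurability on the line, and
    \<open>M\<close> is at least 0 so that the bound also holds off the period.\<close>
  define b where "b t = max 0 (min M (indicat_real {0..T} t *\<^sub>R a t))" for t
  have b: "0 \<le> b t" "b t \<le> M" for t by (auto simp: b_def M_def)
  have aim: "(\<lambda>t. indicat_real {0..T} t *\<^sub>R a t) \<in> borel_measurable lebesgue"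
    using a_meas by (simp add: set_borel_measurable_def)
  have bm: "b \<in> borel_measurable lebesgue"
    unfolding b_def[abs_def] by (intro borel_measurable_max borel_measurable_min borel_measurable_const aim)
  have ibm: "(\<lambda>t. indicat_real {0..T} t *\<^sub>R b t) \<in> borel_measurable lebesgue"
    by (intro borel_measurable_scaleR borel_measurable_indicator bm) auto
  have ab: "AE t in lebesgue. t \<in> {0..T} \<longrightarrow> a t = b t"
    using M0 a_nonneg by eventually_elim (auto simp: b_def M_def)
  then have ba: "AE t in lebesgue. t \<in> {0..T} \<longrightarrow> b t = a t" by eventually_elim auto
  have bint: "set_integrable lebesgue {0..T} b"
    unfolding set_integrable_def
  proof (rule Bochner_Integration.integrable_bound[where f = "\<lambda>t. indicat_real {0..T} t *\<^sub>R M"])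
    show "integrable lebesgue (\<lambda>t. indicat_real {0..T} t *\<^sub>R M)"
      using absolutely_integrable_continuous_real[of 0 T "\<lambda>_. M"] by (simp add: set_integrable_def)
    show "AE t in lebesgue. norm (indicat_real {0..T} t *\<^sub>R b t) \<le> norm (indicat_real {0..T} t *\<^sub>R M)"
      using b by (intro AE_I2) (auto simp: indicator_def M_def)
  qed (rule ibm)
  have ab_int: "(LINT t:{0..T}|lebesgue. a t) = integral {0..T} b"
  proof -
    have "(LINT t:{0..T}|lebesgue. a t) = (LINT t:{0..T}|lebesgue. b t)"
      unfolding set_lebesgue_integral_def
    proof (rule integral_cong_AE)
      show "AE t in lebesgue. indicat_real {0..T} t *\<^sub>R a t = indicat_real {0..T} t *\<^sub>R b t"
        using ab by eventually_elim (auto simp: indicator_def)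
    qed (rule aim ibm)+
    also have "\<dots> = integral {0..T} b" by (rule set_lebesgue_integral_eq_integral(2)[OF bint])
    finally show ?thesis .
  qed
  have e0: "integral {0..T} e = 0"
    using e_mean T set_lebesgue_integral_eq_integral(2)[OF e_int] by simp
  interpret lienard T M phi psi f F b e
  proof
    show "0 < T" by (rule T)
    show "continuous_on UNIV psi" using psi by (simp add: homeomorphism_def)
    show "psi 0 = 0" using pp(2)[of 0] phi_homeo(3) by simp
    show "b integrable_on {0..T}" using set_lebesgue_integral_eq_integral(1)[OF bint] .
    show "0 < integral {0..T} b" using a_mean T by (simp add: ab_int zero_less_divide_iff)
  qed (use psi_mono pp F f_cont b e_int e0 in auto)
  have am: "(LINT t:{0..T}|lebesgue. a t) / T = amean" by (simp add: ab_int amean_def)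
  have iff: "(\<exists>c. sol F q s c u) \<longleftrightarrow> periodic_sol phi f a q e s T u" for s u
    using sol_imp_periodic_sol[OF _ q_cont] periodic_sol_imp_sol[OF _ q_cont]
      periodic_sol_cong_AE[OF ab] periodic_sol_cong_AE[OF ba] by blast
  show ?thesis
    unfolding am ereal_mult_less_iff[OF amean(1)] iff[symmetric]
    by (rule ambrosetti_prodi[OF q_cont lim_m lim_p q_m[rule_format] q_p[rule_format] max_fin])
qed

end
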